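(* There exist universal constants $C, C' > 0$ and a polynomial $P$ in five variables with universal coefficients such that the following holds. For every linear combinatorial semi-bandit problem with independent items and $\sigma^2$-subgaussian rewards (as described in the context), with dimension $d$, maximal action size $m$, minimal gap $\Delta_{\min}$ and maximal gap $\Delta_{\max}$, and for every horizon $T\ge 2$, the regret of the algorithm BG-CTS run with parameter $\lambda = 1$ satisfies $$R(T,\mu^\star) \le C\, \frac{\sigma^2 d \ln m}{\Delta_{\min}} \ln T + C'\, \frac{\sigma^2 d^2 m \ln m}{\Delta_{\min}} \ln\ln T + P\Big(m, d, \frac{1}{\Delta_{\min}}, \Delta_{\max}, \sigma\Big).$$
   Context: Setting (linear combinatorial semi-bandit). $\mathcal{A} \subset \{0,1\}^d$ is a known set of actions; an action $A$ is identified with the set of items $i\in\{1,\dots,d\}$ with $A_i=1$. The vectors $X(1),X(2),\dots\in\mathbb{R}^d$ are i.i.d., with independent entries and mean $\mu^\star$ (unknown to the learner), and are $\sigma^2$-subgaussian: $\mathbb{E}[\exp(u^\top X(t))] \le \exp(u^\top\mu^\star + \|u\|_2^2\sigma^2/2)$ for all $u\in\mathbb{R}^d$; $\sigma$ is known to the learner. At each round $t\in\{1,\dots,T\}$ the learner selects $A(t)\in\mathcal{A}$ on the basis of past observations (and internal randomness), then observes $A(t)\odot X(t)$ (entrywise product) and obtains the reward $A(t)^\top X(t)$. The optimal action $A^\star = \arg\max_{A\in\mathcal{A}} A^\top\mu^\star$ is assumed unique. The gaps are $\Delta_A = (A^\star)^\top\mu^\star - A^\top\mu^\star$, $\Delta_{\min}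 = \min_{A\in\mathcal{A}:\Delta_A>0}\Delta_A$, $\Delta_{\max} = \max_{A\in\mathcal{A}}\Delta_A$; $m = \max_{A\in\mathcal{A}}\|A\|_1$. The regret is $R(T,\mu^\star) = \mathbb{E}\big[\sum_{t=1}^T \Delta_{A(t)}\big]$. Algorithm BG-CTS (Boosted Gaussian Combinatorial Thompson Sampling) with parameter $\lambda>0$. Initialization: take $d$ actions $A^1,\dots,A^d\in\mathcal{A}$ with $\sum_{i=1}^d A^i \ge 1$ entrywise, and play each of them once, so that every item has been selected at least once. Afterwards, at round $t$, let $N(t)=\sum_{s=1}^{t-1}A(s)$ (number of times each item was selected), $V(t)=\mathrm{diag}(1/N_1(t),\dots,1/N_d(t))$, and let $\hat\mu(t) = V(t)\sum_{s=1}^{t-1} X(s)\odot A(s)$ be the empirical mean. Define $$f(t) = (1+\lambda)\Big(\ln t + (m+2)\ln\ln t + \frac{m}{2}\ln\Big(1+\frac{e}{\lambda}\Big)\Big),\qquad g(t)=\frac{f(t)}{\ln t}.$$ The algorithm draws, conditionally on the past, $\theta(t)\sim \mathcal{N}(\hat\mu(t),\, 2 g(t)\sigma^2 V(t))$, i.e. $\theta(t)=\hat\mu(t)+\sigma\sqrt{2g(t)}\,V^{1/2}(t)Z(t)$ with $Z(1),Z(2),\dots$ i.i.d. $\mathcal{N}(0,I_d)$ independent of the rewards, and plays $A(t)\in\arg\max_{A\in\mathcal{A}}A^\top\theta(t)$.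
   Formalization: Assumes m ≥ 2 (for m = 1, ln m = 0 and the bound would be constant in T, which fails for ordinary bandits) and at least one suboptimal action, so that Δ_min is defined; runs live on one fixed sample space of real sequences, to which every run transfers with the same regret. *)

theory Defs
  imports "HOL-Probability.Probability"
begin

text \<open>
  Items are \<open>0, \<dots>, d - 1\<close>; an action is identified with its set of items, and vectors in
  \<open>\<real>\<^sup>d\<close> are functions \<open>nat \<Rightarrow> real\<close> of which only the coordinates below \<open>d\<close> are used.
\<close>

definition reward :: "(nat \<Rightarrow> real) \<Rightarrow> nat set \<Rightarrow> real" where
  "reward v B = (\<Sum>i\<in>B. v i)"

definition opt_action :: "nat set set \<Rightarrow> (nat \<Rightarrow> real) \<Rightarrow> nat set" where
  "opt_action \<A> \<mu> = arg_max_on (reward \<mu>) \<A>"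

definition gap :: "nat set set \<Rightarrow> (nat \<Rightarrow> real) \<Rightarrow> nat set \<Rightarrow> real" where
  "gap \<A> \<mu> B = reward \<mu> (opt_action \<A> \<mu>) - reward \<mu> B"

definition gap_min :: "nat set set \<Rightarrow> (nat \<Rightarrow> real) \<Rightarrow> real" where
  "gap_min \<A> \<mu> = Min {gap \<A> \<mu> B | B. B \<in> \<A> \<and> gap \<A> \<mu> B > 0}"

definition gap_max :: "nat set set \<Rightarrow> (nat \<Rightarrow> real) \<Rightarrow> real" where
  "gap_max \<A> \<mu> = Max (gap \<A> \<mu> ` \<A>)"

definition max_size :: "nat set set \<Rightarrow> nat" where
  "max_size \<A> = Max (card ` \<A>)"

text \<open>
  Statistics of one realisation: \<open>x s\<close> is the outcome vector of round \<open>s\<close>, \<open>a s\<close> the action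
  played in round \<open>s\<close>, \<open>z\<close> the Gaussian noise of the current round. They use rounds before \<open>t\<close> only.
\<close>

definition num_plays :: "(nat \<Rightarrow> nat set) \<Rightarrow> nat \<Rightarrow> nat \<Rightarrow> nat" where
  "num_plays a t i = card {s \<in> {1..<t}. i \<in> a s}"

definition emp_mean :: "(nat \<Rightarrow> nat \<Rightarrow> real) \<Rightarrow> (nat \<Rightarrow> nat set) \<Rightarrow> nat \<Rightarrow> nat \<Rightarrow> real" where
  "emp_mean x a t i =
     1 / real (num_plays a t i) * (\<Sum>s = 1..<t. if i \<in> a s then x s i else 0)"

definition boost_f :: "real \<Rightarrow> nat \<Rightarrow> nat \<Rightarrow> real" where
  "boost_f lam m t = (1 + lam) *
     (ln (real t) + (real m + 2) * ln (ln (real t)) + real m / 2 * ln (1 + exp 1 / lam))"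

definition boost_g :: "real \<Rightarrow> nat \<Rightarrow> nat \<Rightarrow> real" where
  "boost_g lam m t = boost_f lam m t / ln (real t)"

definition theta ::
  "real \<Rightarrow> real \<Rightarrow> nat \<Rightarrow> (nat \<Rightarrow> nat \<Rightarrow> real) \<Rightarrow> (nat \<Rightarrow> nat set) \<Rightarrow> (nat \<Rightarrow> real)
    \<Rightarrow> nat \<Rightarrow> nat \<Rightarrow> real" where
  "theta \<sigma> lam m x a z t i =
     emp_mean x a t i
     + \<sigma> * sqrt (2 * boost_g lam m t) * sqrt (1 / real (num_plays a t i)) * z i"

locale semi_bandit = prob_space M for M :: "'w measure" +
  fixes d :: nat and \<A> :: "nat set set" and \<mu> :: "nat \<Rightarrow> real" and \<sigma> :: real
    and X :: "nat \<Rightarrow> 'w \<Rightarrow> nat \<Rightarrow> real"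
  assumes dim_pos: "1 \<le> d"
    and actions: "\<A> \<subseteq> Pow {..<d}"
    and unique_optimum: "\<exists>!B. is_arg_max (reward \<mu>) (\<lambda>B. B \<in> \<A>) B"
    and sigma_nonneg: "0 \<le> \<sigma>"
    and X_indep: "indep_vars (\<lambda>_. borel) (\<lambda>(t, i) \<omega>. X t \<omega> i) ({1..} \<times> {..<d})"
    and X_ident: "1 \<le> t \<Longrightarrow> i < d \<Longrightarrow>
          distr M borel (\<lambda>\<omega>. X t \<omega> i) = distr M borel (\<lambda>\<omega>. X 1 \<omega> i)"
    and X_integrable: "1 \<le> t \<Longrightarrow> i < d \<Longrightarrow> integrable M (\<lambda>\<omega>. X t \<omega> i)"
    and X_mean: "1 \<le> t \<Longrightarrow> i < d \<Longrightarrow> expectation (\<lambda>\<omega>. X t \<omega> i) = \<mu> i"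
    and subgaussian_integrable: "1 \<le> t \<Longrightarrow> integrable M (\<lambda>\<omega>. exp (\<Sum>i<d. u i * X t \<omega> i))"
    and subgaussian: "1 \<le> t \<Longrightarrow>
          expectation (\<lambda>\<omega>. exp (\<Sum>i<d. u i * X t \<omega> i))
            \<le> exp ((\<Sum>i<d. u i * \<mu> i) + (\<Sum>i<d. (u i)\<^sup>2) * \<sigma>\<^sup>2 / 2)"

text \<open>
  What the learner knows when choosing the action of round \<open>t\<close>: a random seed (used for breaking
  ties), the Gaussian noise drawn so far, the past actions, and the observed (masked) outcomes.
\<close>

definition history_space :: "nat \<Rightarrow> nat \<Rightarrow>
    (real \<times> (nat \<times> nat \<Rightarrow> real) \<times> (nat \<Rightarrow> nat set) \<times> (nat \<times> nat \<Rightarrow> real)) measure" where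
  "history_space d t =
     borel \<Otimes>\<^sub>M PiM ({1..t} \<times> {..<d}) (\<lambda>_. borel)
       \<Otimes>\<^sub>M PiM {1..<t} (\<lambda>_. count_space (Pow {..<d}))
       \<Otimes>\<^sub>M PiM ({1..<t} \<times> {..<d}) (\<lambda>_. borel)"

definition history :: "nat \<Rightarrow> real \<Rightarrow> (nat \<Rightarrow> nat \<Rightarrow> real) \<Rightarrow> (nat \<Rightarrow> nat \<Rightarrow> real) \<Rightarrow>
    (nat \<Rightarrow> nat set) \<Rightarrow> nat \<Rightarrow>
    real \<times> (nat \<times> nat \<Rightarrow> real) \<times> (nat \<Rightarrow> nat set) \<times> (nat \<times> nat \<Rightarrow> real)" where
  "history d u z x a t =
     (u, (\<lambda>(s, i) \<in> {1..t} \<times> {..<d}. z s i), (\<lambda>s \<in> {1..<t}. a s),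
      (\<lambda>(s, i) \<in> {1..<t} \<times> {..<d}. if i \<in> a s then x s i else 0))"

definition traj_space :: "nat \<Rightarrow> (nat \<times> nat \<Rightarrow> real) measure" where
  "traj_space d = PiM ({1..} \<times> {..<d}) (\<lambda>_. borel)"

definition traj :: "nat \<Rightarrow> (nat \<Rightarrow> 'w \<Rightarrow> nat \<Rightarrow> real) \<Rightarrow> 'w \<Rightarrow> nat \<times> nat \<Rightarrow> real" where
  "traj d Y \<omega> = (\<lambda>(t, i) \<in> {1..} \<times> {..<d}. Y t \<omega> i)"

text \<open>
  A run of BG-CTS. Ties in the maximisation may be broken in any way that depends on the learner's
  information, including the seed \<open>U\<close>, which is independent of outcomes and Gaussian noise.
\<close>

locale bg_cts_run = semi_bandit M d \<A> \<mu> \<sigma> X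
  for M :: "'w measure" and d \<A> \<mu> \<sigma> X +
  fixes lam :: real and init :: "nat \<Rightarrow> nat set" and Z :: "nat \<Rightarrow> 'w \<Rightarrow> nat \<Rightarrow> real"
    and U :: "'w \<Rightarrow> real" and A :: "nat \<Rightarrow> 'w \<Rightarrow> nat set"
  assumes lambda_pos: "0 < lam"
    and init_actions: "init ` {1..d} \<subseteq> \<A>"
    and init_cover: "{..<d} \<subseteq> (\<Union>k\<in>{1..d}. init k)"
    and Z_indep: "indep_vars (\<lambda>_. borel) (\<lambda>(t, i) \<omega>. Z t \<omega> i) ({1..} \<times> {..<d})"
    and Z_normal: "1 \<le> t \<Longrightarrow> i < d \<Longrightarrow> distributed M lborel (\<lambda>\<omega>. Z t \<omega> i) std_normal_density"
    and Z_indep_X: "indep_var (traj_space d) (traj d X) (traj_space d) (traj d Z)"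
    and seed_measurable: "U \<in> borel_measurable M"
    and seed_indep: "indep_set
          (sets (vimage_algebra (space M) (\<lambda>\<omega>. (traj d X \<omega>, traj d Z \<omega>))
                   (traj_space d \<Otimes>\<^sub>M traj_space d)))
          (sets (vimage_algebra (space M) U borel))"
    and A_measurable: "1 \<le> t \<Longrightarrow> A t \<in> M \<rightarrow>\<^sub>M count_space (Pow {..<d})"
    and A_nonanticipating: "1 \<le> t \<Longrightarrow>
          \<exists>\<pi> \<in> history_space d t \<rightarrow>\<^sub>M count_space (Pow {..<d}).
            AE \<omega> in M. A t \<omega> =
              \<pi> (history d (U \<omega>) (\<lambda>s. Z s \<omega>) (\<lambda>s. X s \<omega>) (\<lambda>s. A s \<omega>) t)"
    and A_init: "1 \<le> t \<Longrightarrow> t \<le> d \<Longrightarrow> AE \<omega> in M. A t \<omega> = init t"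
    and A_argmax: "d < t \<Longrightarrow> AE \<omega> in M.
          is_arg_max
            (reward (theta \<sigma> lam (max_size \<A>) (\<lambda>s. X s \<omega>) (\<lambda>s. A s \<omega>) (Z t \<omega>) t))
            (\<lambda>B. B \<in> \<A>) (A t \<omega>)"

definition regret ::
  "'w measure \<Rightarrow> nat set set \<Rightarrow> (nat \<Rightarrow> real) \<Rightarrow> (nat \<Rightarrow> 'w \<Rightarrow> nat set) \<Rightarrow> nat \<Rightarrow> real" where
  "regret M \<A> \<mu> A T = (\<integral>\<omega>. (\<Sum>t = 1..T. gap \<A> \<mu> (A t \<omega>)) \<partial>M)"

definition is_polynomial5 :: "(real \<Rightarrow> real \<Rightarrow> real \<Rightarrow> real \<Rightarrow> real \<Rightarrow> real) \<Rightarrow> bool" where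
  "is_polynomial5 P \<longleftrightarrow>
     (\<exists>(n :: nat) (c :: nat \<Rightarrow> nat \<Rightarrow> nat \<Rightarrow> nat \<Rightarrow> nat \<Rightarrow> real). \<forall>x1 x2 x3 x4 x5.
        P x1 x2 x3 x4 x5 =
          (\<Sum>i1\<le>n. \<Sum>i2\<le>n. \<Sum>i3\<le>n. \<Sum>i4\<le>n. \<Sum>i5\<le>n.
             c i1 i2 i3 i4 i5 * x1 ^ i1 * x2 ^ i2 * x3 ^ i3 * x4 ^ i4 * x5 ^ i5))"

text \<open>
  HOL cannot quantify over types, so constants that are uniform over all runs have to refer to one
  fixed type of sample points. Nothing is lost by taking \<open>nat \<times> nat \<times> nat \<Rightarrow> real\<close>: a run on an
  arbitrary probability space is pushed forward along \<open>enc\<close>, which records all outcomes, Gaussian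
  noises, the seed and the actions, to a run of the same problem with the same regret; see
  \<open>bg_cts_run_on_sequences\<close> at the end.
\<close>

lemma reward_cong: "(\<And>i. i \<in> B \<Longrightarrow> v i = w i) \<Longrightarrow> reward v B = reward w B"
  unfolding reward_def by (rule sum.cong) auto

lemma indep_vars_transfer:
  assumes M: "prob_space M" and E[measurable]: "E \<in> M \<rightarrow>\<^sub>M N"
    and Y[measurable]: "\<And>p. p \<in> I \<Longrightarrow> Y p \<in> N \<rightarrow>\<^sub>M L p"
    and eq: "\<And>p \<omega>. p \<in> I \<Longrightarrow> \<omega> \<in> space M \<Longrightarrow> Y p (E \<omega>) = W p \<omega>"
    and ne: "I \<noteq> {}"
    and ind: "prob_space.indep_vars M L W I"
  shows "prob_space.indep_vars (distr M N E) L Y I"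
proof -
  interpret prob_space M by fact
  interpret D: prob_space "distr M N E" by (rule prob_space_distr) measurable
  have W[measurable]: "\<And>p. p \<in> I \<Longrightarrow> W p \<in> M \<rightarrow>\<^sub>M L p"
    using ind by (auto simp: indep_vars_def)
  have "distr (distr M N E) (Pi\<^sub>M I L) (\<lambda>x. \<lambda>i\<in>I. Y i x) = distr M (Pi\<^sub>M I L) (\<lambda>x. \<lambda>i\<in>I. W i x)"
    by (subst distr_distr, measurable) (auto intro!: distr_cong simp: eq)
  also have "\<dots> = (\<Pi>\<^sub>M i\<in>I. distr M (L i) (W i))"
    using indep_vars_iff_distr_eq_PiM'[OF ne, of W L] W ind by blast
  also have "\<dots> = (\<Pi>\<^sub>M i\<in>I. distr (distr M N E) (L i) (Y i))"
    by (intro PiM_cong refl, subst distr_distr) (auto intro!: distr_cong simp: eq)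
  finally show ?thesis
    using D.indep_vars_iff_distr_eq_PiM'[OF ne, of Y L] Y by simp
qed

lemma indep_var_transfer:
  assumes M: "prob_space M" and E[measurable]: "E \<in> M \<rightarrow>\<^sub>M N"
    and Y[measurable]: "Y1 \<in> N \<rightarrow>\<^sub>M L1" "Y2 \<in> N \<rightarrow>\<^sub>M L2"
    and eq: "\<And>\<omega>. \<omega> \<in> space M \<Longrightarrow> Y1 (E \<omega>) = W1 \<omega>" "\<And>\<omega>. \<omega> \<in> space M \<Longrightarrow> Y2 (E \<omega>) = W2 \<omega>"
    and ind: "prob_space.indep_var M L1 W1 L2 W2"
  shows "prob_space.indep_var (distr M N E) L1 Y1 L2 Y2"
proof -
  interpret prob_space M by fact
  interpret D: prob_space "distr M N E" by (rule prob_space_distr) measurable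
  have [measurable]: "W1 \<in> M \<rightarrow>\<^sub>M L1" "W2 \<in> M \<rightarrow>\<^sub>M L2"
    using ind by (auto simp: indep_var_distribution_eq)
  have "distr (distr M N E) L1 Y1 = distr M L1 W1" "distr (distr M N E) L2 Y2 = distr M L2 W2"
    "distr (distr M N E) (L1 \<Otimes>\<^sub>M L2) (\<lambda>x. (Y1 x, Y2 x)) = distr M (L1 \<Otimes>\<^sub>M L2) (\<lambda>x. (W1 x, W2 x))"
    by (subst distr_distr, measurable, auto intro!: distr_cong simp: eq)+
  then show ?thesis using ind
    by (simp add: D.indep_var_distribution_eq indep_var_distribution_eq)
qed

lemma indep_set_transfer:
  assumes M: "prob_space M" and E[measurable]: "E \<in> M \<rightarrow>\<^sub>M N"
    and Y[measurable]: "Y1 \<in> N \<rightarrow>\<^sub>M L1" "Y2 \<in> N \<rightarrow>\<^sub>M L2"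
    and eq: "\<And>\<omega>. \<omega> \<in> space M \<Longrightarrow> Y1 (E \<omega>) = W1 \<omega>" "\<And>\<omega>. \<omega> \<in> space M \<Longrightarrow> Y2 (E \<omega>) = W2 \<omega>"
    and ind: "prob_space.indep_set M (sets (vimage_algebra (space M) W1 L1))
                (sets (vimage_algebra (space M) W2 L2))"
  shows "prob_space.indep_set (distr M N E) 
      (sets (vimage_algebra (space (distr M N E)) Y1 L1))
      (sets (vimage_algebra (space (distr M N E)) Y2 L2))"
proof -
  interpret prob_space M by fact
  interpret D: prob_space "distr M N E" by (rule prob_space_distr) measurable
  have sp: "Y1 \<in> space N \<rightarrow> space L1" "Y2 \<in> space N \<rightarrow> space L2"
    using Y(1)[THEN measurable_space] Y(2)[THEN measurable_space] by auto
  have W: "W1 \<in> M \<rightarrow>\<^sub>M L1" "W2 \<in> M \<rightarrow>\<^sub>M L2"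
    using measurable_cong[of M W1 "\<lambda>\<omega>. Y1 (E \<omega>)" L1] measurable_cong[of M W2 "\<lambda>\<omega>. Y2 (E \<omega>)" L2] eq
    by simp_all
  then have sp': "W1 \<in> space M \<rightarrow> space L1" "W2 \<in> space M \<rightarrow> space L2"
    using W(1)[THEN measurable_space] W(2)[THEN measurable_space] by auto
  show ?thesis
  proof (rule D.indep_setI)
    show "sets (vimage_algebra (space (distr M N E)) Y1 L1) \<subseteq> D.events"
      using Y(1) sp by (auto simp: sets_vimage_algebra2)
    show "sets (vimage_algebra (space (distr M N E)) Y2 L2) \<subseteq> D.events"
      using Y(2) sp by (auto simp: sets_vimage_algebra2)
  next
    fix a b
    assume "a \<in> sets (vimage_algebra (space (distr M N E)) Y1 L1)"
      and "b \<in> sets (vimage_algebra (space (distr M N E)) Y2 L2)"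
    then obtain S T where S[measurable]: "S \<in> sets L1" and a: "a = Y1 -` S \<inter> space N"
      and T[measurable]: "T \<in> sets L2" and b: "b = Y2 -` T \<inter> space N"
      using sp by (auto simp: sets_vimage_algebra2)
    have Es: "E \<omega> \<in> space N" if "\<omega> \<in> space M" for \<omega>
      using measurable_space[OF E that] .
    have ab[measurable]: "a \<in> sets N" "b \<in> sets N"
      using Y S T by (auto simp: a b)
    have pa: "E -` a \<inter> space M = W1 -` S \<inter> space M" "E -` b \<inter> space M = W2 -` T \<inter> space M"
      "E -` (a \<inter> b) \<inter> space M = (W1 -` S \<inter> space M) \<inter> (W2 -` T \<inter> space M)"
      using Es by (auto simp: a b eq)
    have "prob ((W1 -` S \<inter> space M) \<inter> (W2 -` T \<inter> space M))
        = prob (W1 -` S \<inter> space M) * prob (W2 -` T \<inter> space M)"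
      by (rule indep_setD[OF ind]) (use sp' S T in \<open>auto simp: sets_vimage_algebra2\<close>)
    then show "D.prob (a \<inter> b) = D.prob a * D.prob b"
      using ab pa by (simp add: measure_distr)
  qed
qed

lemma AE_distr_finiteI:
  assumes [measurable]: "E \<in> M \<rightarrow>\<^sub>M N" "{x \<in> space N. P x} \<in> sets N"
    and "AE \<omega> in M. P (E \<omega>)"
  shows "AE x in distr M N E. P x"
  using assms by (subst AE_distr_iff) auto

lemma num_plays_sum: "real (num_plays a t i) = (\<Sum>s = 1..<t. of_bool (i \<in> a s))"
proof -
  have "{s. Suc 0 \<le> s \<and> s < t \<and> i \<in> a s} = {Suc 0..<t} \<inter> {x. i \<in> a x}" by auto
  then show ?thesis by (simp add: num_plays_def)
qed

context bg_cts_run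
begin

definition enc :: "'w \<Rightarrow> nat \<times> nat \<times> nat \<Rightarrow> real" where
  "enc \<omega> = (\<lambda>(k, t, i). if k = 2 then U \<omega>
     else if 1 \<le> t \<and> i < d then
       (if k = 0 then X t \<omega> i else if k = 1 then Z t \<omega> i else of_bool (i \<in> A t \<omega>))
     else 0)"

definition encX :: "nat \<Rightarrow> (nat \<times> nat \<times> nat \<Rightarrow> real) \<Rightarrow> nat \<Rightarrow> real" where
  "encX t w i = w (0, t, i)"
definition encZ :: "nat \<Rightarrow> (nat \<times> nat \<times> nat \<Rightarrow> real) \<Rightarrow> nat \<Rightarrow> real" where
  "encZ t w i = w (1, t, i)"
definition encU :: "(nat \<times> nat \<times> nat \<Rightarrow> real) \<Rightarrow> real" where
  "encU w = w (2, 0, 0)"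
definition encA :: "nat \<Rightarrow> (nat \<times> nat \<times> nat \<Rightarrow> real) \<Rightarrow> nat set" where
  "encA t w = {i \<in> {..<d}. w (3, t, i) = 1}"

abbreviation "enc_space \<equiv> (PiM UNIV (\<lambda>_. borel) :: (nat \<times> nat \<times> nat \<Rightarrow> real) measure)"
abbreviation "enc_measure \<equiv> distr M enc_space enc"

lemma X_meas[measurable]: "1 \<le> t \<Longrightarrow> i < d \<Longrightarrow> (\<lambda>\<omega>. X t \<omega> i) \<in> borel_measurable M"
  using X_integrable by blast

lemma Z_meas[measurable]: "1 \<le> t \<Longrightarrow> i < d \<Longrightarrow> (\<lambda>\<omega>. Z t \<omega> i) \<in> borel_measurable M"
  using Z_normal[of t i] by (auto simp: distributed_def)

lemma A_ev: 
  assumes "1 \<le> t" shows "(\<lambda>\<omega>. of_bool (i \<in> A t \<omega>) :: real) \<in> borel_measurable M"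
proof -
  have "(\<lambda>B. of_bool (i \<in> B) :: real) \<in> count_space (Pow {..<d}) \<rightarrow>\<^sub>M borel" by simp
  from measurable_compose[OF A_measurable[OF assms] this] show ?thesis .
qed

lemma enc_meas[measurable]: "enc \<in> M \<rightarrow>\<^sub>M enc_space"
proof -
  note [measurable] = seed_measurable
  have "(\<lambda>\<omega>. enc \<omega> p) \<in> borel_measurable M" for p
  proof (cases p)
    case (fields k t i)
    show ?thesis
      unfolding fields enc_def using A_ev[of t i] X_meas[of t i] Z_meas[of t i]
      by (cases "k = 2"; cases "1 \<le> t \<and> i < d"; cases "k = 0"; cases "k = 1") auto
  qed
  then show ?thesis
    by (intro measurable_PiM_single') auto
qed

lemma A_sub: "1 \<le> t \<Longrightarrow> \<omega> \<in> space M \<Longrightarrow> A t \<omega> \<subseteq> {..<d}"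
  using measurable_space[OF A_measurable, of t \<omega>] by simp

lemma enc_simps:
  assumes "\<omega> \<in> space M"
  shows "1 \<le> t \<Longrightarrow> i < d \<Longrightarrow> encX t (enc \<omega>) i = X t \<omega> i"
    "1 \<le> t \<Longrightarrow> i < d \<Longrightarrow> encZ t (enc \<omega>) i = Z t \<omega> i"
    "encU (enc \<omega>) = U \<omega>"
    "1 \<le> t \<Longrightarrow> encA t (enc \<omega>) = A t \<omega>"
  using A_sub[of t \<omega>] assms by (auto simp: encX_def encZ_def encU_def encA_def enc_def)

lemma NN_proj[measurable]: "(\<lambda>w. w p) \<in> borel_measurable enc_space"
  using measurable_component_singleton[of p UNIV "\<lambda>_. borel"] by simp

lemma encX_meas[measurable]: "(\<lambda>w. encX t w i) \<in> borel_measurable enc_space"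
  unfolding encX_def by measurable
lemma encZ_meas[measurable]: "(\<lambda>w. encZ t w i) \<in> borel_measurable enc_space"
  unfolding encZ_def by measurable
lemma encU_meas[measurable]: "encU \<in> borel_measurable enc_space"
  unfolding encU_def by measurable

lemma encA_mem[measurable]: "Measurable.pred enc_space (\<lambda>w. i \<in> encA t w)"
  unfolding encA_def by simp

lemma encA_meas[measurable]: "encA t \<in> enc_space \<rightarrow>\<^sub>M count_space (Pow {..<d})"
proof -
  have "encA t -` {B} \<inter> space enc_space \<in> sets enc_space" if B: "B \<in> Pow {..<d}" for B
  proof -
    have 1: "Measurable.pred enc_space (\<lambda>w. if i \<in> B then i \<in> encA t w else i \<notin> encA t w)" for i
      using encA_mem[of i t] by (cases "i \<in> B") (simp_all add: pred_intros_logic)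
    have "Measurable.pred enc_space
        (\<lambda>w. \<forall>i\<in>{..<d}. if i \<in> B then i \<in> encA t w else i \<notin> encA t w)"
      by (rule pred_intros_finite(3)[OF finite_lessThan 1])
    moreover have "(\<forall>i\<in>{..<d}. if i \<in> B then i \<in> encA t w else i \<notin> encA t w) \<longleftrightarrow> encA t w = B"
      for w
    proof -
      have "encA t w \<subseteq> {..<d}" by (auto simp: encA_def)
      then show ?thesis using B by (auto split: if_splits)
    qed
    ultimately have "Measurable.pred enc_space (\<lambda>w. encA t w = B)" by simp
    moreover have "encA t -` {B} \<inter> space enc_space = {w \<in> space enc_space. encA t w = B}"
      by blast
    ultimately show ?thesis by (simp only: pred_def)
  qed
  moreover have "encA t \<in> space enc_space \<rightarrow> Pow {..<d}" unfolding encA_def by blast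
  moreover have "finite (Pow {..<d})" by simp
  ultimately show ?thesis
    unfolding measurable_count_space_eq2[OF \<open>finite (Pow {..<d})\<close>] by blast
qed

lemma traj_X: "\<omega> \<in> space M \<Longrightarrow> traj d encX (enc \<omega>) = traj d X \<omega>"
  and traj_Z: "\<omega> \<in> space M \<Longrightarrow> traj d encZ (enc \<omega>) = traj d Z \<omega>"
  by (auto simp: traj_def enc_simps restrict_def fun_eq_iff)

lemma traj_meas[measurable]: "traj d encX \<in> enc_space \<rightarrow>\<^sub>M traj_space d" "traj d encZ \<in> enc_space \<rightarrow>\<^sub>M traj_space d"
  unfolding traj_def[abs_def] traj_space_def split_beta by (intro measurable_restrict encX_meas encZ_meas)+

lemma history_eq:
  assumes "\<omega> \<in> space M"
  shows "history d (encU (enc \<omega>)) (\<lambda>s. encZ s (enc \<omega>)) (\<lambda>s. encX s (enc \<omega>)) (\<lambda>s. encA s (enc \<omega>)) t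
     = history d (U \<omega>) (\<lambda>s. Z s \<omega>) (\<lambda>s. X s \<omega>) (\<lambda>s. A s \<omega>) t"
  using assms by (auto simp: history_def enc_simps restrict_def fun_eq_iff)

lemma history_meas[measurable]:
  "(\<lambda>w. history d (encU w) (\<lambda>s. encZ s w) (\<lambda>s. encX s w) (\<lambda>s. encA s w) t)
     \<in> enc_space \<rightarrow>\<^sub>M history_space d t"
  unfolding history_def history_space_def split_beta by measurable

lemma theta_eq:
  assumes "\<omega> \<in> space M" "1 \<le> t" "i < d"
  shows "theta \<sigma> lam m (\<lambda>s. encX s (enc \<omega>)) (\<lambda>s. encA s (enc \<omega>)) (encZ t (enc \<omega>)) t i
       = theta \<sigma> lam m (\<lambda>s. X s \<omega>) (\<lambda>s. A s \<omega>) (Z t \<omega>) t i"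
proof -
  have "num_plays (\<lambda>s. encA s (enc \<omega>)) t i = num_plays (\<lambda>s. A s \<omega>) t i"
    unfolding num_plays_def using assms by (intro arg_cong[where f = card]) (auto simp: enc_simps)
  moreover have "(\<Sum>s = 1..<t. if i \<in> encA s (enc \<omega>) then encX s (enc \<omega>) i else 0)
      = (\<Sum>s = 1..<t. if i \<in> A s \<omega> then X s \<omega> i else 0)"
    using assms by (intro sum.cong) (auto simp: enc_simps)
  ultimately show ?thesis
    using assms by (simp add: theta_def emp_mean_def enc_simps)
qed

lemma theta_meas[measurable]:
  "(\<lambda>w. theta \<sigma> lam m (\<lambda>s. encX s w) (\<lambda>s. encA s w) (encZ t w) t i) \<in> borel_measurable enc_space"
  unfolding theta_def emp_mean_def num_plays_sum by measurable

lemma enc_run: "bg_cts_run enc_measure d \<A> \<mu> \<sigma> encX lam init encZ encU encA"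
proof -
  interpret D: prob_space enc_measure by (rule prob_space_distr[OF enc_meas])
  have M: "prob_space M" by (rule prob_space_axioms)
  have "(1 :: nat, 0 :: nat) \<in> {1..} \<times> {..<d}" using dim_pos by simp
  then have ne: "{1 :: nat..} \<times> {..<d} \<noteq> {}" by blast
  have finA: "finite \<A>" using actions by (rule finite_subset) simp
  have X_distr: "distr enc_measure borel (\<lambda>w. encX t w i) = distr M borel (\<lambda>\<omega>. X t \<omega> i)"
    if "1 \<le> t" "i < d" for t i
    unfolding distr_distr[OF encX_meas enc_meas]
    using that by (intro distr_cong refl) (auto simp: enc_simps)
  have exp_eq: "(\<Sum>i<d. u i * encX t (enc \<omega>) i) = (\<Sum>i<d. u i * X t \<omega> i)"
    if "1 \<le> t" "\<omega> \<in> space M" for t \<omega> u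
    using that by (intro sum.cong refl) (auto simp: enc_simps)
  show ?thesis
  proof unfold_locales
    show "1 \<le> d" "\<A> \<subseteq> Pow {..<d}" "\<exists>!B. is_arg_max (reward \<mu>) (\<lambda>B. B \<in> \<A>) B" "0 \<le> \<sigma>"
      by (fact dim_pos actions unique_optimum sigma_nonneg)+
    show "0 < lam" "init ` {1..d} \<subseteq> \<A>" "{..<d} \<subseteq> (\<Union>k\<in>{1..d}. init k)"
      by (fact lambda_pos init_actions init_cover)+
    show "D.indep_vars (\<lambda>_. borel) (\<lambda>(t, i) \<omega>. encX t \<omega> i) ({1..} \<times> {..<d})"
      by (rule indep_vars_transfer[OF M enc_meas _ _ ne X_indep]) (auto simp: enc_simps)
    show "D.indep_vars (\<lambda>_. borel) (\<lambda>(t, i) \<omega>. encZ t \<omega> i) ({1..} \<times> {..<d})"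
      by (rule indep_vars_transfer[OF M enc_meas _ _ ne Z_indep]) (auto simp: enc_simps)
    show "D.indep_var (traj_space d) (traj d encX) (traj_space d) (traj d encZ)"
      by (rule indep_var_transfer[OF M enc_meas _ _ _ _ Z_indep_X]) (auto simp: traj_X traj_Z)
    show "D.indep_set
          (sets (vimage_algebra (space enc_measure) (\<lambda>\<omega>. (traj d encX \<omega>, traj d encZ \<omega>))
                   (traj_space d \<Otimes>\<^sub>M traj_space d)))
          (sets (vimage_algebra (space enc_measure) encU borel))"
      by (rule indep_set_transfer[OF M enc_meas _ _ _ _ seed_indep])
        (auto simp: traj_X traj_Z enc_simps)
    show "encU \<in> borel_measurable enc_measure" by simp
  next
    fix t i :: nat assume ti: "1 \<le> t" "i < d"
    show "distr enc_measure borel (\<lambda>\<omega>. encX t \<omega> i) = distr enc_measure borel (\<lambda>\<omega>. encX 1 \<omega> i)"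
      using X_ident[OF ti] ti by (simp add: X_distr)
    have "integrable M (\<lambda>\<omega>. encX t (enc \<omega>) i) \<longleftrightarrow> integrable M (\<lambda>\<omega>. X t \<omega> i)"
      by (intro Bochner_Integration.integrable_cong refl) (use ti in \<open>auto simp: enc_simps\<close>)
    then show "integrable enc_measure (\<lambda>\<omega>. encX t \<omega> i)"
      using X_integrable[OF ti] by (simp add: integrable_distr_eq)
    have "expectation (\<lambda>\<omega>. encX t (enc \<omega>) i) = \<mu> i"
      unfolding X_mean[OF ti, symmetric] by (intro Bochner_Integration.integral_cong refl) (use ti in \<open>auto simp: enc_simps\<close>)
    then show "D.expectation (\<lambda>\<omega>. encX t \<omega> i) = \<mu> i"
      by (simp add: integral_distr)
    have "distr enc_measure lborel (\<lambda>w. encZ t w i) = distr M lborel (\<lambda>\<omega>. Z t \<omega> i)"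
      using ti encZ_meas by (subst distr_distr[OF _ enc_meas]) (auto intro!: distr_cong simp: enc_simps)
    then show "distributed enc_measure lborel (\<lambda>\<omega>. encZ t \<omega> i) std_normal_density"
      using Z_normal[OF ti] by (simp add: distributed_def)
  next
    fix t :: nat and u assume t: "1 \<le> t"
    have "integrable M (\<lambda>\<omega>. exp (\<Sum>i<d. u i * encX t (enc \<omega>) i))
        \<longleftrightarrow> integrable M (\<lambda>\<omega>. exp (\<Sum>i<d. u i * X t \<omega> i))"
      by (intro Bochner_Integration.integrable_cong refl) (use t in \<open>auto simp: exp_eq\<close>)
    then show "integrable enc_measure (\<lambda>\<omega>. exp (\<Sum>i<d. u i * encX t \<omega> i))"
      using subgaussian_integrable[OF t, of u] by (simp add: integrable_distr_eq)
    have "expectation (\<lambda>\<omega>. exp (\<Sum>i<d. u i * encX t (enc \<omega>) i))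
        = expectation (\<lambda>\<omega>. exp (\<Sum>i<d. u i * X t \<omega> i))"
      by (intro Bochner_Integration.integral_cong refl) (use t in \<open>auto simp: exp_eq\<close>)
    then show "D.expectation (\<lambda>\<omega>. exp (\<Sum>i<d. u i * encX t \<omega> i))
            \<le> exp ((\<Sum>i<d. u i * \<mu> i) + (\<Sum>i<d. (u i)\<^sup>2) * \<sigma>\<^sup>2 / 2)"
      using subgaussian[OF t, of u] by (simp add: integral_distr)
  next
    fix t :: nat assume t: "1 \<le> t"
    show "encA t \<in> enc_measure \<rightarrow>\<^sub>M count_space (Pow {..<d})" by simp
    from A_nonanticipating[OF t] obtain \<pi>
      where \<pi>[measurable]: "\<pi> \<in> history_space d t \<rightarrow>\<^sub>M count_space (Pow {..<d})"
      and ae: "AE \<omega> in M. A t \<omega> = \<pi> (history d (U \<omega>) (\<lambda>s. Z s \<omega>) (\<lambda>s. X s \<omega>) (\<lambda>s. A s \<omega>) t)"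
      by blast
    have "AE w in enc_measure. encA t w =
       \<pi> (history d (encU w) (\<lambda>s. encZ s w) (\<lambda>s. encX s w) (\<lambda>s. encA s w) t)"
    proof (rule AE_distr_finiteI)
      have *: "finite (Pow {..<d})" by simp
      have "Measurable.pred enc_space (\<lambda>w. \<exists>B\<in>Pow {..<d}. encA t w = B \<and>
        \<pi> (history d (encU w) (\<lambda>s. encZ s w) (\<lambda>s. encX s w) (\<lambda>s. encA s w) t) = B)"
      proof (rule pred_intros_finite(4)[OF *])
        fix B assume B: "B \<in> Pow {..<d}"
        have 1: "Measurable.pred (count_space (Pow {..<d})) (\<lambda>C. C = B)" by simp
        show "Measurable.pred enc_space (\<lambda>w. encA t w = B \<and>
          \<pi> (history d (encU w) (\<lambda>s. encZ s w) (\<lambda>s. encX s w) (\<lambda>s. encA s w) t) = B)"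
          by (rule pred_intros_logic(3)[OF measurable_compose[OF encA_meas 1]
                measurable_compose[OF measurable_compose[OF history_meas \<pi>] 1]])
      qed
      also have "(\<lambda>w. \<exists>B\<in>Pow {..<d}. encA t w = B \<and>
        \<pi> (history d (encU w) (\<lambda>s. encZ s w) (\<lambda>s. encX s w) (\<lambda>s. encA s w) t) = B)
        = (\<lambda>w. encA t w = \<pi> (history d (encU w) (\<lambda>s. encZ s w) (\<lambda>s. encX s w) (\<lambda>s. encA s w) t))"
        by (auto simp: fun_eq_iff encA_def)
      finally show "{w \<in> space enc_space. encA t w =
        \<pi> (history d (encU w) (\<lambda>s. encZ s w) (\<lambda>s. encX s w) (\<lambda>s. encA s w) t)} \<in> sets enc_space"
        by simp
      show "AE \<omega> in M. encA t (enc \<omega>) = \<pi> (history d (encU (enc \<omega>)) (\<lambda>s. encZ s (enc \<omega>))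
          (\<lambda>s. encX s (enc \<omega>)) (\<lambda>s. encA s (enc \<omega>)) t)"
        using ae AE_space by eventually_elim (simp only: history_eq enc_simps(4)[OF _ t])
    qed measurable
    with \<pi> show "\<exists>\<pi> \<in> history_space d t \<rightarrow>\<^sub>M count_space (Pow {..<d}).
        AE w in enc_measure. encA t w =
          \<pi> (history d (encU w) (\<lambda>s. encZ s w) (\<lambda>s. encX s w) (\<lambda>s. encA s w) t)" 
      by blast
  next
    fix t :: nat assume t: "1 \<le> t" "t \<le> d"
    show "AE w in enc_measure. encA t w = init t"
    proof (rule AE_distr_finiteI)
      have "Measurable.pred enc_space (\<lambda>w. encA t w = init t)" 
        by (rule measurable_compose[OF encA_meas]) simp
      then show "{w \<in> space enc_space. encA t w = init t} \<in> sets enc_space" by simp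
      show "AE \<omega> in M. encA t (enc \<omega>) = init t"
        using A_init[OF t] AE_space by eventually_elim (simp only: enc_simps(4)[OF _ t(1)])
    qed measurable
  next
    fix t :: nat assume t: "d < t"
    then have t1: "1 \<le> t" by simp
    let ?th = "\<lambda>w. theta \<sigma> lam (max_size \<A>) (\<lambda>s. encX s w) (\<lambda>s. encA s w) (encZ t w) t"
    show "AE w in enc_measure. is_arg_max (reward (?th w)) (\<lambda>B. B \<in> \<A>) (encA t w)"
    proof (rule AE_distr_finiteI)
      have eq: "is_arg_max (reward (?th w)) (\<lambda>B. B \<in> \<A>) (encA t w) \<longleftrightarrow>
         (\<exists>B\<in>\<A>. encA t w = B \<and> (\<forall>C\<in>\<A>. reward (?th w) C \<le> reward (?th w) B))" for w
        by (auto simp: is_arg_max_linorder)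
      have 1: "Measurable.pred enc_space (\<lambda>w. encA t w = B)" for B
        by (rule measurable_compose[OF encA_meas]) simp
      have 2: "(\<lambda>w. reward (?th w) B) \<in> borel_measurable enc_space" for B
        unfolding reward_def by (rule borel_measurable_sum) (rule theta_meas)
      have "Measurable.pred enc_space
          (\<lambda>w. \<exists>B\<in>\<A>. encA t w = B \<and> (\<forall>C\<in>\<A>. reward (?th w) C \<le> reward (?th w) B))"
        by (intro pred_intros_finite(3,4)[OF finA] pred_intros_logic(3) 1)
          (auto simp: pred_def intro!: borel_measurable_le 2)
      then show "{w \<in> space enc_space. is_arg_max (reward (?th w)) (\<lambda>B. B \<in> \<A>) (encA t w)}
          \<in> sets enc_space"
        by (simp only: eq pred_def)
      have rew: "reward (?th (enc \<omega>)) B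
          = reward (theta \<sigma> lam (max_size \<A>) (\<lambda>s. X s \<omega>) (\<lambda>s. A s \<omega>) (Z t \<omega>) t) B"
        if "\<omega> \<in> space M" "B \<in> \<A>" for \<omega> B
        using that actions by (intro reward_cong theta_eq t1) auto
      show "AE \<omega> in M. is_arg_max (reward (?th (enc \<omega>))) (\<lambda>B. B \<in> \<A>) (encA t (enc \<omega>))"
        using A_argmax[OF t] AE_space
        by eventually_elim (simp add: is_arg_max_linorder rew enc_simps(4)[OF _ t1])
    qed measurable
  qed
qed

lemma enc_regret: "regret enc_measure \<A> \<mu> encA T = regret M \<A> \<mu> A T"
proof -
  have "(\<lambda>w. gap \<A> \<mu> (encA t w)) \<in> borel_measurable enc_space" for t
    by (rule measurable_compose[OF encA_meas]) simp
  then have "regret enc_measure \<A> \<mu> encA T = (\<integral>\<omega>. (\<Sum>t = 1..T. gap \<A> \<mu> (encA t (enc \<omega>))) \<partial>M)"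
    unfolding regret_def by (intro integral_distr) auto
  also have "\<dots> = regret M \<A> \<mu> A T"
    unfolding regret_def by (intro Bochner_Integration.integral_cong refl sum.cong) (auto simp: enc_simps)
  finally show ?thesis .
qed

end

theorem bg_cts_run_on_sequences:
  assumes "bg_cts_run M d \<A> \<mu> \<sigma> X lam init Z U A"
  shows "\<exists>(M' :: (nat \<times> nat \<times> nat \<Rightarrow> real) measure) X' Z' U' A'.
    bg_cts_run M' d \<A> \<mu> \<sigma> X' lam init Z' U' A' \<and>
    (\<forall>T. regret M' \<A> \<mu> A' T = regret M \<A> \<mu> A T)"
  using bg_cts_run.enc_run[OF assms] bg_cts_run.enc_regret[OF assms] by blast

end

theory Submission
  imports Defs
begin

text \<open>
  Call a round boosted when the Gaussian noise of the optimal action \<open>A\<^sup>\<star>\<close> exceeds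
  \<open>sqrt (ln t)\<close> standard deviations. The boost \<open>g\<close> is chosen so that a boosted round with accurate
  empirical means has \<open>A\<^sup>\<star> \<bullet> \<theta>(t) \<ge> A\<^sup>\<star> \<bullet> \<mu>\<close>, where accuracy comes from an exponential
  supermartingale mixed over Gaussian parameters. Boosted rounds occur independently, with
  probability \<open>1 / sqrt t\<close> up to lower-order factors, whereas an optimistic round that plays a
  suboptimal action increases the counts of uncertain items and hence occurs only \<open>O(ln t)\<close> times.
  So \<open>A\<^sup>\<star>\<close> is played at least about \<open>t powr (2 / 5)\<close> times with high probability, which makes
  \<open>A\<^sup>\<star> \<bullet> \<theta>(t)\<close> accurate up to half the minimal gap after a polynomial number of rounds. From then on
  the regret is a UCB-type sum, and splitting each gap over the items of the action gives the factor
  \<open>d ln m\<close>.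
\<close>

section \<open>Charging gaps to play counts\<close>

text \<open>The exponents are tied together. With \<open>lam = 1\<close> the optimism argument
  tolerates a squared deviation of about \<open>4 * ln t\<close>, in units of the squared
  \<open>\<sigma>\<close>, along the optimal action. The mixture over a grid of precisions loses a
  factor 20 / 9, so this tolerance fails with probability at most \<open>t powr (- 9 / 5)\<close>.
  The failing rounds depend on each other and are counted by Markov only: of order
  \<open>t powr (- 4 / 5)\<close> of them are expected between \<open>t / 2\<close> and
  \<open>t\<close>. Against a quota of order \<open>t powr (2 / 5)\<close> this leaves
  \<open>t powr (- 6 / 5)\<close>, which is summable. The exponent 2 / 5 must stay below 1 / 2 for
  boosted rounds to reach the quota, and above 1 / 5 for the series to converge.

  The obstacle is circular: the play counts of the optimal action depend on the noise whose effect
  is to be measured. It disappears because, for any frozen counts, the normalised noise of the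
  optimal action is standard normal, so the chance of a boosted round has a deterministic lower
  bound.\<close>

definition log_envelope :: "real \<Rightarrow> real \<Rightarrow> real" where
  "log_envelope R x = (if x \<le> R then 2 * sqrt (R * x) else 2 * R + R * ln (x / R))"

text \<open>For positive \<open>x\<close>, \<open>log_envelope R x\<close> is the integral from 0 to
  \<open>x\<close> of the decreasing function \<open>min (sqrt (R / y)) (R / y)\<close>, whose
  branches meet at \<open>y = R\<close>. The value at the right end of a unit cell is therefore at
  most the integral over the cell.\<close>

lemma log_envelope_step:
  assumes R: "0 < R" and x: "0 \<le> x"
  shows "min (sqrt (R / (x + 1))) (R / (x + 1)) \<le> log_envelope R (x + 1) - log_envelope R x"
proof -
  consider (low) "x + 1 \<le> R" | (mid) "x \<le> R" "R < x + 1" | (high) "R < x" by linarith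
  then show ?thesis
  proof cases
    case low
    have "sqrt x * sqrt (x + 1) \<le> x + 1 / 2"
      by (rule power2_le_imp_le) (use x in \<open>auto simp: power_mult_distrib power2_eq_square algebra_simps\<close>)
    then have "1 / sqrt (x + 1) \<le> 2 * (sqrt (x + 1) - sqrt x)"
      using x by (simp add: field_simps)
    then have "sqrt R * (1 / sqrt (x + 1)) \<le> sqrt R * (2 * (sqrt (x + 1) - sqrt x))"
      using R by (intro mult_left_mono) auto
    then have "sqrt (R / (x + 1)) \<le> 2 * sqrt (R * (x + 1)) - 2 * sqrt (R * x)"
      by (simp add: real_sqrt_mult real_sqrt_divide right_diff_distrib mult.left_commute)
    then show ?thesis using low by (simp add: log_envelope_def)
  next
    case mid
    have "- ln ((x + 1) / R) \<le> R / (x + 1) - 1"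
      using ln_le_minus_one[of "R / (x + 1)"] R x by (simp add: ln_div)
    then have "R * (- ln ((x + 1) / R)) \<le> R * (R / (x + 1) - 1)"
      using R by (intro mult_left_mono) auto
    moreover have "2 * sqrt (R * x) \<le> R + x"
      using arith_geo_mean_sqrt[of R x] R x by simp
    \<comment> \<open>The cell contains the breakpoint \<open>R\<close>. Both antiderivatives have
      been replaced by linear bounds; multiplied by \<open>x + 1\<close>, what is left reads
      \<open>0 \<le> (x + 1 - R) * (R - x)\<close>.\<close>
    moreover have "R / (x + 1) \<le> R - x + R * (1 - R / (x + 1))"
    proof -
      have "0 \<le> (x + 1 - R) * (R - x)" using mid by simp
      then have "R + R * R \<le> (2 * R - x) * (x + 1)" by (simp add: algebra_simps)
      then have "(R + R * R) / (x + 1) \<le> 2 * R - x" using x by (simp add: pos_divide_le_eq)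
      then show ?thesis by (simp add: add_divide_distrib right_diff_distrib)
    qed
    ultimately show ?thesis
      using mid by (simp add: log_envelope_def algebra_simps)
  next
    case high
    have "ln (x / (x + 1)) \<le> x / (x + 1) - 1"
      using high R x by (intro ln_le_minus_one) auto
    then have "1 / (x + 1) \<le> ln (x + 1) - ln x"
      using high R by (simp add: ln_div field_simps)
    then have "R * (1 / (x + 1)) \<le> R * (ln (x + 1) - ln x)"
      using R by (intro mult_left_mono) auto
    then show ?thesis
      using high R by (simp add: log_envelope_def ln_div algebra_simps)
  qed
qed

lemma sum_log_envelope:
  assumes R: "0 < R"
  shows "(\<Sum>n = 1..N. min (sqrt (R / real n)) (R / real n)) \<le> log_envelope R (real N)"
proof (induction N)
  case 0
  show ?case using R by (simp add: log_envelope_def)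
next
  case (Suc N)
  then show ?case
    using log_envelope_step[OF R, of "real N"] by (simp add: add.commute)
qed

text \<open>Counts up to \<open>R\<close> cost at most \<open>2 * R\<close> altogether; only the
  window from \<open>R\<close> to \<open>c * R\<close> adds a logarithm, and that of the ratio
  \<open>c\<close> alone.\<close>

lemma sum_min_sqrt_le:
  assumes R: "0 < R" and c: "1 \<le> c"
    and I: "finite I" "\<And>n. n \<in> I \<Longrightarrow> 1 \<le> n \<and> real n \<le> c * R"
  shows "(\<Sum>n\<in>I. min (sqrt (R / real n)) (R / real n)) \<le> R * (2 + ln c)"
proof -
  define N where "N = nat \<lfloor>c * R\<rfloor>"
  have N: "real N \<le> c * R" using R c by (simp add: N_def)
  have "(\<Sum>n\<in>I. min (sqrt (R / real n)) (R / real n))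
      \<le> (\<Sum>n = 1..N. min (sqrt (R / real n)) (R / real n))"
    using I R by (intro sum_mono2) (auto simp: N_def le_nat_floor)
  also have "\<dots> \<le> log_envelope R (real N)" by (rule sum_log_envelope[OF R])
  also have "\<dots> \<le> R * (2 + ln c)"
  proof (cases "real N \<le> R")
    case True
    then have "sqrt (R * real N) \<le> R" using R by (intro real_le_lsqrt) (auto simp: power2_eq_square)
    moreover have "0 \<le> R * ln c" using R c by simp
    ultimately show ?thesis using True by (simp add: log_envelope_def algebra_simps)
  next
    case False
    then have "ln (real N / R) \<le> ln c" using N R c by (subst ln_le_cancel_iff) (auto simp: field_simps)
    then show ?thesis using False R by (simp add: log_envelope_def algebra_simps)
  qed
  finally show ?thesis .
qed

section \<open>Play counts along one realisation\<close>

lemma num_plays_mono: "s \<le> t \<Longrightarrow> num_plays a s i \<le> num_plays a t i"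
  unfolding num_plays_def by (intro card_mono) auto

lemma num_plays_Suc: "1 \<le> s \<Longrightarrow> num_plays a (Suc s) i = num_plays a s i + of_bool (i \<in> a s)"
proof -
  assume "1 \<le> s"
  then have "{r \<in> {1..<Suc s}. i \<in> a r} = {r \<in> {1..<s}. i \<in> a r} \<union> (if i \<in> a s then {s} else {})"
    using le_less_Suc_eq less_Suc_eq by auto
  then show ?thesis by (simp add: num_plays_def)
qed

text \<open>Each play of an item raises its count, so a sum over the rounds that play the item can
  be reindexed as a sum over distinct integers.\<close>

lemma inj_on_num_plays: "inj_on (\<lambda>s. num_plays a s i) {s. 1 \<le> s \<and> i \<in> a s}"
proof (rule linorder_inj_onI)
  fix s t assume "s < t" "s \<in> {s. 1 \<le> s \<and> i \<in> a s}"
  then have "num_plays a s i < num_plays a (Suc s) i" "num_plays a (Suc s) i \<le> num_plays a t i"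
    using num_plays_mono[of "Suc s" t a i] by (auto simp: num_plays_Suc)
  then show "num_plays a s i \<noteq> num_plays a t i" by linarith
qed auto

text \<open>
  A gap charged to inverse counts is split over the items of the action: an item with fewer than
  \<open>K / \<delta>\<^sup>2\<close> plays can pay for the whole gap, items with more than \<open>2 m K / \<delta>\<^sup>2\<close> plays need not pay,
  and the ratio \<open>2 m\<close> of these thresholds is what produces \<open>ln m\<close> instead of \<open>ln T\<close>.
\<close>

lemma charge_gap:
  fixes N :: "'i \<Rightarrow> real"
  assumes B: "finite B" "real (card B) \<le> m" and m: "0 < m" and K: "0 < K"
    and D: "0 < D" "D \<le> \<delta>" and N: "\<And>i. i \<in> B \<Longrightarrow> 0 < N i"
    and le: "\<delta>\<^sup>2 \<le> K * (\<Sum>i\<in>B. 1 / N i)"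
  defines "R \<equiv> K / D\<^sup>2"
  shows "\<delta> \<le> (\<Sum>i\<in>B. if N i \<le> 2 * m * R then 2 * D * min (sqrt (R / N i)) (R / N i) else 0)"
    (is "_ \<le> (\<Sum>i\<in>B. ?phi i)")
proof -
  have d0: "0 < \<delta>" using D by simp
  define C where "C = {i \<in> B. N i \<le> 2 * K * m / \<delta>\<^sup>2}"
  have C: "finite C" "C \<subseteq> B" using B by (auto simp: C_def)
  have R0: "0 < R" using K D by (simp add: R_def)
  have phi0: "0 \<le> ?phi i" if "i \<in> B" for i using D R0 N[OF that] by auto
  have DR: "D * sqrt (R / N i) = sqrt (K / N i)" "D * (R / N i) = K / (D * N i)" if "i \<in> B" for i
    using D N[OF that] by (auto simp: R_def real_sqrt_divide real_sqrt_mult power2_eq_square field_simps)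
  have thr: "N i \<le> 2 * m * R" if "i \<in> C" for i
  proof -
    have "D\<^sup>2 \<le> \<delta>\<^sup>2" using D by (intro power_mono) auto
    then have "2 * K * m / \<delta>\<^sup>2 \<le> 2 * K * m / D\<^sup>2"
      using D K m by (intro divide_left_mono) auto
    then show ?thesis using that by (simp add: C_def R_def mult.assoc mult.commute mult.left_commute)
  qed
  \<comment> \<open>The threshold in \<open>C\<close> is chosen so that the at most \<open>m\<close>
    items outside it account for at most half of \<open>\<delta>\<^sup>2\<close>.\<close>
  have "(\<Sum>i\<in>B - C. 1 / N i) \<le> (\<Sum>i\<in>B - C. \<delta>\<^sup>2 / (2 * K * m))"
  proof (rule sum_mono)
    fix i assume i: "i \<in> B - C"
    then have "2 * K * m / \<delta>\<^sup>2 < N i" by (auto simp: C_def)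
    then show "1 / N i \<le> \<delta>\<^sup>2 / (2 * K * m)"
      using d0 K m N[of i] i by (simp add: field_simps)
  qed
  also have "\<dots> = real (card (B - C)) * (\<delta>\<^sup>2 / (2 * K * m))" by simp
  also have "\<dots> \<le> m * (\<delta>\<^sup>2 / (2 * K * m))"
    using B K m card_mono[of B "B - C"] by (intro mult_right_mono) auto
  also have "\<dots> = \<delta>\<^sup>2 / (2 * K)" using m by simp
  finally have "K * (\<Sum>i\<in>B - C. 1 / N i) \<le> K * (\<delta>\<^sup>2 / (2 * K))" using K by (intro mult_left_mono) auto
  then have "K * (\<Sum>i\<in>B - C. 1 / N i) \<le> \<delta>\<^sup>2 / 2" using K by simp
  moreover have "(\<Sum>i\<in>B. 1 / N i) = (\<Sum>i\<in>B - C. 1 / N i) + (\<Sum>i\<in>C. 1 / N i)"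
    using C B by (intro sum.subset_diff) auto
  ultimately have half: "\<delta>\<^sup>2 \<le> 2 * K * (\<Sum>i\<in>C. 1 / N i)" using le by (simp add: algebra_simps)
  have le_C: "(\<Sum>i\<in>C. ?phi i) \<le> (\<Sum>i\<in>B. ?phi i)"
    using C B phi0 by (intro sum_mono2) auto
  show ?thesis
  proof (cases "\<exists>i\<in>C. N i \<le> K / \<delta>\<^sup>2")
    case True
    then obtain i where i: "i \<in> C" "N i \<le> K / \<delta>\<^sup>2" by blast
    then have iB: "i \<in> B" using C by auto
    have d2: "\<delta>\<^sup>2 \<le> K / N i" using i d0 N[OF iB] by (simp add: field_simps)
    then have "\<delta> \<le> D * sqrt (R / N i)" using d0 DR[OF iB] by (simp add: real_le_rsqrt)
    moreover have "\<delta> \<le> D * (R / N i)"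
    proof -
      have "D * \<delta> \<le> \<delta>\<^sup>2" using D d0 by (simp add: power2_eq_square)
      then have "D * \<delta> \<le> K / N i" using d2 by simp
      then show ?thesis unfolding DR[OF iB] using D N[OF iB] by (simp add: field_simps)
    qed
    ultimately have "\<delta> \<le> D * min (sqrt (R / N i)) (R / N i)" by (simp add: min_def)
    then have "\<delta> \<le> ?phi i" using thr[OF i(1)] d0 by simp
    also have "\<dots> \<le> (\<Sum>i\<in>C. ?phi i)"
      by (rule member_le_sum[OF i(1) phi0 C(1)]) (use C in auto)
    finally show ?thesis using le_C by simp
  next
    case False
    \<comment> \<open>Dividing \<open>half\<close> by \<open>\<delta>\<close> assigns to each item
      of \<open>C\<close> the share \<open>2 * K / (\<delta> * N i)\<close>; the 2 lost to the
      discarded items is the 2 in \<open>?phi\<close>.\<close>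
    have "\<delta> \<le> (2 * K * (\<Sum>i\<in>C. 1 / N i)) / \<delta>"
      using half d0 by (simp add: field_simps power2_eq_square)
    also have "\<dots> = (\<Sum>i\<in>C. 2 * (K / (\<delta> * N i)))" 
      by (simp add: sum_distrib_left sum_divide_distrib field_simps)
    also have "\<dots> \<le> (\<Sum>i\<in>C. ?phi i)"
    proof (rule sum_mono)
      fix i assume i: "i \<in> C"
      then have iB: "i \<in> B" using C by auto
      have lt: "K / \<delta>\<^sup>2 < N i" using False i by auto
      have "sqrt (K / N i) \<le> \<delta>"
        using lt d0 N[OF iB] by (intro real_le_lsqrt) (auto simp: field_simps)
      then have "sqrt (K / N i) * sqrt (K / N i) \<le> \<delta> * sqrt (K / N i)"
        using K N[OF iB] by (intro mult_right_mono) auto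
      then have "K / N i \<le> \<delta> * sqrt (K / N i)" using K N[OF iB] by simp
      \<comment> \<open>The share must lie below both branches of the minimum: more than
        \<open>K / \<delta>\<^sup>2\<close> plays give the root branch, and
        \<open>D \<le> \<delta>\<close> gives the other one.\<close>
      then have 1: "K / (\<delta> * N i) \<le> D * sqrt (R / N i)"
      proof -
        have "K / (\<delta> * N i) = (K / N i) / \<delta>" by simp
        also have "\<dots> \<le> sqrt (K / N i)" using \<open>K / N i \<le> \<delta> * sqrt (K / N i)\<close> d0
          by (subst pos_divide_le_eq) (auto simp: mult.commute)
        finally show ?thesis unfolding DR[OF iB] .
      qed
      have 2: "K / (\<delta> * N i) \<le> D * (R / N i)"
        unfolding DR[OF iB] using D d0 K N[OF iB] by (intro divide_left_mono mult_right_mono) auto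
      show "2 * (K / (\<delta> * N i)) \<le> ?phi i"
        using 1 2 thr[OF i] D by (simp add: min_def)
    qed
    finally show ?thesis using le_C by simp
  qed
qed

text \<open>After \<open>charge_gap\<close> the sums over rounds and items are exchanged. The counts
  of one item at its plays are distinct elements of \<open>I\<close>, so each of the
  \<open>d\<close> items pays for \<open>I\<close> at most once.\<close>

lemma sum_gap_le:
  fixes a :: "nat \<Rightarrow> nat set" and \<delta> :: "nat \<Rightarrow> real"
  assumes T: "finite \<T>" "\<And>s. s \<in> \<T> \<Longrightarrow> 1 \<le> s"
    and a: "\<And>s. s \<in> \<T> \<Longrightarrow> a s \<subseteq> {..<d}" "\<And>s. s \<in> \<T> \<Longrightarrow> card (a s) \<le> m"
    and m: "2 \<le> m" and K: "0 \<le> K" and D: "0 < D" "\<And>s. s \<in> \<T> \<Longrightarrow> D \<le> \<delta> s"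
    and N: "\<And>s i. s \<in> \<T> \<Longrightarrow> i \<in> a s \<Longrightarrow> 1 \<le> num_plays a s i"
    and le: "\<And>s. s \<in> \<T> \<Longrightarrow> (\<delta> s)\<^sup>2 \<le> K * (\<Sum>i\<in>a s. 1 / real (num_plays a s i))"
  shows "(\<Sum>s\<in>\<T>. \<delta> s) \<le> 10 * (real d * K * ln (real m) / D)"
proof (cases "K = 0")
  case True
  \<comment> \<open>\<open>K = 0\<close> is the noiseless case \<open>\<sigma> = 0\<close>: a
    positive gap then contradicts \<open>le\<close>, so no round is left to charge.\<close>
  have "\<T> = {}"
  proof (rule ccontr)
    assume "\<T> \<noteq> {}"
    then obtain s where s: "s \<in> \<T>" by blast
    have "0 < (\<delta> s)\<^sup>2" using D(1) D(2)[OF s] by simp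
    then show False using le[OF s] True by simp
  qed
  then show ?thesis using True by simp
next
  case False
  with K have K: "0 < K" by simp
  define R where "R = K / D\<^sup>2"
  define \<psi> where "\<psi> n = min (sqrt (R / real n)) (R / real n)" for n
  define I where "I = {n :: nat. 1 \<le> n \<and> real n \<le> 2 * real m * R}"
  have R: "0 < R" using K D by (simp add: R_def)
  have fI: "finite I"
    by (rule finite_subset[of _ "{..nat \<lfloor>2 * real m * R\<rfloor>}"]) (auto simp: I_def le_nat_floor)
  have \<psi>0: "0 \<le> \<psi> n" for n using R by (simp add: \<psi>_def)
  have "(\<Sum>s\<in>\<T>. \<delta> s) \<le> (\<Sum>s\<in>\<T>. \<Sum>i\<in>a s. if num_plays a s i \<in> I then 2 * D * \<psi> (num_plays a s i) else 0)"
  proof (rule sum_mono)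
    fix s assume s: "s \<in> \<T>"
    have fin: "finite (a s)" using a(1)[OF s] by (rule finite_subset) simp
    have N0: "0 < real (num_plays a s i)" if "i \<in> a s" for i using N[OF s that] by simp
    have "\<delta> s \<le> (\<Sum>i\<in>a s. if real (num_plays a s i) \<le> 2 * real m * R
        then 2 * D * min (sqrt (R / real (num_plays a s i))) (R / real (num_plays a s i)) else 0)"
      unfolding R_def
      by (rule charge_gap[OF fin _ _ K D(1) D(2)[OF s] N0 le[OF s]])
        (use a(2)[OF s] m in auto)
    also have "\<dots> = (\<Sum>i\<in>a s. if num_plays a s i \<in> I then 2 * D * \<psi> (num_plays a s i) else 0)"
      by (intro sum.cong refl) (use N[OF s] in \<open>auto simp: I_def \<psi>_def\<close>)
    finally show "\<delta> s \<le> (\<Sum>i\<in>a s. if num_plays a s i \<in> I then 2 * D * \<psi> (num_plays a s i) else 0)" .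
  qed
  also have "\<dots> = (\<Sum>s\<in>\<T>. \<Sum>i<d. if i \<in> a s \<and> num_plays a s i \<in> I then 2 * D * \<psi> (num_plays a s i) else 0)"
    using a(1) by (intro sum.cong refl sum.mono_neutral_cong_left) auto
  also have "\<dots> = (\<Sum>i<d. \<Sum>s\<in>\<T>. if i \<in> a s \<and> num_plays a s i \<in> I then 2 * D * \<psi> (num_plays a s i) else 0)"
    by (rule sum.swap)
  also have "\<dots> \<le> (\<Sum>i<d. 2 * D * (\<Sum>n\<in>I. \<psi> n))"
  proof (rule sum_mono)
    fix i
    let ?S = "{s \<in> \<T>. i \<in> a s \<and> num_plays a s i \<in> I}"
    have inj: "inj_on (\<lambda>s. num_plays a s i) ?S"
      by (rule inj_on_subset[OF inj_on_num_plays[of a i]]) (use T in auto)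
    have "(\<Sum>s\<in>\<T>. if i \<in> a s \<and> num_plays a s i \<in> I then 2 * D * \<psi> (num_plays a s i) else 0)
        = (\<Sum>s\<in>?S. 2 * D * \<psi> (num_plays a s i))"
      using T(1) by (intro sum.mono_neutral_cong_right) auto
    also have "\<dots> = (\<Sum>n\<in>(\<lambda>s. num_plays a s i) ` ?S. 2 * D * \<psi> n)"
      using inj by (simp add: sum.reindex)
    also have "\<dots> \<le> (\<Sum>n\<in>I. 2 * D * \<psi> n)"
      using fI D \<psi>0 by (intro sum_mono2) auto
    finally show "(\<Sum>s\<in>\<T>. if i \<in> a s \<and> num_plays a s i \<in> I then 2 * D * \<psi> (num_plays a s i) else 0)
        \<le> 2 * D * (\<Sum>n\<in>I. \<psi> n)" by (simp add: sum_distrib_left)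
  qed
  also have "\<dots> = real d * (2 * D * (\<Sum>n\<in>I. \<psi> n))" by simp
  also have "\<dots> \<le> real d * (2 * D * (R * (2 + ln (2 * real m))))"
    unfolding \<psi>_def using R m fI D
    by (intro mult_left_mono sum_min_sqrt_le) (auto simp: I_def)
  \<comment> \<open>Here \<open>2 \<le> m\<close> enters: \<open>2 \<le> 3 * ln 2\<close> lets the
    additive constants be absorbed into multiples of \<open>ln m\<close>.\<close>
  also have "\<dots> \<le> real d * (2 * D * (R * (5 * ln (real m))))"
  proof -
    have "(2::real) / 3 \<le> ln 2" using ln2_ge_two_thirds by simp
    moreover have "ln 2 \<le> ln (real m)" using m by simp
    moreover have "ln (2 * real m) = ln 2 + ln (real m)" using m by (simp add: ln_mult)
    ultimately have "2 + ln (2 * real m) \<le> 5 * ln (real m)" by linarith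
    then show ?thesis using R D by (intro mult_left_mono) auto
  qed
  also have "\<dots> = 10 * (real d * K * ln (real m) / D)"
    using D by (simp add: R_def power2_eq_square)
  finally show ?thesis .
qed

section \<open>Independence and Gaussian tails\<close>

text \<open>Stated through the product law, so that the two variables may have different value
  types: the vector of one round has to be independent of a tuple of past vectors, another
  trajectory and the seed.\<close>

definition (in prob_space) indep_rv :: "'b measure \<Rightarrow> ('a \<Rightarrow> 'b) \<Rightarrow> 'c measure \<Rightarrow> ('a \<Rightarrow> 'c) \<Rightarrow> bool" where
  "indep_rv S X T Y \<longleftrightarrow> X \<in> M \<rightarrow>\<^sub>M S \<and> Y \<in> M \<rightarrow>\<^sub>M T \<and>
     distr M S X \<Otimes>\<^sub>M distr M T Y = distr M (S \<Otimes>\<^sub>M T) (\<lambda>x. (X x, Y x))"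

lemma (in prob_space) indep_rv_nn_integral:
  fixes f :: "'b \<Rightarrow> ennreal" and g :: "'c \<Rightarrow> ennreal"
  assumes ind: "indep_rv S X T Y"
    and f[measurable]: "f \<in> borel_measurable S" and g[measurable]: "g \<in> borel_measurable T"
  shows "(\<integral>\<^sup>+\<omega>. f (X \<omega>) * g (Y \<omega>) \<partial>M) = (\<integral>\<^sup>+\<omega>. f (X \<omega>) \<partial>M) * (\<integral>\<^sup>+\<omega>. g (Y \<omega>) \<partial>M)"
proof -
  have [measurable]: "X \<in> M \<rightarrow>\<^sub>M S" "Y \<in> M \<rightarrow>\<^sub>M T"
    and eq: "distr M S X \<Otimes>\<^sub>M distr M T Y = distr M (S \<Otimes>\<^sub>M T) (\<lambda>x. (X x, Y x))"
    using ind by (auto simp: indep_rv_def)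
  interpret Y: prob_space "distr M T Y" by (rule prob_space_distr) measurable
  have "(\<integral>\<^sup>+\<omega>. f (X \<omega>) * g (Y \<omega>) \<partial>M) = (\<integral>\<^sup>+p. f (fst p) * g (snd p) \<partial>(distr M S X \<Otimes>\<^sub>M distr M T Y))"
    unfolding eq by (subst nn_integral_distr) auto
  also have "\<dots> = (\<integral>\<^sup>+x. \<integral>\<^sup>+y. f x * g y \<partial>distr M T Y \<partial>distr M S X)"
    by (subst Y.nn_integral_fst[symmetric]) auto
  also have "\<dots> = (\<integral>\<^sup>+x. f x \<partial>distr M S X) * (\<integral>\<^sup>+y. g y \<partial>distr M T Y)"
    by (simp add: nn_integral_cmult nn_integral_multc)
  finally show ?thesis by (simp add: nn_integral_distr)
qed

text \<open>The two hypotheses make the law of the triple a product of three laws, and this product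
  can be bracketed the other way.\<close>

lemma (in prob_space) indep_rv_assoc:
  assumes AB: "indep_rv S A T B" and ABC: "indep_rv (S \<Otimes>\<^sub>M T) (\<lambda>\<omega>. (A \<omega>, B \<omega>)) R C"
  shows "indep_rv S A (T \<Otimes>\<^sub>M R) (\<lambda>\<omega>. (B \<omega>, C \<omega>))"
proof -
  have [measurable]: "A \<in> M \<rightarrow>\<^sub>M S" "B \<in> M \<rightarrow>\<^sub>M T" "C \<in> M \<rightarrow>\<^sub>M R"
    and eqAB: "distr M S A \<Otimes>\<^sub>M distr M T B = distr M (S \<Otimes>\<^sub>M T) (\<lambda>x. (A x, B x))"
    and eqABC: "distr M (S \<Otimes>\<^sub>M T) (\<lambda>\<omega>. (A \<omega>, B \<omega>)) \<Otimes>\<^sub>M distr M R C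
      = distr M ((S \<Otimes>\<^sub>M T) \<Otimes>\<^sub>M R) (\<lambda>x. ((A x, B x), C x))"
    using AB ABC by (auto simp: indep_rv_def)
  interpret A: prob_space "distr M S A" by (rule prob_space_distr) measurable
  interpret B: prob_space "distr M T B" by (rule prob_space_distr) measurable
  interpret C: prob_space "distr M R C" by (rule prob_space_distr) measurable
  interpret BC: prob_space "distr M (T \<Otimes>\<^sub>M R) (\<lambda>\<omega>. (B \<omega>, C \<omega>))" by (rule prob_space_distr) measurable
  \<comment> \<open>The triple product as an iterated integral; below it is applied to indicators of
    rectangles.\<close>
  have int: "(\<integral>\<^sup>+\<omega>. h (A \<omega>) (B \<omega>) (C \<omega>) \<partial>M)
      = (\<integral>\<^sup>+a. \<integral>\<^sup>+b. \<integral>\<^sup>+c. h a b c \<partial>distr M R C \<partial>distr M T B \<partial>distr M S A)"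
    if [measurable]: "(\<lambda>p. h (fst (fst p)) (snd (fst p)) (snd p)) \<in> borel_measurable ((S \<Otimes>\<^sub>M T) \<Otimes>\<^sub>M R)" for h :: "_ \<Rightarrow> _ \<Rightarrow> _ \<Rightarrow> ennreal"
  proof -
    have "(\<integral>\<^sup>+\<omega>. h (A \<omega>) (B \<omega>) (C \<omega>) \<partial>M) = (\<integral>\<^sup>+p. h (fst (fst p)) (snd (fst p)) (snd p)
        \<partial>(distr M (S \<Otimes>\<^sub>M T) (\<lambda>\<omega>. (A \<omega>, B \<omega>)) \<Otimes>\<^sub>M distr M R C))"
      unfolding eqABC by (subst nn_integral_distr) auto
    also have "\<dots> = (\<integral>\<^sup>+p. \<integral>\<^sup>+c. h (fst p) (snd p) c \<partial>distr M R C \<partial>(distr M S A \<Otimes>\<^sub>M distr M T B))"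
      unfolding eqAB[symmetric] split_beta by (subst C.nn_integral_fst[symmetric]) auto
    also have "\<dots> = (\<integral>\<^sup>+a. \<integral>\<^sup>+b. \<integral>\<^sup>+c. h a b c \<partial>distr M R C \<partial>distr M T B \<partial>distr M S A)"
      by (subst B.nn_integral_fst[symmetric]) (auto intro!: C.borel_measurable_nn_integral simp: split_beta)
    finally show ?thesis .
  qed
  have "distr M S A \<Otimes>\<^sub>M distr M (T \<Otimes>\<^sub>M R) (\<lambda>\<omega>. (B \<omega>, C \<omega>))
      = distr M (S \<Otimes>\<^sub>M (T \<Otimes>\<^sub>M R)) (\<lambda>\<omega>. (A \<omega>, (B \<omega>, C \<omega>)))"
  proof (rule pair_measure_eqI)
    show "sigma_finite_measure (distr M S A)" "sigma_finite_measure (distr M (T \<Otimes>\<^sub>M R) (\<lambda>\<omega>. (B \<omega>, C \<omega>)))"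
      by unfold_locales
    fix a e assume "a \<in> sets (distr M S A)" and "e \<in> sets (distr M (T \<Otimes>\<^sub>M R) (\<lambda>\<omega>. (B \<omega>, C \<omega>)))"
    then have [measurable]: "a \<in> sets S" "e \<in> sets (T \<Otimes>\<^sub>M R)" by auto
    have "emeasure (distr M (S \<Otimes>\<^sub>M (T \<Otimes>\<^sub>M R)) (\<lambda>\<omega>. (A \<omega>, (B \<omega>, C \<omega>)))) (a \<times> e)
        = (\<integral>\<^sup>+p. indicator (a \<times> e) p \<partial>distr M (S \<Otimes>\<^sub>M (T \<Otimes>\<^sub>M R)) (\<lambda>\<omega>. (A \<omega>, (B \<omega>, C \<omega>))))"
      by simp
    also have "\<dots> = (\<integral>\<^sup>+\<omega>. indicator a (A \<omega>) * indicator e (B \<omega>, C \<omega>) \<partial>M)"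
      by (subst nn_integral_distr) (auto intro!: nn_integral_cong simp: indicator_def)
    also have "\<dots> = (\<integral>\<^sup>+x. \<integral>\<^sup>+b. \<integral>\<^sup>+c. indicator a x * indicator e (b, c) \<partial>distr M R C \<partial>distr M T B \<partial>distr M S A)"
      by (subst int) auto
    also have "\<dots> = (\<integral>\<^sup>+x. indicator a x \<partial>distr M S A) * (\<integral>\<^sup>+b. \<integral>\<^sup>+c. indicator e (b, c) \<partial>distr M R C \<partial>distr M T B)"
    proof -
      have 1: "(\<lambda>b. \<integral>\<^sup>+c. indicator e (b, c) \<partial>distr M R C) \<in> borel_measurable (distr M T B)"
        by (rule C.borel_measurable_nn_integral) simp
      have 2: "(\<lambda>c. indicator e (b, c) :: ennreal) \<in> borel_measurable (distr M R C)" if "b \<in> space T" for b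
        using that by simp
      have "(\<integral>\<^sup>+x. \<integral>\<^sup>+b. \<integral>\<^sup>+c. indicator a x * indicator e (b, c) \<partial>distr M R C \<partial>distr M T B \<partial>distr M S A)
          = (\<integral>\<^sup>+x. \<integral>\<^sup>+b. indicator a x * (\<integral>\<^sup>+c. indicator e (b, c) \<partial>distr M R C) \<partial>distr M T B \<partial>distr M S A)"
        by (intro nn_integral_cong nn_integral_cmult 2) simp
      also have "\<dots> = (\<integral>\<^sup>+x. indicator a x * (\<integral>\<^sup>+b. \<integral>\<^sup>+c. indicator e (b, c) \<partial>distr M R C \<partial>distr M T B) \<partial>distr M S A)"
        by (intro nn_integral_cong nn_integral_cmult 1)
      finally show ?thesis by (simp add: nn_integral_multc)
    qed
    also have "(\<integral>\<^sup>+b. \<integral>\<^sup>+c. indicator e (b, c) \<partial>distr M R C \<partial>distr M T B)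
        = (\<integral>\<^sup>+x. \<integral>\<^sup>+b. \<integral>\<^sup>+c. indicator e (b, c) \<partial>distr M R C \<partial>distr M T B \<partial>distr M S A)"
      using A.emeasure_space_1 by simp
    also have "\<dots> = (\<integral>\<^sup>+\<omega>. indicator e (B \<omega>, C \<omega>) \<partial>M)"
      by (subst int) auto
    also have "\<dots> = emeasure (distr M (T \<Otimes>\<^sub>M R) (\<lambda>\<omega>. (B \<omega>, C \<omega>))) e"
      by (subst nn_integral_indicator[symmetric], simp, subst nn_integral_distr) auto
    also have "(\<integral>\<^sup>+x. indicator a x \<partial>distr M S A) = emeasure (distr M S A) a"
      by simp
    finally show "emeasure (distr M S A) a * emeasure (distr M (T \<Otimes>\<^sub>M R) (\<lambda>\<omega>. (B \<omega>, C \<omega>))) e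
        = emeasure (distr M (S \<Otimes>\<^sub>M T \<Otimes>\<^sub>M R) (\<lambda>\<omega>. (A \<omega>, B \<omega>, C \<omega>))) (a \<times> e)" by simp
  qed simp
  then show ?thesis by (simp add: indep_rv_def)
qed

lemma (in prob_space) indep_rv_iff_sets:
  "indep_rv S X T Y \<longleftrightarrow> X \<in> M \<rightarrow>\<^sub>M S \<and> Y \<in> M \<rightarrow>\<^sub>M T \<and>
    (\<forall>A\<in>sets S. \<forall>B\<in>sets T. prob (X -` A \<inter> Y -` B \<inter> space M)
        = prob (X -` A \<inter> space M) * prob (Y -` B \<inter> space M))" (is "_ \<longleftrightarrow> _ \<and> _ \<and> ?P")
proof (cases "X \<in> M \<rightarrow>\<^sub>M S \<and> Y \<in> M \<rightarrow>\<^sub>M T")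
  case True
  then have [measurable]: "X \<in> M \<rightarrow>\<^sub>M S" "Y \<in> M \<rightarrow>\<^sub>M T" by auto
  interpret X: prob_space "distr M S X" by (rule prob_space_distr) measurable
  interpret Y: prob_space "distr M T Y" by (rule prob_space_distr) measurable
  have rect: "emeasure (distr M (S \<Otimes>\<^sub>M T) (\<lambda>x. (X x, Y x))) (A \<times> B) = ennreal (prob (X -` A \<inter> Y -` B \<inter> space M))"
    "emeasure (distr M S X \<Otimes>\<^sub>M distr M T Y) (A \<times> B) = ennreal (prob (X -` A \<inter> space M) * prob (Y -` B \<inter> space M))"
    if [measurable]: "A \<in> sets S" "B \<in> sets T" for A B
  proof -
    have "(\<lambda>x. (X x, Y x)) -` (A \<times> B) \<inter> space M = X -` A \<inter> Y -` B \<inter> space M" by auto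
    then show "emeasure (distr M (S \<Otimes>\<^sub>M T) (\<lambda>x. (X x, Y x))) (A \<times> B) = ennreal (prob (X -` A \<inter> Y -` B \<inter> space M))"
      by (simp add: emeasure_distr emeasure_eq_measure)
    show "emeasure (distr M S X \<Otimes>\<^sub>M distr M T Y) (A \<times> B) = ennreal (prob (X -` A \<inter> space M) * prob (Y -` B \<inter> space M))"
      by (simp add: Y.emeasure_pair_measure_Times emeasure_distr emeasure_eq_measure ennreal_mult)
  qed
  have "distr M S X \<Otimes>\<^sub>M distr M T Y = distr M (S \<Otimes>\<^sub>M T) (\<lambda>x. (X x, Y x))" if ?P
    by (rule pair_measure_eqI) (use that rect in \<open>auto simp: Y.emeasure_pair_measure_Times, unfold_locales\<close>)
  moreover have ?P if "distr M S X \<Otimes>\<^sub>M distr M T Y = distr M (S \<Otimes>\<^sub>M T) (\<lambda>x. (X x, Y x))"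
    using rect unfolding that by (auto simp: ennreal_inj)
  ultimately show ?thesis using True by (auto simp: indep_rv_def)
qed (auto simp: indep_rv_def)

lemma (in prob_space) indep_rv_commute: "indep_rv S A T B \<Longrightarrow> indep_rv T B S A"
  unfolding indep_rv_iff_sets by (auto simp: Int_commute mult.commute)

lemma (in prob_space) indep_var_imp_indep_rv: "indep_var S X T Y \<Longrightarrow> indep_rv S X T Y"
  by (simp add: indep_rv_def indep_var_distribution_eq)

text \<open>Every preimage under \<open>h\<close> is a preimage under \<open>Y\<close>, so
  independence passes to \<open>h\<close> without factoring \<open>h\<close> as a function of
  \<open>Y\<close>. This allows arguments with sigma-algebras of known data.\<close>

lemma (in prob_space) indep_rv_vimage:
  assumes ind: "indep_rv S X T Y" and h: "h \<in> vimage_algebra (space M) Y T \<rightarrow>\<^sub>M L"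
  shows "indep_rv S X L h"
proof -
  have XY[measurable]: "X \<in> M \<rightarrow>\<^sub>M S" "Y \<in> M \<rightarrow>\<^sub>M T"
    and indp: "prob (X -` A \<inter> Y -` B \<inter> space M) = prob (X -` A \<inter> space M) * prob (Y -` B \<inter> space M)"
      if "A \<in> sets S" "B \<in> sets T" for A B
    using ind that by (auto simp: indep_rv_iff_sets)
  have Ysp: "Y \<in> space M \<rightarrow> space T" using XY(2)[THEN measurable_space] by auto
  have ex: "\<exists>C\<in>sets T. h -` B \<inter> space M = Y -` C \<inter> space M" if "B \<in> sets L" for B
    using measurable_sets[OF h that] Ysp by (auto simp: sets_vimage_algebra2)
  have hM: "h \<in> M \<rightarrow>\<^sub>M L"
  proof (rule measurableI)
    fix x assume "x \<in> space M" then show "h x \<in> space L" using measurable_space[OF h, of x] by simp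
  next
    fix A assume "A \<in> sets L"
    then show "h -` A \<inter> space M \<in> sets M" using ex[of A] by auto
  qed
  moreover have "prob (X -` A \<inter> h -` B \<inter> space M) = prob (X -` A \<inter> space M) * prob (h -` B \<inter> space M)"
    if A: "A \<in> sets S" and B: "B \<in> sets L" for A B
  proof -
    obtain C where C: "C \<in> sets T" "h -` B \<inter> space M = Y -` C \<inter> space M" using ex[OF B] by blast
    then have "X -` A \<inter> h -` B \<inter> space M = X -` A \<inter> Y -` C \<inter> space M" by blast
    then show ?thesis using indp[OF A C(1)] C(2) by simp
  qed
  ultimately show ?thesis using XY by (simp add: indep_rv_iff_sets)
qed

lemma (in prob_space) indep_rv_compose:
  assumes ind: "indep_rv S X T Y" and f: "f \<in> T \<rightarrow>\<^sub>M L"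
  shows "indep_rv S X L (\<lambda>\<omega>. f (Y \<omega>))"
proof (rule indep_rv_vimage[OF ind])
  have "Y \<in> space M \<rightarrow> space T" using ind by (auto simp: indep_rv_def dest: measurable_space)
  then have "Y \<in> vimage_algebra (space M) Y T \<rightarrow>\<^sub>M T" by (rule measurable_vimage_algebra1)
  then show "(\<lambda>\<omega>. f (Y \<omega>)) \<in> vimage_algebra (space M) Y T \<rightarrow>\<^sub>M L"
    using f by (rule measurable_compose)
qed

lemma (in prob_space) indep_rv_of_indep_set:
  assumes X: "X \<in> M \<rightarrow>\<^sub>M S" and Y: "Y \<in> M \<rightarrow>\<^sub>M T"
    and ind: "indep_set (sets (vimage_algebra (space M) X S)) (sets (vimage_algebra (space M) Y T))"
  shows "indep_rv S X T Y"
proof -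
  have "X \<in> space M \<rightarrow> space S" "Y \<in> space M \<rightarrow> space T" using X Y by (auto dest: measurable_space)
  then have "prob ((X -` A \<inter> space M) \<inter> (Y -` B \<inter> space M)) = prob (X -` A \<inter> space M) * prob (Y -` B \<inter> space M)"
    if "A \<in> sets S" "B \<in> sets T" for A B
    using that by (intro indep_setD[OF ind]) (auto simp: sets_vimage_algebra2)
  moreover have "(X -` A \<inter> space M) \<inter> (Y -` B \<inter> space M) = X -` A \<inter> Y -` B \<inter> space M" for A B by auto
  ultimately show ?thesis using X Y by (simp add: indep_rv_iff_sets)
qed

text \<open>
  Conditioning without conditional expectations: the observed data \<open>\<kappa>\<close> take finitely many values, so
  it suffices to split over them and use independence for each value.
\<close>

lemma (in prob_space) nn_integral_conditioning:
  fixes f :: "'k \<Rightarrow> 'b \<Rightarrow> ennreal" and H :: "'a \<Rightarrow> ennreal"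
  assumes I: "finite I" "\<And>\<omega>. \<omega> \<in> space M \<Longrightarrow> \<kappa> \<omega> \<in> I"
    and ind: "\<And>k. k \<in> I \<Longrightarrow> indep_rv S Y borel (\<lambda>\<omega>. indicator {\<omega> \<in> space M. \<kappa> \<omega> = k} \<omega> * H \<omega>)"
    and f: "\<And>k. k \<in> I \<Longrightarrow> f k \<in> borel_measurable S"
    and le: "\<And>k. k \<in> I \<Longrightarrow> (\<integral>\<^sup>+\<omega>. f k (Y \<omega>) \<partial>M) \<le> c"
  shows "(\<integral>\<^sup>+\<omega>. f (\<kappa> \<omega>) (Y \<omega>) * H \<omega> \<partial>M) \<le> c * (\<integral>\<^sup>+\<omega>. H \<omega> \<partial>M)"
proof -
  let ?H = "\<lambda>k \<omega>. indicator {\<omega> \<in> space M. \<kappa> \<omega> = k} \<omega> * H \<omega>"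
  have H: "?H k \<in> borel_measurable M" if "k \<in> I" for k using ind[OF that] by (simp add: indep_rv_def)
  have fY: "(\<lambda>\<omega>. f k (Y \<omega>)) \<in> borel_measurable M" if "k \<in> I" for k
    by (rule measurable_compose[OF _ f[OF that]]) (use ind[OF that] in \<open>simp add: indep_rv_def\<close>)
  have split: "h (\<kappa> \<omega>) * H \<omega> = (\<Sum>k\<in>I. h k * ?H k \<omega>)" if "\<omega> \<in> space M" for h :: "'k \<Rightarrow> ennreal" and \<omega>
  proof -
    have "(\<Sum>k\<in>I. h k * ?H k \<omega>) = (\<Sum>k\<in>I. if k = \<kappa> \<omega> then h k * H \<omega> else 0)"
      using that by (intro sum.cong) (auto simp: indicator_def)
    also have "\<dots> = h (\<kappa> \<omega>) * H \<omega>" using I that by (subst sum.delta) auto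
    finally show ?thesis ..
  qed
  have "(\<integral>\<^sup>+\<omega>. f (\<kappa> \<omega>) (Y \<omega>) * H \<omega> \<partial>M) = (\<integral>\<^sup>+\<omega>. (\<Sum>k\<in>I. f k (Y \<omega>) * ?H k \<omega>) \<partial>M)"
  proof (intro nn_integral_cong)
    fix \<omega> assume "\<omega> \<in> space M"
    then show "f (\<kappa> \<omega>) (Y \<omega>) * H \<omega> = (\<Sum>k\<in>I. f k (Y \<omega>) * ?H k \<omega>)"
      by (rule split[of \<omega> "\<lambda>k. f k (Y \<omega>)"])
  qed
  also have "\<dots> = (\<Sum>k\<in>I. \<integral>\<^sup>+\<omega>. f k (Y \<omega>) * ?H k \<omega> \<partial>M)"
    by (rule nn_integral_sum) (rule borel_measurable_times_ennreal[OF fY H])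
  also have "\<dots> = (\<Sum>k\<in>I. (\<integral>\<^sup>+\<omega>. f k (Y \<omega>) \<partial>M) * (\<integral>\<^sup>+\<omega>. ?H k \<omega> \<partial>M))"
    by (intro sum.cong refl indep_rv_nn_integral[OF ind f measurable_ident_sets[OF refl]])
  also have "\<dots> \<le> (\<Sum>k\<in>I. c * (\<integral>\<^sup>+\<omega>. ?H k \<omega> \<partial>M))"
    by (intro sum_mono mult_right_mono le) auto
  also have "\<dots> = c * (\<integral>\<^sup>+\<omega>. (\<Sum>k\<in>I. ?H k \<omega>) \<partial>M)"
    by (subst nn_integral_sum[OF H]) (auto simp: sum_distrib_left)
  also have "(\<integral>\<^sup>+\<omega>. (\<Sum>k\<in>I. ?H k \<omega>) \<partial>M) = (\<integral>\<^sup>+\<omega>. H \<omega> \<partial>M)"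
    using split[of _ "\<lambda>_. 1"] by (intro nn_integral_cong) simp
  finally show ?thesis .
qed

text \<open>Completing the square turns the integrand into a constant times a normal density with
  mean \<open>S / (\<sigma>\<^sup>2 * (N + c))\<close> and precision
  \<open>\<sigma>\<^sup>2 * (N + c)\<close>. The mixing density acts like \<open>c\<close>
  additional plays.\<close>

lemma gaussian_mixture:
  fixes \<sigma> c N S :: real
  assumes s: "0 < \<sigma>" and c: "0 < c" and N: "0 \<le> N"
  shows "(\<integral>\<^sup>+u. ennreal (exp (u * S - u\<^sup>2 * \<sigma>\<^sup>2 * N / 2) * normal_density 0 (1 / (\<sigma> * sqrt c)) u) \<partial>lborel)
    = ennreal (sqrt (c / (N + c)) * exp (S\<^sup>2 / (2 * \<sigma>\<^sup>2 * (N + c))))"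
proof -
  let ?v = "N + c"
  have v: "0 < ?v" using N c by simp
  have pt: "exp (u * S - u\<^sup>2 * \<sigma>\<^sup>2 * N / 2) * normal_density 0 (1 / (\<sigma> * sqrt c)) u
    = sqrt (c / ?v) * exp (S\<^sup>2 / (2 * \<sigma>\<^sup>2 * ?v)) * normal_density (S / (\<sigma>\<^sup>2 * ?v)) (1 / (\<sigma> * sqrt ?v)) u" for u
  proof -
    have 1: "normal_density 0 (1 / (\<sigma> * sqrt c)) u = \<sigma> * sqrt c / sqrt (2 * pi) * exp (- (u\<^sup>2 * \<sigma>\<^sup>2 * c / 2))"
      using s c by (simp add: normal_density_def real_sqrt_mult real_sqrt_divide power_mult_distrib power_divide field_simps)
    have 2: "normal_density (S / (\<sigma>\<^sup>2 * ?v)) (1 / (\<sigma> * sqrt ?v)) u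
        = \<sigma> * sqrt ?v / sqrt (2 * pi) * exp (- ((u - S / (\<sigma>\<^sup>2 * ?v))\<^sup>2 * \<sigma>\<^sup>2 * ?v / 2))"
      using s v by (simp add: normal_density_def real_sqrt_mult real_sqrt_divide power_mult_distrib power_divide divide_simps)
    have 3: "u * S - u\<^sup>2 * \<sigma>\<^sup>2 * N / 2 - u\<^sup>2 * \<sigma>\<^sup>2 * c / 2
        = S\<^sup>2 / (2 * \<sigma>\<^sup>2 * ?v) - (u - S / (\<sigma>\<^sup>2 * ?v))\<^sup>2 * \<sigma>\<^sup>2 * ?v / 2"
    proof -
      define w where "w = \<sigma>\<^sup>2 * ?v"
      have w: "0 < w" using s v by (simp add: w_def)
      have "u * S - u\<^sup>2 * w / 2 = S\<^sup>2 / (2 * w) - (u - S / w)\<^sup>2 * w / 2"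
        using w by (simp add: field_simps power2_eq_square)
      then show ?thesis by (simp add: w_def algebra_simps)
    qed
    show ?thesis unfolding 1 2 using v c
      by (simp add: real_sqrt_divide exp_add[symmetric] mult_exp_exp 3[symmetric] field_simps del: exp_add)
        (use 3 in \<open>simp add: field_simps exp_add[symmetric] mult_exp_exp\<close>)
  qed
  have "prob_space (density lborel (normal_density (S / (\<sigma>\<^sup>2 * ?v)) (1 / (\<sigma> * sqrt ?v))))"
    using s v by (intro prob_space_normal_density) simp
  then have "emeasure (density lborel (normal_density (S / (\<sigma>\<^sup>2 * ?v)) (1 / (\<sigma> * sqrt ?v)))) (space lborel) = 1"
    using prob_space.emeasure_space_1 by fastforce
  then have one: "(\<integral>\<^sup>+u. ennreal (normal_density (S / (\<sigma>\<^sup>2 * ?v)) (1 / (\<sigma> * sqrt ?v)) u) \<partial>lborel) = 1"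
    by (simp add: emeasure_density)
  have "(\<integral>\<^sup>+u. ennreal (exp (u * S - u\<^sup>2 * \<sigma>\<^sup>2 * N / 2) * normal_density 0 (1 / (\<sigma> * sqrt c)) u) \<partial>lborel)
    = (\<integral>\<^sup>+u. ennreal (sqrt (c / ?v) * exp (S\<^sup>2 / (2 * \<sigma>\<^sup>2 * ?v))) * ennreal (normal_density (S / (\<sigma>\<^sup>2 * ?v)) (1 / (\<sigma> * sqrt ?v)) u) \<partial>lborel)"
    unfolding pt using v c by (intro nn_integral_cong) (simp add: ennreal_mult)
  also have "\<dots> = ennreal (sqrt (c / ?v) * exp (S\<^sup>2 / (2 * \<sigma>\<^sup>2 * ?v)))"
    by (subst nn_integral_cmult) (auto simp: one)
  finally show ?thesis .
qed

text \<open>The weight \<open>exp (x\<^sup>2 / 4)\<close> halves the exponent of the density, which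
  yields a normal density of variance 2; the ratio of the normalising constants is
  \<open>sqrt 2\<close>.\<close>

lemma (in prob_space) std_normal_exp_square:
  assumes Y: "distributed M lborel Y std_normal_density"
  shows "(\<integral>\<^sup>+\<omega>. ennreal (exp ((Y \<omega>)\<^sup>2 / 4)) \<partial>M) = ennreal (sqrt 2)"
proof -
  have "(\<integral>\<^sup>+\<omega>. ennreal (exp ((Y \<omega>)\<^sup>2 / 4)) \<partial>M) = (\<integral>\<^sup>+x. ennreal (std_normal_density x) * ennreal (exp (x\<^sup>2 / 4)) \<partial>lborel)"
    by (rule distributed_nn_integral[OF Y, symmetric]) simp
  also have "\<dots> = (\<integral>\<^sup>+x. ennreal (sqrt 2) * ennreal (normal_density 0 (sqrt 2) x) \<partial>lborel)"
  proof (intro nn_integral_cong)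
    fix x :: real
    have "exp (- x\<^sup>2 / 2) * exp (x\<^sup>2 / 4) = exp (- (x\<^sup>2) / 4)" by (simp add: mult_exp_exp field_simps)
    then have "std_normal_density x * exp (x\<^sup>2 / 4) = sqrt 2 * normal_density 0 (sqrt 2) x"
      by (simp add: normal_density_def real_sqrt_mult field_simps)
    then show "ennreal (std_normal_density x) * ennreal (exp (x\<^sup>2 / 4)) = ennreal (sqrt 2) * ennreal (normal_density 0 (sqrt 2) x)"
      by (metis ennreal_mult normal_density_nonneg exp_ge_zero real_sqrt_ge_zero zero_le_numeral)
  qed
  also have "\<dots> = ennreal (sqrt 2) * (\<integral>\<^sup>+x. ennreal (normal_density 0 (sqrt 2) x) \<partial>lborel)"
    by (rule nn_integral_cmult) simp
  also have "(\<integral>\<^sup>+x. ennreal (normal_density 0 (sqrt 2) x) \<partial>lborel) = 1"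
    by (subst nn_integral_eq_integral) auto
  finally show ?thesis by simp
qed

text \<open>On \<open>{x..x + 1}\<close> the density is at least its value at the right end.
  Compared with \<open>exp (- x\<^sup>2 / 2)\<close> this loses \<open>exp (- x - 1 / 2)\<close>,
  which at \<open>x = sqrt (ln t)\<close> decays more slowly than any negative power of
  \<open>t\<close>.\<close>

lemma (in prob_space) std_normal_tail:
  assumes Y: "distributed M lborel Y std_normal_density" and x: "0 \<le> x"
  shows "exp (- (x + 1)\<^sup>2 / 2) / sqrt (2 * pi) \<le> prob {\<omega> \<in> space M. x \<le> Y \<omega>}"
proof -
  have "ennreal (exp (- (x + 1)\<^sup>2 / 2) / sqrt (2 * pi)) = (\<integral>\<^sup>+y. ennreal (exp (- (x + 1)\<^sup>2 / 2) / sqrt (2 * pi)) * indicator {x..x + 1} y \<partial>lborel)"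
    by (simp add: nn_integral_cmult)
  also have "\<dots> \<le> (\<integral>\<^sup>+y. ennreal (std_normal_density y) * indicator {x..} y \<partial>lborel)"
  proof (intro nn_integral_mono)
    fix y :: real
    have "exp (- (x + 1)\<^sup>2 / 2) / sqrt (2 * pi) \<le> std_normal_density y" if "y \<in> {x..x+1}"
    proof -
      have "y\<^sup>2 \<le> (x + 1)\<^sup>2" using that x by (intro power_mono) auto
      then show ?thesis by (simp add: std_normal_density_def divide_right_mono)
    qed
    then show "ennreal (exp (- (x + 1)\<^sup>2 / 2) / sqrt (2 * pi)) * indicator {x..x + 1} y \<le> ennreal (std_normal_density y) * indicator {x..} y"
      by (auto simp: indicator_def intro!: ennreal_leI)
  qed
  also have "\<dots> = emeasure M (Y -` {x..} \<inter> space M)"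
    by (rule distributed_emeasure[OF Y, symmetric]) simp
  also have "Y -` {x..} \<inter> space M = {\<omega> \<in> space M. x \<le> Y \<omega>}" by auto
  finally show ?thesis by (simp add: emeasure_eq_measure)
qed

lemma (in prob_space) std_normal_combination_tail:
  assumes S: "finite S" and a: "\<And>i. i \<in> S \<Longrightarrow> 0 \<le> a i" and x: "0 \<le> x"
    and ind: "indep_vars (\<lambda>_. borel) Y S"
    and Y: "\<And>i. i \<in> S \<Longrightarrow> distributed M lborel (Y i) std_normal_density"
  shows "exp (- (x + 1)\<^sup>2 / 2) / sqrt (2 * pi)
    \<le> prob {\<omega> \<in> space M. x * sqrt (\<Sum>i\<in>S. (a i)\<^sup>2) \<le> (\<Sum>i\<in>S. a i * Y i \<omega>)}"
proof -
  \<comment> \<open>A zero coefficient gives a degenerate summand without a density. Such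
    coefficients must be allowed because \<open>1 / 0 = 0\<close> for an item with count
    zero.\<close>
  define S' where "S' = {i \<in> S. 0 < a i}"
  have S': "finite S'" "S' \<subseteq> S" and a': "\<And>i. i \<in> S' \<Longrightarrow> 0 < a i" using S by (auto simp: S'_def)
  have eq: "(\<Sum>i\<in>S. (a i)\<^sup>2) = (\<Sum>i\<in>S'. (a i)\<^sup>2)" "(\<Sum>i\<in>S. a i * Y i \<omega>) = (\<Sum>i\<in>S'. a i * Y i \<omega>)" for \<omega>
  proof -
    have "a i = 0" if "i \<in> S - S'" for i using a[of i] that by (auto simp: S'_def)
    then show "(\<Sum>i\<in>S. (a i)\<^sup>2) = (\<Sum>i\<in>S'. (a i)\<^sup>2)" "(\<Sum>i\<in>S. a i * Y i \<omega>) = (\<Sum>i\<in>S'. a i * Y i \<omega>)" for \<omega>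
      using S S' by (auto intro!: sum.mono_neutral_right)
  qed
  define b where "b = sqrt (\<Sum>i\<in>S'. (a i)\<^sup>2)"
  show ?thesis
  proof (cases "S' = {}")
    case True
    have "1 \<le> sqrt (2 * pi)" using pi_gt3 by simp
    moreover have "exp (- (x + 1)\<^sup>2 / 2) \<le> 1" by simp
    ultimately have "exp (- (x + 1)\<^sup>2 / 2) / sqrt (2 * pi) \<le> 1" 
      unfolding divide_le_eq by (smt (verit))
    then show ?thesis unfolding eq using True by (simp add: prob_space)
  next
    case False
    have b: "0 < b" unfolding b_def
      by (intro real_sqrt_gt_zero sum_pos S' False zero_less_power a')
    have nd: "distributed M lborel (\<lambda>\<omega>. a i * Y i \<omega>) (normal_density 0 (a i))" if "i \<in> S'" for i
      using normal_density_affine[OF Y, of i "a i" 0] a'[OF that] S' that by auto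
    have ind': "indep_vars (\<lambda>_. borel) (\<lambda>i \<omega>. a i * Y i \<omega>) S'"
      by (rule indep_vars_compose2[OF indep_vars_subset[OF ind S'(2)]]) simp
    have "distributed M lborel (\<lambda>\<omega>. \<Sum>i\<in>S'. a i * Y i \<omega>) (normal_density (\<Sum>i\<in>S'. 0) b)"
      unfolding b_def by (rule sum_indep_normal[OF S'(1) False ind' a' nd])
    then have "distributed M lborel (\<lambda>\<omega>. \<Sum>i\<in>S'. a i * Y i \<omega>) (normal_density 0 b)" by simp
    from normal_density_affine[OF this b, of "1 / b" 0]
    have "distributed M lborel (\<lambda>\<omega>. (\<Sum>i\<in>S'. a i * Y i \<omega>) / b) std_normal_density" using b by simp
    from std_normal_tail[OF this x]
    have "exp (- (x + 1)\<^sup>2 / 2) / sqrt (2 * pi) \<le> prob {\<omega> \<in> space M. x \<le> (\<Sum>i\<in>S'. a i * Y i \<omega>) / b}" .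
    also have "{\<omega> \<in> space M. x \<le> (\<Sum>i\<in>S'. a i * Y i \<omega>) / b} = {\<omega> \<in> space M. x * b \<le> (\<Sum>i\<in>S'. a i * Y i \<omega>)}"
      using b by (simp add: field_simps)
    finally show ?thesis unfolding eq by (simp add: b_def)
  qed
qed

text \<open>Round \<open>t\<close> is independent of the earlier rounds of the same trajectory, and
  \<open>V\<close> is independent of the whole trajectory; regrouping makes round \<open>t\<close>
  independent of the earlier rounds and \<open>V\<close> jointly. \<open>V\<close> will be the other
  trajectory together with the seed.\<close>

lemma (in prob_space) indep_rv_step:
  fixes Y :: "nat \<Rightarrow> 'a \<Rightarrow> nat \<Rightarrow> real" and V :: "'a \<Rightarrow> 'b" and d t :: nat
  defines "J \<equiv> {1..<t} \<times> {..<d}" and "K \<equiv> {t} \<times> {..<d}"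
  assumes Y: "indep_vars (\<lambda>_. borel) (\<lambda>(t, i) \<omega>. Y t \<omega> i) ({1..} \<times> {..<d})" and t: "1 \<le> t"
    and V: "indep_rv (traj_space d) (traj d Y) N V"
  shows "indep_rv (PiM K (\<lambda>_. borel)) (\<lambda>\<omega>. \<lambda>(s, i)\<in>K. Y s \<omega> i)
    (PiM J (\<lambda>_. borel) \<Otimes>\<^sub>M N) (\<lambda>\<omega>. (\<lambda>(s, i)\<in>J. Y s \<omega> i, V \<omega>))"
proof (rule indep_rv_assoc)
  have sub: "J \<subseteq> {1..} \<times> {..<d}" "K \<subseteq> {1..} \<times> {..<d}" "K \<inter> J = {}" using t by (auto simp: J_def K_def)
  have "indep_var (PiM K (\<lambda>_. borel)) (\<lambda>\<omega>. \<lambda>p\<in>K. (\<lambda>(t, i) \<omega>. Y t \<omega> i) p \<omega>)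
      (PiM J (\<lambda>_. borel)) (\<lambda>\<omega>. \<lambda>p\<in>J. (\<lambda>(t, i) \<omega>. Y t \<omega> i) p \<omega>)"
    by (rule indep_var_restrict[OF Y]) (use sub in auto)
  then have "indep_rv (PiM K (\<lambda>_. borel)) (\<lambda>\<omega>. \<lambda>p\<in>K. (\<lambda>(t, i) \<omega>. Y t \<omega> i) p \<omega>)
      (PiM J (\<lambda>_. borel)) (\<lambda>\<omega>. \<lambda>p\<in>J. (\<lambda>(t, i) \<omega>. Y t \<omega> i) p \<omega>)"
    by (rule indep_var_imp_indep_rv)
  then show "indep_rv (PiM K (\<lambda>_. borel)) (\<lambda>\<omega>. \<lambda>(s, i)\<in>K. Y s \<omega> i) (PiM J (\<lambda>_. borel)) (\<lambda>\<omega>. \<lambda>(s, i)\<in>J. Y s \<omega> i)"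
    by (simp add: case_prod_beta')
  have "(\<lambda>y. (restrict y K, restrict y J)) \<in> traj_space d \<rightarrow>\<^sub>M PiM K (\<lambda>_. borel) \<Otimes>\<^sub>M PiM J (\<lambda>_. borel)"
    unfolding traj_space_def using sub by (intro measurable_Pair measurable_restrict_subset)
  from indep_rv_compose[OF indep_rv_commute[OF V] this]
  have "indep_rv N V (PiM K (\<lambda>_. borel) \<Otimes>\<^sub>M PiM J (\<lambda>_. borel)) (\<lambda>\<omega>. (restrict (traj d Y \<omega>) K, restrict (traj d Y \<omega>) J))" .
  moreover have "restrict (traj d Y \<omega>) I = (\<lambda>(s, i)\<in>I. Y s \<omega> i)" if "I \<subseteq> {1..} \<times> {..<d}" for I \<omega>
    using that by (auto simp: traj_def restrict_def fun_eq_iff)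
  ultimately show "indep_rv (PiM K (\<lambda>_. borel) \<Otimes>\<^sub>M PiM J (\<lambda>_. borel))
      (\<lambda>\<omega>. (\<lambda>(s, i)\<in>K. Y s \<omega> i, \<lambda>(s, i)\<in>J. Y s \<omega> i)) N V"
    using sub by (subst indep_rv_commute) simp_all
qed

lemma (in prob_space) indep_vars_reindex:
  assumes inj: "inj_on f I" and ind: "indep_vars (\<lambda>_. N) Y (f ` I)"
  shows "indep_vars (\<lambda>_. N) (\<lambda>i. Y (f i)) I"
  unfolding indep_vars_def2
proof (intro conjI ballI)
  show "random_variable N (Y (f i))" if "i \<in> I" for i using ind that by (auto simp: indep_vars_def2)
  have "indep_sets (\<lambda>i. {Y i -` A \<inter> space M |A. A \<in> sets N}) (f ` I)" using ind by (simp add: indep_vars_def2)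
  note sets = this
  show "indep_sets (\<lambda>i. {Y (f i) -` A \<inter> space M |A. A \<in> sets N}) I"
  proof (rule indep_setsI)
    show "{Y (f i) -` A \<inter> space M |A. A \<in> sets N} \<subseteq> events" if "i \<in> I" for i
      using sets that by (auto simp: indep_sets_def)
    fix A J assume J: "J \<noteq> {}" "J \<subseteq> I" "finite J" and A: "\<forall>j\<in>J. A j \<in> {Y (f j) -` A \<inter> space M |A. A \<in> sets N}"
    define B where "B = (\<lambda>k. A (inv_into I f k))"
    have BA: "B (f j) = A j" if "j \<in> J" for j using inj that J by (auto simp: B_def inv_into_f_f)
    have "prob (\<Inter>k\<in>f ` J. B k) = (\<Prod>k\<in>f ` J. prob (B k))"
    proof (rule indep_setsD[OF sets])
      show "\<forall>k\<in>f ` J. B k \<in> {Y k -` A \<inter> space M |A. A \<in> sets N}"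
      proof
        fix k assume "k \<in> f ` J"
        then obtain j where "j \<in> J" "k = f j" by blast
        then show "B k \<in> {Y k -` A \<inter> space M |A. A \<in> sets N}" using A BA by simp
      qed
    qed (use J in auto)
    also have "(\<Prod>k\<in>f ` J. prob (B k)) = (\<Prod>j\<in>J. prob (A j))"
      using inj_on_subset[OF inj J(2)] BA by (subst prod.reindex) (auto intro!: prod.cong)
    finally show "prob (\<Inter>j\<in>J. A j) = (\<Prod>j\<in>J. prob (A j))" using BA by simp
  qed
qed

section \<open>Markov inequalities\<close>

lemma (in prob_space) prob_exp_Markov:
  assumes F: "F \<in> borel_measurable M" and K: "(\<integral>\<^sup>+\<omega>. F \<omega> \<partial>M) \<le> ennreal K" and K0: "0 \<le> K"
    and E: "E \<in> events" and le: "AE \<omega> in M. \<omega> \<in> E \<longrightarrow> ennreal (exp y) \<le> F \<omega>"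
  shows "prob E \<le> K * exp (- y)"
proof -
  have "ennreal (exp y) * emeasure M E = (\<integral>\<^sup>+\<omega>. ennreal (exp y) * indicator E \<omega> \<partial>M)"
    using E by (simp add: nn_integral_cmult)
  also have "\<dots> \<le> (\<integral>\<^sup>+\<omega>. F \<omega> \<partial>M)"
    by (intro nn_integral_mono_AE) (use le in eventually_elim, auto simp: indicator_def)
  also have "\<dots> \<le> ennreal K" by (rule K)
  finally have "ennreal (exp y * prob E) \<le> ennreal K"
    by (simp add: emeasure_eq_measure ennreal_mult)
  then have "exp y * prob E \<le> K" using K0 by (simp add: ennreal_le_iff)
  then show ?thesis by (simp only: exp_minus inverse_eq_divide) (simp add: pos_le_divide_eq mult.commute)
qed

text \<open>Only the expected count enters, so no independence between the events is required; the
  inaccurate rounds will be counted in this way.\<close>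

lemma (in prob_space) prob_count_ge:
  assumes S: "finite S" and E: "\<And>s. s \<in> S \<Longrightarrow> {\<omega> \<in> space M. P s \<omega>} \<in> events" and r: "0 < r"
  shows "prob {\<omega> \<in> space M. r \<le> real (card {s \<in> S. P s \<omega>})} \<le> (\<Sum>s\<in>S. prob {\<omega> \<in> space M. P s \<omega>}) / r"
proof -
  let ?u = "\<lambda>\<omega>. \<Sum>s\<in>S. indicator {\<omega> \<in> space M. P s \<omega>} \<omega> :: real"
  have u: "?u \<omega> = real (card {s \<in> S. P s \<omega>})" if "\<omega> \<in> space M" for \<omega>
  proof -
    have "?u \<omega> = (\<Sum>s\<in>S. of_bool (P s \<omega>))" using that by (intro sum.cong) (auto simp: indicator_def)
    also have "\<dots> = real (card (S \<inter> {s. P s \<omega>}))" using S by simp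
    also have "S \<inter> {s. P s \<omega>} = {s \<in> S. P s \<omega>}" by auto
    finally show ?thesis .
  qed
  have int: "integrable M (indicator {\<omega> \<in> space M. P s \<omega>} :: _ \<Rightarrow> real)" if "s \<in> S" for s
    using E[OF that] by (simp add: integrable_indicator_iff emeasure_eq_measure)
  have "prob {\<omega> \<in> space M. r \<le> ?u \<omega>} \<le> (\<integral>\<omega>. ?u \<omega> \<partial>M) / r"
    by (rule integral_Markov_inequality_measure[where A = "{}"]) (use int r in \<open>auto intro!: sum_nonneg\<close>)
  also have "(\<integral>\<omega>. ?u \<omega> \<partial>M) = (\<Sum>s\<in>S. prob {\<omega> \<in> space M. P s \<omega>})"
    using int E by (subst Bochner_Integration.integral_sum) (auto intro!: sum.cong)
  also have "{\<omega> \<in> space M. r \<le> ?u \<omega>} = {\<omega> \<in> space M. r \<le> real (card {s \<in> S. P s \<omega>})}"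
    using u by auto
  finally show ?thesis .
qed

section \<open>Nonanticipating actions\<close>

context bg_cts_run
begin

definition policy where
  "policy t = (SOME \<pi>. \<pi> \<in> history_space d t \<rightarrow>\<^sub>M count_space (Pow {..<d}) \<and>
     (AE \<omega> in M. A t \<omega> = \<pi> (history d (U \<omega>) (\<lambda>s. Z s \<omega>) (\<lambda>s. X s \<omega>) (\<lambda>s. A s \<omega>) t)))"

lemma policy:
  assumes "1 \<le> t"
  shows "policy t \<in> history_space d t \<rightarrow>\<^sub>M count_space (Pow {..<d})"
    "AE \<omega> in M. A t \<omega> = policy t (history d (U \<omega>) (\<lambda>s. Z s \<omega>) (\<lambda>s. X s \<omega>) (\<lambda>s. A s \<omega>) t)"
proof -
  have "\<exists>\<pi>. \<pi> \<in> history_space d t \<rightarrow>\<^sub>M count_space (Pow {..<d}) \<and>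
     (AE \<omega> in M. A t \<omega> = \<pi> (history d (U \<omega>) (\<lambda>s. Z s \<omega>) (\<lambda>s. X s \<omega>) (\<lambda>s. A s \<omega>) t))"
    using A_nonanticipating[OF assms] by blast
  from someI_ex[OF this]
  show "policy t \<in> history_space d t \<rightarrow>\<^sub>M count_space (Pow {..<d})"
    "AE \<omega> in M. A t \<omega> = policy t (history d (U \<omega>) (\<lambda>s. Z s \<omega>) (\<lambda>s. X s \<omega>) (\<lambda>s. A s \<omega>) t)"
    unfolding policy_def by blast+
qed

text \<open>
  The actions follow the policies only almost everywhere. Replaying the policies recursively gives
  a version that is a function of the information of the learner at every sample point.
\<close>

function act :: "nat \<Rightarrow> 'w \<Rightarrow> nat set" where
  "act t \<omega> = policy t (history d (U \<omega>) (\<lambda>s. Z s \<omega>) (\<lambda>s. X s \<omega>)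
     (\<lambda>s. if s < t then act s \<omega> else {}) t)"
  by auto
termination by (relation "Wellfounded.measure fst") auto

declare act.simps[simp del]

lemma history_cong:
  "(\<And>s. 1 \<le> s \<Longrightarrow> s < t \<Longrightarrow> a s = b s) \<Longrightarrow> history d u z x a t = history d u z x b t"
  by (auto simp: history_def restrict_def fun_eq_iff)

lemma act_eq: "act t \<omega> = policy t (history d (U \<omega>) (\<lambda>s. Z s \<omega>) (\<lambda>s. X s \<omega>) (\<lambda>s. act s \<omega>) t)"
  by (subst act.simps) (auto intro!: arg_cong[where f = "policy t"] history_cong)

lemma act_AE: "1 \<le> t \<Longrightarrow> AE \<omega> in M. act t \<omega> = A t \<omega>"
proof (induction t rule: less_induct)
  case (less t)
  have "AE \<omega> in M. \<forall>s\<in>{1..<t}. act s \<omega> = A s \<omega>"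
    by (rule AE_finite_allI) (use less in auto)
  with policy(2)[OF less.prems] show ?case
  proof eventually_elim
    case (elim \<omega>)
    have "act t \<omega> = policy t (history d (U \<omega>) (\<lambda>s. Z s \<omega>) (\<lambda>s. X s \<omega>) (\<lambda>s. A s \<omega>) t)"
      unfolding act_eq[of t] using elim by (intro arg_cong[where f = "policy t"] history_cong) auto
    then show ?case using elim by simp
  qed
qed

text \<open>The measure \<open>N\<close> is a parameter because the recursion is replayed over the
  full space and over two sub-sigma-algebras. What matters there is that the action of round
  \<open>t\<close> requires noise up to \<open>t\<close>, but outcomes only before
  \<open>t\<close>.\<close>

lemma act_measurable_gen:
  assumes U: "U \<in> borel_measurable N"
    and Z: "\<And>s i. 1 \<le> s \<Longrightarrow> s \<le> t \<Longrightarrow> i < d \<Longrightarrow> (\<lambda>\<omega>. Z s \<omega> i) \<in> borel_measurable N"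
    and X: "\<And>s i. 1 \<le> s \<Longrightarrow> s < t \<Longrightarrow> i < d \<Longrightarrow> (\<lambda>\<omega>. X s \<omega> i) \<in> borel_measurable N"
    and t: "1 \<le> t"
  shows "act t \<in> N \<rightarrow>\<^sub>M count_space (Pow {..<d})"
  using t Z X
proof (induction t rule: less_induct)
  case (less t)
  have act: "act s \<in> N \<rightarrow>\<^sub>M count_space (Pow {..<d})" if "1 \<le> s" "s < t" for s
    using that by (intro less.IH less.prems) auto
  have masked: "(\<lambda>\<omega>. if i \<in> act s \<omega> then X s \<omega> i else 0) \<in> borel_measurable N" if "1 \<le> s" "s < t" "i < d" for s i
  proof -
    have "Measurable.pred N (\<lambda>\<omega>. i \<in> act s \<omega>)"
      by (rule measurable_compose[OF act[OF that(1,2)]]) simp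
    then show ?thesis using less.prems(3)[OF that] by (intro measurable_If) (auto simp: pred_def)
  qed
  have "(\<lambda>\<omega>. history d (U \<omega>) (\<lambda>s. Z s \<omega>) (\<lambda>s. X s \<omega>) (\<lambda>s. act s \<omega>) t) \<in> N \<rightarrow>\<^sub>M history_space d t"
    unfolding history_def history_space_def split_beta
    by (intro measurable_Pair measurable_restrict U) (auto intro!: act masked less.prems)
  from measurable_compose[OF this policy(1)[OF less.prems(1)]]
  show ?case unfolding act_eq[symmetric] .
qed

lemma act_pred:
  assumes "act s \<in> N \<rightarrow>\<^sub>M count_space (Pow {..<d})" shows "Measurable.pred N (\<lambda>\<omega>. i \<in> act s \<omega>)"
  by (rule measurable_compose[OF assms]) simp

lemma act_measurable[measurable]: "1 \<le> t \<Longrightarrow> act t \<in> M \<rightarrow>\<^sub>M count_space (Pow {..<d})"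
  by (intro act_measurable_gen seed_measurable Z_meas X_meas) auto

lemma act_sub: "1 \<le> t \<Longrightarrow> \<omega> \<in> space M \<Longrightarrow> act t \<omega> \<subseteq> {..<d}"
  using measurable_space[OF act_measurable, of t \<omega>] by simp

text \<open>All of \<open>W\<close>, its future included, may count as known, since the two
  trajectories and the seed are independent. With outcomes as \<open>Y\<close>, the action of round
  \<open>t\<close> is known because its noise belongs to \<open>W\<close>; with noises as
  \<open>Y\<close>, only the actions before \<open>t\<close> are known.\<close>

definition known_before :: "(nat \<Rightarrow> 'w \<Rightarrow> nat \<Rightarrow> real) \<Rightarrow> (nat \<Rightarrow> 'w \<Rightarrow> nat \<Rightarrow> real) \<Rightarrow> nat \<Rightarrow> 'w measure" where
  "known_before Y W t = vimage_algebra (space M)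
     (\<lambda>\<omega>. (\<lambda>(s, i)\<in>{1..<t} \<times> {..<d}. Y s \<omega> i, (traj d W \<omega>, U \<omega>)))
     (PiM ({1..<t} \<times> {..<d}) (\<lambda>_. borel) \<Otimes>\<^sub>M (traj_space d \<Otimes>\<^sub>M borel))"

abbreviation "outcomes_before \<equiv> known_before X Z"
abbreviation "noises_before \<equiv> known_before Z X"

section \<open>Independence of the current round from the known data\<close>

lemma traj_measurable: "traj d X \<in> M \<rightarrow>\<^sub>M traj_space d" "traj d Z \<in> M \<rightarrow>\<^sub>M traj_space d"
  unfolding traj_def[abs_def] traj_space_def split_beta
  by (intro measurable_restrict; auto intro!: X_meas Z_meas)+

lemma indep_XZ_seed: "indep_rv (traj_space d \<Otimes>\<^sub>M traj_space d) (\<lambda>\<omega>. (traj d X \<omega>, traj d Z \<omega>)) borel U"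
  by (rule indep_rv_of_indep_set[OF _ seed_measurable seed_indep]) (use traj_measurable in measurable)

lemma indep_X_rest: "indep_rv (traj_space d) (traj d X) (traj_space d \<Otimes>\<^sub>M borel) (\<lambda>\<omega>. (traj d Z \<omega>, U \<omega>))"
  by (rule indep_rv_assoc[OF indep_var_imp_indep_rv[OF Z_indep_X] indep_XZ_seed])

lemma indep_Z_rest: "indep_rv (traj_space d) (traj d Z) (traj_space d \<Otimes>\<^sub>M borel) (\<lambda>\<omega>. (traj d X \<omega>, U \<omega>))"
proof (rule indep_rv_assoc[OF indep_rv_commute[OF indep_var_imp_indep_rv[OF Z_indep_X]]])
  have "(\<lambda>p. (snd p, fst p)) \<in> traj_space d \<Otimes>\<^sub>M traj_space d \<rightarrow>\<^sub>M traj_space d \<Otimes>\<^sub>M traj_space d" by measurable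
  from indep_rv_compose[OF indep_rv_commute[OF indep_XZ_seed] this]
  show "indep_rv (traj_space d \<Otimes>\<^sub>M traj_space d) (\<lambda>\<omega>. (traj d Z \<omega>, traj d X \<omega>)) borel U"
    by (intro indep_rv_commute[of borel U]) simp
qed

lemma indep_outcome:
  assumes "1 \<le> t" "h \<in> outcomes_before t \<rightarrow>\<^sub>M N"
  shows "indep_rv (PiM ({t} \<times> {..<d}) (\<lambda>_. borel)) (\<lambda>\<omega>. \<lambda>(s, i)\<in>{t} \<times> {..<d}. X s \<omega> i) N h"
  using assms indep_rv_vimage[OF indep_rv_step[OF X_indep _ indep_X_rest]]
  unfolding known_before_def by blast

lemma indep_noise:
  assumes "1 \<le> t" "h \<in> noises_before t \<rightarrow>\<^sub>M N"
  shows "indep_rv (PiM ({t} \<times> {..<d}) (\<lambda>_. borel)) (\<lambda>\<omega>. \<lambda>(s, i)\<in>{t} \<times> {..<d}. Z s \<omega> i) N h"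
  using assms indep_rv_vimage[OF indep_rv_step[OF Z_indep _ indep_Z_rest]]
  unfolding known_before_def by blast

lemma restrict_measurable:
  assumes "\<And>s i. (s, i) \<in> J \<Longrightarrow> (\<lambda>\<omega>. Y s \<omega> i) \<in> borel_measurable N"
  shows "(\<lambda>\<omega>. \<lambda>(s, i)\<in>J. Y s \<omega> i) \<in> N \<rightarrow>\<^sub>M PiM J (\<lambda>_. borel)"
  unfolding split_beta by (intro measurable_restrict) (use assms in auto)

lemma known_before_measurable:
  fixes t :: nat
  assumes Y: "\<And>s i. 1 \<le> s \<Longrightarrow> i < d \<Longrightarrow> (\<lambda>\<omega>. Y s \<omega> i) \<in> borel_measurable M"
    and W: "traj d W \<in> M \<rightarrow>\<^sub>M traj_space d"
  shows "U \<in> borel_measurable (known_before Y W t)"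
    "\<And>s i. 1 \<le> s \<Longrightarrow> i < d \<Longrightarrow> (\<lambda>\<omega>. W s \<omega> i) \<in> borel_measurable (known_before Y W t)"
    "\<And>s i. 1 \<le> s \<Longrightarrow> s < t \<Longrightarrow> i < d \<Longrightarrow> (\<lambda>\<omega>. Y s \<omega> i) \<in> borel_measurable (known_before Y W t)"
proof -
  let ?\<Phi> = "\<lambda>\<omega>. (\<lambda>(s, i)\<in>{1..<t} \<times> {..<d}. Y s \<omega> i, (traj d W \<omega>, U \<omega>))"
  let ?N = "PiM ({1..<t} \<times> {..<d}) (\<lambda>_. borel) \<Otimes>\<^sub>M (traj_space d \<Otimes>\<^sub>M borel) :: ((nat \<times> nat \<Rightarrow> real) \<times> (nat \<times> nat \<Rightarrow> real) \<times> real) measure"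
  have "?\<Phi> \<in> M \<rightarrow>\<^sub>M ?N"
    by (intro measurable_Pair restrict_measurable W seed_measurable) (auto intro: Y)
  then have \<Phi>: "?\<Phi> \<in> known_before Y W t \<rightarrow>\<^sub>M ?N"
    unfolding known_before_def by (intro measurable_vimage_algebra1) (auto dest: measurable_space)
  have "(\<lambda>p. snd (snd p)) \<in> ?N \<rightarrow>\<^sub>M borel" by measurable
  from measurable_compose[OF \<Phi> this] show "U \<in> borel_measurable (known_before Y W t)" by simp
  show "(\<lambda>\<omega>. W s \<omega> i) \<in> borel_measurable (known_before Y W t)" if "1 \<le> s" "i < d" for s i
  proof -
    have "(\<lambda>p. fst (snd p) (s, i)) \<in> ?N \<rightarrow>\<^sub>M borel"
      unfolding traj_space_def
      by (rule measurable_compose[OF _ measurable_component_singleton[of "(s, i)" "{1..} \<times> {..<d}"]]) (use that in auto)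
    from measurable_compose[OF \<Phi> this] show ?thesis using that by (simp add: traj_def)
  qed
  show "(\<lambda>\<omega>. Y s \<omega> i) \<in> borel_measurable (known_before Y W t)" if "1 \<le> s" "s < t" "i < d" for s i
  proof -
    have "(\<lambda>p. fst p (s, i)) \<in> ?N \<rightarrow>\<^sub>M borel"
      by (rule measurable_compose[OF _ measurable_component_singleton[of "(s, i)" "{1..<t} \<times> {..<d}"]]) (use that in auto)
    from measurable_compose[OF \<Phi> this] show ?thesis using that by simp
  qed
qed

lemmas outcomes_before_measurable = known_before_measurable[OF X_meas traj_measurable(2)]
lemmas noises_before_measurable = known_before_measurable[OF Z_meas traj_measurable(1)]

lemma act_outcomes_before: "1 \<le> s \<Longrightarrow> s \<le> t \<Longrightarrow> act s \<in> outcomes_before t \<rightarrow>\<^sub>M count_space (Pow {..<d})"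
  by (intro act_measurable_gen outcomes_before_measurable) auto

lemma act_noises_before: "1 \<le> s \<Longrightarrow> s < t \<Longrightarrow> act s \<in> noises_before t \<rightarrow>\<^sub>M count_space (Pow {..<d})"
  by (intro act_measurable_gen noises_before_measurable) auto

end

section \<open>An exponential supermartingale\<close>

context bg_cts_run
begin

definition plays :: "nat \<Rightarrow> 'w \<Rightarrow> nat \<Rightarrow> nat" where
  "plays t \<omega> i = num_plays (\<lambda>s. act s \<omega>) t i"

definition dev :: "nat \<Rightarrow> 'w \<Rightarrow> nat \<Rightarrow> real" where
  "dev t \<omega> i = (\<Sum>s = 1..<t. if i \<in> act s \<omega> then X s \<omega> i - \<mu> i else 0)"

text \<open>Each summand is the play count times the squared error of the empirical mean, that is,
  the squared error in units of its own standard deviation up to \<open>\<sigma>\<close>.\<close>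

definition sq_dev :: "nat set \<Rightarrow> nat \<Rightarrow> 'w \<Rightarrow> real" where
  "sq_dev S t \<omega> = (\<Sum>i\<in>S. (dev t \<omega> i)\<^sup>2 / real (plays t \<omega> i))"

lemma plays_1[simp]: "plays (Suc 0) \<omega> i = 0"
  by (simp add: plays_def num_plays_def)

lemma plays_Suc: "1 \<le> t \<Longrightarrow> plays (Suc t) \<omega> i = plays t \<omega> i + of_bool (i \<in> act t \<omega>)"
  unfolding plays_def by (rule num_plays_Suc)

lemma plays_less: "1 \<le> t \<Longrightarrow> plays t \<omega> i < t"
proof -
  assume t: "1 \<le> t"
  have "plays t \<omega> i \<le> card {1..<t}" unfolding plays_def num_plays_def by (intro card_mono) auto
  then show ?thesis using t by simp
qed

lemma dev_1[simp]: "dev (Suc 0) \<omega> i = 0"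
  by (simp add: dev_def)

lemma dev_Suc: "1 \<le> t \<Longrightarrow> dev (Suc t) \<omega> i = dev t \<omega> i + (if i \<in> act t \<omega> then X t \<omega> i - \<mu> i else 0)"
  by (simp add: dev_def)

lemma plays_measurable_gen:
  assumes "\<And>s. 1 \<le> s \<Longrightarrow> s < t \<Longrightarrow> act s \<in> N \<rightarrow>\<^sub>M count_space (Pow {..<d})"
  shows "(\<lambda>\<omega>. real (plays t \<omega> i)) \<in> borel_measurable N"
proof -
  have "(\<lambda>\<omega>. of_bool (i \<in> act s \<omega>) :: real) \<in> borel_measurable N" if "s \<in> {1..<t}" for s
    by (rule measurable_compose[OF assms]) (use that in auto)
  then show ?thesis unfolding plays_def num_plays_sum by (intro borel_measurable_sum) auto
qed

lemma dev_measurable_gen: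
  assumes "\<And>s. 1 \<le> s \<Longrightarrow> s < t \<Longrightarrow> act s \<in> N \<rightarrow>\<^sub>M count_space (Pow {..<d})"
    and "\<And>s. 1 \<le> s \<Longrightarrow> s < t \<Longrightarrow> (\<lambda>\<omega>. X s \<omega> i) \<in> borel_measurable N"
  shows "(\<lambda>\<omega>. dev t \<omega> i) \<in> borel_measurable N"
  unfolding dev_def
proof (intro borel_measurable_sum measurable_If)
  fix s assume s: "s \<in> {1..<t}"
  show "(\<lambda>\<omega>. X s \<omega> i - \<mu> i) \<in> borel_measurable N" using assms(2)[of s] s by simp
  have "Measurable.pred N (\<lambda>\<omega>. i \<in> act s \<omega>)" by (rule act_pred[OF assms(1)]) (use s in auto)
  then show "{x \<in> space N. i \<in> act s x} \<in> sets N" by (simp add: pred_def)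
qed simp

lemma plays_measurable[measurable]: "(\<lambda>\<omega>. real (plays t \<omega> i)) \<in> borel_measurable M"
  by (intro plays_measurable_gen act_measurable)

lemma dev_measurable[measurable]: "i < d \<Longrightarrow> (\<lambda>\<omega>. dev t \<omega> i) \<in> borel_measurable M"
  by (intro dev_measurable_gen act_measurable X_meas)

lemma sq_dev_measurable[measurable]: "S \<subseteq> {..<d} \<Longrightarrow> sq_dev S t \<in> borel_measurable M"
  unfolding sq_dev_def[abs_def] by (intro borel_measurable_sum borel_measurable_divide) auto

text \<open>The variance proxy may be any \<open>s2\<close> above \<open>\<sigma>\<^sup>2\<close>:
  the Gaussian mixtures need a positive one, and the freedom is used when
  \<open>\<sigma> = 0\<close>.\<close>

lemma subgaussian_increment:
  assumes t: "1 \<le> t" and B: "B \<subseteq> {..<d}" and s: "\<sigma>\<^sup>2 \<le> s2"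
  shows "(\<integral>\<^sup>+\<omega>. ennreal (exp (\<Sum>i\<in>B. u i * (X t \<omega> i - \<mu> i) - (u i)\<^sup>2 * s2 / 2)) \<partial>M) \<le> 1"
proof -
  define v where "v i = (if i \<in> B then u i else 0)" for i
  define K where "K = (\<Sum>i\<in>B. - u i * \<mu> i - (u i)\<^sup>2 * s2 / 2)"
  have fB: "finite B" using B by (rule finite_subset) simp
  have v: "(\<Sum>i<d. v i * y i) = (\<Sum>i\<in>B. u i * y i)" "(\<Sum>i<d. (v i)\<^sup>2) = (\<Sum>i\<in>B. (u i)\<^sup>2)" for y
    unfolding v_def using B by (auto intro!: sum.mono_neutral_cong_right)
  have "(\<integral>\<^sup>+\<omega>. ennreal (exp (\<Sum>i\<in>B. u i * (X t \<omega> i - \<mu> i) - (u i)\<^sup>2 * s2 / 2)) \<partial>M)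
      = (\<integral>\<^sup>+\<omega>. ennreal (exp K) * ennreal (exp (\<Sum>i<d. v i * X t \<omega> i)) \<partial>M)"
    by (intro nn_integral_cong)
      (simp add: v K_def ennreal_mult[symmetric] exp_add[symmetric] sum.distrib[symmetric] algebra_simps)
  also have "\<dots> = ennreal (exp K) * (\<integral>\<^sup>+\<omega>. ennreal (exp (\<Sum>i<d. v i * X t \<omega> i)) \<partial>M)"
    using subgaussian_integrable[OF t, of v] by (intro nn_integral_cmult) auto
  also have "(\<integral>\<^sup>+\<omega>. ennreal (exp (\<Sum>i<d. v i * X t \<omega> i)) \<partial>M) = ennreal (expectation (\<lambda>\<omega>. exp (\<Sum>i<d. v i * X t \<omega> i)))"
    using subgaussian_integrable[OF t, of v] by (intro nn_integral_eq_integral) auto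
  also have "ennreal (exp K) * \<dots> = ennreal (exp K * expectation (\<lambda>\<omega>. exp (\<Sum>i<d. v i * X t \<omega> i)))"
    by (simp add: ennreal_mult')
  also have "\<dots> \<le> ennreal (exp K * exp ((\<Sum>i<d. v i * \<mu> i) + (\<Sum>i<d. (v i)\<^sup>2) * \<sigma>\<^sup>2 / 2))"
    by (intro ennreal_leI mult_left_mono subgaussian t) auto
  also have "\<dots> \<le> 1"
  proof -
    have "(\<Sum>i\<in>B. (u i)\<^sup>2) * \<sigma>\<^sup>2 \<le> (\<Sum>i\<in>B. (u i)\<^sup>2) * s2"
      by (intro mult_left_mono s sum_nonneg) auto
    then have "K + ((\<Sum>i<d. v i * \<mu> i) + (\<Sum>i<d. (v i)\<^sup>2) * \<sigma>\<^sup>2 / 2) \<le> 0"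
      unfolding v K_def by (simp add: sum_subtractf sum_negf sum_divide_distrib[symmetric] sum_distrib_right[symmetric])
    then show ?thesis by (simp add: exp_add[symmetric])
  qed
  finally show ?thesis .
qed

text \<open>Given the action of round \<open>t\<close>, only its items contribute new terms, and
  their factor has mean at most 1 by \<open>subgaussian_increment\<close>. Subtracting the actual
  count compensates exactly the plays that took place, however adaptively they were chosen.\<close>

lemma exp_supermartingale:
  assumes t: "1 \<le> t" and S: "S \<subseteq> {..<d}" and s: "\<sigma>\<^sup>2 \<le> s2"
  shows "(\<integral>\<^sup>+\<omega>. ennreal (exp (\<Sum>i\<in>S. u i * dev t \<omega> i - (u i)\<^sup>2 * s2 * real (plays t \<omega> i) / 2)) \<partial>M) \<le> 1"
  using t
proof (induction t rule: dec_induct)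
  case base
  show ?case by (simp add: emeasure_space_1)
next
  case (step t)
  have fS: "finite S" using S by (rule finite_subset) simp
  define W where "W \<omega> = ennreal (exp (\<Sum>i\<in>S. u i * dev t \<omega> i - (u i)\<^sup>2 * s2 * real (plays t \<omega> i) / 2))" for \<omega>
  define f where "f B y = ennreal (exp (\<Sum>i\<in>S \<inter> B. u i * (y (t, i) - \<mu> i) - (u i)\<^sup>2 * s2 / 2))"
    for B and y :: "nat \<times> nat \<Rightarrow> real"
  let ?Y = "\<lambda>\<omega>. \<lambda>(s, i)\<in>{t} \<times> {..<d}. X s \<omega> i"
  have W_meas: "W \<in> borel_measurable (outcomes_before t)"
  proof -
    have [measurable]: "(\<lambda>\<omega>. dev t \<omega> i) \<in> borel_measurable (outcomes_before t)" if "i \<in> S" for i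
      using that S by (intro dev_measurable_gen act_outcomes_before outcomes_before_measurable) auto
    have [measurable]: "(\<lambda>\<omega>. real (plays t \<omega> i)) \<in> borel_measurable (outcomes_before t)" for i
      by (intro plays_measurable_gen act_outcomes_before) auto
    show ?thesis unfolding W_def by measurable
  qed
  \<comment> \<open>The action of round \<open>t\<close> is chosen before its outcome is seen, so
    fixing it to \<open>B\<close> does not disturb the law of the outcome.\<close>
  have ind_meas: "(\<lambda>\<omega>. indicator {\<omega> \<in> space M. act t \<omega> = B} \<omega> * W \<omega>) \<in> borel_measurable (outcomes_before t)" for B
  proof -
    have "Measurable.pred (outcomes_before t) (\<lambda>\<omega>. act t \<omega> = B)"
      by (rule measurable_compose[OF act_outcomes_before]) (use step in auto)
    then have "{\<omega> \<in> space M. act t \<omega> = B} \<in> sets (outcomes_before t)"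
      by (simp add: pred_def known_before_def)
    then show ?thesis using W_meas by (intro borel_measurable_times_ennreal borel_measurable_indicator)
  qed
  have f_meas: "f B \<in> borel_measurable (PiM ({t} \<times> {..<d}) (\<lambda>_. borel))" for B
  proof -
    have [measurable]: "(\<lambda>y. y (t, i)) \<in> borel_measurable (PiM ({t} \<times> {..<d}) (\<lambda>_. borel))" if "i \<in> S \<inter> B" for i
      using that S by (intro measurable_component_singleton) auto
    show ?thesis unfolding f_def by measurable
  qed
  have f_eq: "f B (?Y \<omega>) = ennreal (exp (\<Sum>i\<in>S \<inter> B. u i * (X t \<omega> i - \<mu> i) - (u i)\<^sup>2 * s2 / 2))" for B \<omega>
    unfolding f_def using S by (intro arg_cong[where f = "\<lambda>x. ennreal (exp x)"] sum.cong refl) auto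
  have "(\<integral>\<^sup>+\<omega>. ennreal (exp (\<Sum>i\<in>S. u i * dev (Suc t) \<omega> i - (u i)\<^sup>2 * s2 * real (plays (Suc t) \<omega> i) / 2)) \<partial>M)
      = (\<integral>\<^sup>+\<omega>. f (act t \<omega>) (?Y \<omega>) * W \<omega> \<partial>M)"
  proof (intro nn_integral_cong)
    fix \<omega> assume w: "\<omega> \<in> space M"
    have "(\<Sum>i\<in>S. u i * dev (Suc t) \<omega> i - (u i)\<^sup>2 * s2 * real (plays (Suc t) \<omega> i) / 2)
      = (\<Sum>i\<in>S. (u i * dev t \<omega> i - (u i)\<^sup>2 * s2 * real (plays t \<omega> i) / 2)
          + (if i \<in> act t \<omega> then u i * (X t \<omega> i - \<mu> i) - (u i)\<^sup>2 * s2 / 2 else 0))"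
      using step by (intro sum.cong) (auto simp: dev_Suc plays_Suc algebra_simps add_divide_distrib)
    also have "\<dots> = (\<Sum>i\<in>S. u i * dev t \<omega> i - (u i)\<^sup>2 * s2 * real (plays t \<omega> i) / 2)
        + (\<Sum>i\<in>S \<inter> act t \<omega>. u i * (X t \<omega> i - \<mu> i) - (u i)\<^sup>2 * s2 / 2)"
      using fS by (simp add: sum.distrib sum.inter_restrict)
    finally show "ennreal (exp (\<Sum>i\<in>S. u i * dev (Suc t) \<omega> i - (u i)\<^sup>2 * s2 * real (plays (Suc t) \<omega> i) / 2))
       = f (act t \<omega>) (?Y \<omega>) * W \<omega>"
      unfolding f_eq W_def by (simp add: exp_add ennreal_mult mult.commute)
  qed
  also have "\<dots> \<le> 1 * (\<integral>\<^sup>+\<omega>. W \<omega> \<partial>M)"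
  proof (rule nn_integral_conditioning[where I = "Pow {..<d}" and \<kappa> = "act t" and f = f and Y = ?Y and H = W])
    show "act t \<omega> \<in> Pow {..<d}" if "\<omega> \<in> space M" for \<omega> using act_sub[of t \<omega>] that step by auto
    show "indep_rv (PiM ({t} \<times> {..<d}) (\<lambda>_. borel)) ?Y borel (\<lambda>\<omega>. indicator {\<omega> \<in> space M. act t \<omega> = B} \<omega> * W \<omega>)" for B
      by (rule indep_outcome[OF _ ind_meas]) (use step in auto)
    show "f B \<in> borel_measurable (PiM ({t} \<times> {..<d}) (\<lambda>_. borel))" for B by (rule f_meas)
    show "(\<integral>\<^sup>+\<omega>. f B (?Y \<omega>) \<partial>M) \<le> 1" for B
      unfolding f_eq using step S s by (intro subgaussian_increment) auto
  qed simp
  also have "\<dots> \<le> 1" unfolding W_def using step.IH by simp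
  finally show ?case .
qed

end

section \<open>Self-normalised concentration\<close>

context bg_cts_run
begin

lemma plays_pos: "AE \<omega> in M. \<forall>t i. d < t \<longrightarrow> i < d \<longrightarrow> 1 \<le> plays t \<omega> i"
proof -
  have "AE \<omega> in M. \<forall>s\<in>{1..d}. act s \<omega> = init s"
  proof (rule AE_finite_allI)
    fix s assume s: "s \<in> {1..d}"
    then have "1 \<le> s" "s \<le> d" by auto
    from act_AE[OF this(1)] A_init[OF this] show "AE \<omega> in M. act s \<omega> = init s" by eventually_elim simp
  qed simp
  then show ?thesis
  proof eventually_elim
    case (elim \<omega>)
    show ?case
    proof (intro allI impI)
      fix t i assume t: "d < t" and i: "i < d"
      then obtain s where s: "s \<in> {1..d}" "i \<in> init s" using init_cover by blast
      then have "s \<in> {s \<in> {1..<t}. i \<in> act s \<omega>}" using elim t by auto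
      then have "0 < card {s \<in> {1..<t}. i \<in> act s \<omega>}" by (subst card_gt_0_iff) auto
      then show "1 \<le> plays t \<omega> i" by (simp add: plays_def num_plays_def)
    qed
  qed
qed

text \<open>
  Mixing the exponential supermartingale over Gaussian \<open>u\<close> of precision \<open>c\<close> is sharp only when \<open>c\<close>
  is proportional to the random count \<open>N\<close>; a geometric grid of about \<open>ln t\<close> precisions
  always contains one with \<open>N / (9 e) \<le> c \<le> N / 9\<close>.
\<close>

definition grid_density :: "real \<Rightarrow> nat \<Rightarrow> real \<Rightarrow> real" where
  "grid_density s K u = (\<Sum>k<K. normal_density 0 (1 / (s * sqrt (exp (real k) / 9))) u)"

lemma grid_density_nonneg: "0 \<le> grid_density s K u"
  unfolding grid_density_def by (intro sum_nonneg) simp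

lemma grid_density_measurable[measurable]: "grid_density s K \<in> borel_measurable borel"
  unfolding grid_density_def[abs_def] by measurable

lemma nn_integral_grid_density:
  assumes "0 < s" shows "(\<integral>\<^sup>+u. ennreal (grid_density s K u) \<partial>lborel) = ennreal (real K)"
proof -
  have "(\<integral>\<^sup>+u. ennreal (normal_density 0 (1 / (s * sqrt (exp (real k) / 9))) u) \<partial>lborel) = 1" for k
    using assms by (subst nn_integral_eq_integral) auto
  moreover have "(\<integral>\<^sup>+u. ennreal (grid_density s K u) \<partial>lborel)
      = (\<integral>\<^sup>+u. (\<Sum>k<K. ennreal (normal_density 0 (1 / (s * sqrt (exp (real k) / 9))) u)) \<partial>lborel)"
    unfolding grid_density_def by (intro nn_integral_cong sum_ennreal[symmetric]) simp
  ultimately show ?thesis by (subst (asm) nn_integral_sum) (auto simp: ennreal_of_nat_eq_real_of_nat)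
qed

text \<open>Only the grid point with \<open>k\<close> the integer part of \<open>ln N\<close> is
  kept. Its precision \<open>c \<le> N / 9\<close> gives \<open>N + c \<le> 10 * N / 9\<close>,
  hence the rate 9 / 20 in place of 1 / 2; \<open>c\<close> being at least
  \<open>N / (9 * exp 1)\<close> keeps the prefactor above \<open>exp (- 2)\<close>.\<close>

lemma grid_mixture_ge:
  assumes s: "0 < s" and N: "1 \<le> N" "ln (real N) < real K"
  shows "ennreal (exp (- 2 + 9 * D\<^sup>2 / (20 * s\<^sup>2 * real N)))
    \<le> (\<integral>\<^sup>+u. ennreal (exp (u * D - u\<^sup>2 * s\<^sup>2 * real N / 2) * grid_density s K u) \<partial>lborel)"
proof -
  define k where "k = nat \<lfloor>ln (real N)\<rfloor>"
  define c where "c = exp (real k) / 9"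
  have ln0: "0 \<le> ln (real N)" using N by simp
  have k1: "real k \<le> ln (real N)" "ln (real N) < real k + 1" using ln0 unfolding k_def by linarith+
  then have kK: "k < K" using N by linarith
  have "exp (real k) \<le> real N" using k1(1) N by (metis exp_le_cancel_iff exp_ln of_nat_0_less_iff less_le_trans zero_less_one)
  then have c: "0 < c" "c \<le> real N / 9" by (auto simp: c_def)
  have "real N < exp (real k + 1)" using k1(2) N by (metis exp_less_cancel_iff exp_ln of_nat_0_less_iff less_le_trans zero_less_one)
  then have Nc: "real N \<le> 9 * exp 1 * c" by (simp add: c_def exp_add mult.commute)
  \<comment> \<open>It suffices that \<open>10 \<le> exp 1 ^ 3\<close>, which follows from
    \<open>exp 1 \<ge> 9 / 4\<close>.\<close>
  have e4: "1 + 9 * exp 1 \<le> (exp 4 :: real)"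
  proof -
    have "(3 / 2)\<^sup>2 \<le> (exp (1 / 2) :: real)\<^sup>2" using exp_ge_add_one_self[of "1 / 2"] by (intro power_mono) auto
    then have e: "9 / 4 \<le> (exp 1 :: real)" by (simp add: power2_eq_square mult_exp_exp)
    have "(9 / 4) ^ 3 \<le> (exp 1 :: real) ^ 3" using e by (intro power_mono) auto
    then have "10 \<le> (exp 1 :: real) ^ 3" by (simp add: power3_eq_cube)
    then have "10 * exp 1 \<le> exp 1 ^ 3 * (exp 1 :: real)" by (intro mult_right_mono) auto
    also have "\<dots> = exp 4" by (simp add: exp_of_nat_mult[symmetric] mult_exp_exp)
    finally show ?thesis using e by linarith
  qed
  have r: "exp (- 4) \<le> c / (real N + c)"
  proof -
    have "real N + c \<le> exp 4 * c" using Nc c e4 mult_right_mono[OF e4, of c] by (simp add: algebra_simps)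
    then show ?thesis using c N by (simp add: exp_minus field_simps)
  qed
  have "exp (- 2) = sqrt (exp (- 4 :: real))"
    by (rule real_sqrt_unique[symmetric]) (auto simp: power2_eq_square mult_exp_exp)
  then have r': "exp (- 2) \<le> sqrt (c / (real N + c))" using r by (metis real_sqrt_le_iff)
  have q: "9 * D\<^sup>2 / (20 * s\<^sup>2 * real N) \<le> D\<^sup>2 / (2 * s\<^sup>2 * (real N + c))"
  proof -
    have "9 * (2 * s\<^sup>2 * (real N + c)) \<le> 20 * s\<^sup>2 * real N"
    proof -
      have "9 * (real N + c) \<le> 10 * real N" using c by simp
      then have "2 * s\<^sup>2 * (9 * (real N + c)) \<le> 2 * s\<^sup>2 * (10 * real N)" by (intro mult_left_mono) auto
      then show ?thesis by (simp add: algebra_simps)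
    qed
    then have "D\<^sup>2 / (20 * s\<^sup>2 * real N) \<le> D\<^sup>2 / (9 * (2 * s\<^sup>2 * (real N + c)))"
      using s c N by (intro divide_left_mono) auto
    then have "9 * (D\<^sup>2 / (20 * s\<^sup>2 * real N)) \<le> 9 * (D\<^sup>2 / (9 * (2 * s\<^sup>2 * (real N + c))))"
      by (rule mult_left_mono) simp
    moreover have "9 * (D\<^sup>2 / (9 * w)) = D\<^sup>2 / w" for w :: real by simp
    ultimately show ?thesis unfolding times_divide_eq_right[symmetric] by (simp add: ac_simps)
  qed
  have "exp (- 2 + 9 * D\<^sup>2 / (20 * s\<^sup>2 * real N)) = exp (- 2) * exp (9 * D\<^sup>2 / (20 * s\<^sup>2 * real N))"
    by (rule exp_add)
  also have "\<dots> \<le> sqrt (c / (real N + c)) * exp (D\<^sup>2 / (2 * s\<^sup>2 * (real N + c)))"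
    using r' q c by (intro mult_mono) auto
  finally have "ennreal (exp (- 2 + 9 * D\<^sup>2 / (20 * s\<^sup>2 * real N)))
      \<le> ennreal (sqrt (c / (real N + c)) * exp (D\<^sup>2 / (2 * s\<^sup>2 * (real N + c))))"
    by (rule ennreal_leI)
  also have "\<dots> = (\<integral>\<^sup>+u. ennreal (exp (u * D - u\<^sup>2 * s\<^sup>2 * real N / 2) * normal_density 0 (1 / (s * sqrt c)) u) \<partial>lborel)"
    using s c N by (intro gaussian_mixture[symmetric]) auto
  also have "\<dots> \<le> (\<integral>\<^sup>+u. ennreal (exp (u * D - u\<^sup>2 * s\<^sup>2 * real N / 2) * grid_density s K u) \<partial>lborel)"
    unfolding grid_density_def c_def using kK
    by (intro nn_integral_mono ennreal_leI mult_left_mono member_le_sum) auto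
  finally show ?thesis .
qed

text \<open>The product of one-dimensional mixtures is one integral over vectors \<open>u\<close>.
  By Fubini the expectation is taken first for fixed \<open>u\<close>, where it is at most 1; the
  total mass of the unnormalised mixing measure, \<open>K\<close> per coordinate, remains.\<close>

lemma grid_mixture_expectation:
  assumes t: "1 \<le> t" and S: "S \<subseteq> {..<d}" and s: "0 < s" "\<sigma> \<le> s"
  shows "(\<lambda>\<omega>. \<Prod>i\<in>S. \<integral>\<^sup>+u. ennreal (exp (u * dev t \<omega> i - u\<^sup>2 * s\<^sup>2 * real (plays t \<omega> i) / 2)
          * grid_density s K u) \<partial>lborel) \<in> borel_measurable M" (is "?F \<in> _")
    and "(\<integral>\<^sup>+\<omega>. (\<Prod>i\<in>S. \<integral>\<^sup>+u. ennreal (exp (u * dev t \<omega> i - u\<^sup>2 * s\<^sup>2 * real (plays t \<omega> i) / 2)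
          * grid_density s K u) \<partial>lborel) \<partial>M) \<le> ennreal (real K ^ card S)"
proof -
  have fS: "finite S" using S by (rule finite_subset) simp
  have [measurable]: "(\<lambda>\<omega>. dev t \<omega> i) \<in> borel_measurable M" if "i \<in> S" for i using that S by auto
  interpret P: product_sigma_finite "\<lambda>_ :: nat. lborel :: real measure" by unfold_locales
  interpret PS: sigma_finite_measure "PiM S (\<lambda>_. lborel :: real measure)" by (rule P.sigma_finite[OF fS])
  interpret pair_sigma_finite M "PiM S (\<lambda>_. lborel :: real measure)" by unfold_locales
  show "?F \<in> borel_measurable M"
    by (intro borel_measurable_prod_ennreal lborel.borel_measurable_nn_integral) (simp add: split_beta)
  have comp[measurable]: "(\<lambda>u. u i) \<in> borel_measurable (PiM S (\<lambda>_. lborel :: real measure))" if "i \<in> S" for i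
    using measurable_component_singleton[OF that, of "\<lambda>_. lborel :: real measure"] by simp
  have s2: "\<sigma>\<^sup>2 \<le> s\<^sup>2" using s sigma_nonneg by (intro power_mono) auto
  have "(\<integral>\<^sup>+\<omega>. ?F \<omega> \<partial>M) = (\<integral>\<^sup>+\<omega>. \<integral>\<^sup>+u. (\<Prod>i\<in>S. ennreal (exp (u i * dev t \<omega> i - (u i)\<^sup>2 * s\<^sup>2 * real (plays t \<omega> i) / 2)
          * grid_density s K (u i))) \<partial>PiM S (\<lambda>_. lborel) \<partial>M)"
    using fS by (intro nn_integral_cong P.product_nn_integral_prod[symmetric]) auto
  also have "\<dots> = (\<integral>\<^sup>+u. \<integral>\<^sup>+\<omega>. (\<Prod>i\<in>S. ennreal (exp (u i * dev t \<omega> i - (u i)\<^sup>2 * s\<^sup>2 * real (plays t \<omega> i) / 2)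
          * grid_density s K (u i))) \<partial>M \<partial>PiM S (\<lambda>_. lborel))"
    by (rule Fubini'[symmetric]) (auto simp: split_beta intro!: borel_measurable_prod_ennreal)
  also have "\<dots> \<le> (\<integral>\<^sup>+u. (\<Prod>i\<in>S. ennreal (grid_density s K (u i))) \<partial>PiM S (\<lambda>_. lborel))"
  proof (intro nn_integral_mono)
    fix u :: "nat \<Rightarrow> real"
    have "(\<integral>\<^sup>+\<omega>. (\<Prod>i\<in>S. ennreal (exp (u i * dev t \<omega> i - (u i)\<^sup>2 * s\<^sup>2 * real (plays t \<omega> i) / 2)
          * grid_density s K (u i))) \<partial>M)
        = (\<integral>\<^sup>+\<omega>. (\<Prod>i\<in>S. ennreal (grid_density s K (u i)))
            * ennreal (exp (\<Sum>i\<in>S. u i * dev t \<omega> i - (u i)\<^sup>2 * s\<^sup>2 * real (plays t \<omega> i) / 2)) \<partial>M)"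
      using fS by (intro nn_integral_cong)
        (simp add: exp_sum prod_ennreal grid_density_nonneg ennreal_mult[symmetric] prod_nonneg prod.distrib mult.commute)
    also have "\<dots> = (\<Prod>i\<in>S. ennreal (grid_density s K (u i)))
            * (\<integral>\<^sup>+\<omega>. ennreal (exp (\<Sum>i\<in>S. u i * dev t \<omega> i - (u i)\<^sup>2 * s\<^sup>2 * real (plays t \<omega> i) / 2)) \<partial>M)"
      by (intro nn_integral_cmult) measurable
    also have "\<dots> \<le> (\<Prod>i\<in>S. ennreal (grid_density s K (u i))) * 1"
      by (intro mult_left_mono exp_supermartingale t S s2) auto
    finally show "(\<integral>\<^sup>+\<omega>. (\<Prod>i\<in>S. ennreal (exp (u i * dev t \<omega> i - (u i)\<^sup>2 * s\<^sup>2 * real (plays t \<omega> i) / 2)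
          * grid_density s K (u i))) \<partial>M) \<le> (\<Prod>i\<in>S. ennreal (grid_density s K (u i)))" by simp
  qed
  also have "\<dots> = (\<Prod>i\<in>S. \<integral>\<^sup>+u. ennreal (grid_density s K u) \<partial>lborel)"
    using fS by (intro P.product_nn_integral_prod) auto
  also have "\<dots> = ennreal (real K ^ card S)"
    using s by (simp add: nn_integral_grid_density ennreal_power)
  finally show "(\<integral>\<^sup>+\<omega>. ?F \<omega> \<partial>M) \<le> ennreal (real K ^ card S)" .
qed

text \<open>Markov for the product of mixtures. Per item, not knowing the count costs the logarithm
  of the grid mass, at most \<open>ln (ln t + 1)\<close>, and 2 for the prefactor; 20 / 9 inverts
  the rate of \<open>grid_mixture_ge\<close>.\<close>

lemma sq_dev_concentration_aux:
  assumes t: "d < t" and S: "S \<subseteq> {..<d}" and s: "0 < s" "\<sigma> \<le> s"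
  shows "prob {\<omega> \<in> space M. s\<^sup>2 * (20 / 9 * (x + real (card S) * (ln (ln (real t) + 1) + 2))) \<le> sq_dev S t \<omega>} \<le> exp (- x)"
    (is "prob ?E \<le> _")
proof -
  define K where "K = nat \<lfloor>ln (real t)\<rfloor> + 1"
  define L where "L = ln (real t) + 1"
  have fS: "finite S" using S by (rule finite_subset) simp
  have ln0: "0 \<le> ln (real t)" using t by simp
  then have L: "1 \<le> L" "real K \<le> L" "ln (real t) < real K" unfolding L_def K_def by linarith+
  have E: "?E \<in> events" using sq_dev_measurable[OF S] by simp
  let ?F = "\<lambda>\<omega>. \<Prod>i\<in>S. \<integral>\<^sup>+u. ennreal (exp (u * dev t \<omega> i - u\<^sup>2 * s\<^sup>2 * real (plays t \<omega> i) / 2)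
          * grid_density s K u) \<partial>lborel"
  let ?y = "x + real (card S) * ln L"
  have "prob ?E \<le> real K ^ card S * exp (- ?y)"
  proof (rule prob_exp_Markov[where F = ?F])
    show "?F \<in> borel_measurable M" "(\<integral>\<^sup>+\<omega>. ?F \<omega> \<partial>M) \<le> ennreal (real K ^ card S)"
      by (rule grid_mixture_expectation[OF _ S s]; use t in simp)+
    show "AE \<omega> in M. \<omega> \<in> ?E \<longrightarrow> ennreal (exp ?y) \<le> ?F \<omega>"
      using plays_pos
    proof eventually_elim
      case (elim \<omega>)
      show ?case
      proof
        assume "\<omega> \<in> ?E"
        then have le: "s\<^sup>2 * (20 / 9 * (?y + 2 * real (card S))) \<le> sq_dev S t \<omega>"
          by (simp add: L_def algebra_simps)
        have "?y \<le> (\<Sum>i\<in>S. - 2 + 9 * (dev t \<omega> i)\<^sup>2 / (20 * s\<^sup>2 * real (plays t \<omega> i)))"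
        proof -
          have "(\<Sum>i\<in>S. - 2 + 9 * (dev t \<omega> i)\<^sup>2 / (20 * s\<^sup>2 * real (plays t \<omega> i)))
              = - 2 * real (card S) + 9 / (20 * s\<^sup>2) * sq_dev S t \<omega>"
            unfolding sq_dev_def sum.distrib sum_distrib_left by simp
          moreover have "9 / (20 * s\<^sup>2) * (s\<^sup>2 * (20 / 9 * (?y + 2 * real (card S)))) \<le> 9 / (20 * s\<^sup>2) * sq_dev S t \<omega>"
            by (rule mult_left_mono[OF le]) simp
          moreover have "9 / (20 * s\<^sup>2) * (s\<^sup>2 * (20 / 9 * (?y + 2 * real (card S)))) = ?y + 2 * real (card S)"
            using s by simp
          ultimately show ?thesis by linarith
        qed
        then have "ennreal (exp ?y) \<le> ennreal (exp (\<Sum>i\<in>S. - 2 + 9 * (dev t \<omega> i)\<^sup>2 / (20 * s\<^sup>2 * real (plays t \<omega> i))))"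
          by (intro ennreal_leI) simp
        also have "\<dots> = (\<Prod>i\<in>S. ennreal (exp (- 2 + 9 * (dev t \<omega> i)\<^sup>2 / (20 * s\<^sup>2 * real (plays t \<omega> i)))))"
          using fS by (simp add: exp_sum prod_ennreal)
        also have "\<dots> \<le> ?F \<omega>"
        proof (intro prod_mono_ennreal)
          fix i assume i: "i \<in> S"
          have N: "1 \<le> plays t \<omega> i" using elim t i S by auto
          have "ln (real (plays t \<omega> i)) \<le> ln (real t)" using N plays_less[of t \<omega> i] t by simp
          then show "ennreal (exp (- 2 + 9 * (dev t \<omega> i)\<^sup>2 / (20 * s\<^sup>2 * real (plays t \<omega> i))))
            \<le> (\<integral>\<^sup>+u. ennreal (exp (u * dev t \<omega> i - u\<^sup>2 * s\<^sup>2 * real (plays t \<omega> i) / 2) * grid_density s K u) \<partial>lborel)"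
            using L by (intro grid_mixture_ge s N) simp
        qed
        finally show "ennreal (exp ?y) \<le> ?F \<omega>" .
      qed
    qed
    show "?E \<in> events" by (rule E)
  qed simp
  also have "\<dots> \<le> L ^ card S * exp (- ?y)"
    using L by (intro mult_right_mono power_mono) auto
  also have "\<dots> = exp (- x)"
  proof -
    have "exp (real (card S) * ln L) = L ^ card S" using L by (simp add: exp_of_nat_mult)
    moreover have "exp (- ?y) = exp (- x) / exp (real (card S) * ln L)"
      by (simp only: exp_diff[symmetric]) simp
    ultimately show ?thesis using L by simp
  qed
  finally show ?thesis .
qed

lemma sq_dev_concentration:
  assumes t: "d < t" and S: "S \<subseteq> {..<d}" and x: "0 < x"
  shows "prob {\<omega> \<in> space M. \<sigma>\<^sup>2 * (20 / 9 * (x + real (card S) * (ln (ln (real t) + 1) + 2))) < sq_dev S t \<omega>} \<le> exp (- x)"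
    (is "prob ?E \<le> _")
proof (cases "\<sigma> = 0")
  case False
  then have s: "0 < \<sigma>" using sigma_nonneg by simp
  have "prob ?E \<le> prob {\<omega> \<in> space M. \<sigma>\<^sup>2 * (20 / 9 * (x + real (card S) * (ln (ln (real t) + 1) + 2))) \<le> sq_dev S t \<omega>}"
    using sq_dev_measurable[OF S] by (intro finite_measure_mono) auto
  also have "\<dots> \<le> exp (- x)" by (rule sq_dev_concentration_aux[OF t S s]) simp
  finally show ?thesis .
next
  case True
  define b where "b = 20 / 9 * (x + real (card S) * (ln (ln (real t) + 1) + 2))"
  define E where "E n = {\<omega> \<in> space M. (1 / real (Suc n))\<^sup>2 * b \<le> sq_dev S t \<omega>}" for n
  have "0 \<le> ln (ln (real t) + 1)" using t by simp
  then have b: "0 < b" unfolding b_def using x by (intro mult_pos_pos add_pos_nonneg mult_nonneg_nonneg) auto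
  have En: "E n \<in> events" for n unfolding E_def using sq_dev_measurable[OF S] by simp
  have inc: "incseq E"
  proof (rule incseq_SucI)
    fix n
    have "(1 / real (Suc (Suc n)))\<^sup>2 * b \<le> (1 / real (Suc n))\<^sup>2 * b"
      using b by (intro mult_right_mono power_mono) (auto simp: frac_le)
    then show "E n \<subseteq> E (Suc n)" unfolding E_def by auto
  qed
  have "?E = (\<Union>n. E n)"
  proof
    show "?E \<subseteq> (\<Union>n. E n)"
    proof
      fix \<omega> assume "\<omega> \<in> ?E"
      then have w: "\<omega> \<in> space M" "0 < sq_dev S t \<omega>" using True by auto
      then have "0 < sq_dev S t \<omega> / b" using b by simp
      then obtain n where n: "inverse (real (Suc n)) < sq_dev S t \<omega> / b" using reals_Archimedean by blast
      have "(1 / real (Suc n))\<^sup>2 \<le> 1 / real (Suc n)"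
        using power_decreasing[of 1 2 "1 / real (Suc n)"] by simp
      also have "\<dots> \<le> sq_dev S t \<omega> / b" using n by (simp add: inverse_eq_divide)
      finally have "(1 / real (Suc n))\<^sup>2 * b \<le> sq_dev S t \<omega>" using b by (simp add: pos_le_divide_eq)
      then show "\<omega> \<in> (\<Union>n. E n)" using w by (auto simp: E_def)
    qed
    show "(\<Union>n. E n) \<subseteq> ?E"
    proof
      fix \<omega> assume "\<omega> \<in> (\<Union>n. E n)"
      then obtain n where n: "\<omega> \<in> space M" "(1 / real (Suc n))\<^sup>2 * b \<le> sq_dev S t \<omega>" by (auto simp: E_def)
      have "0 < (1 / real (Suc n))\<^sup>2 * b" using b by simp
      then show "\<omega> \<in> ?E" using n True by auto
    qed
  qed
  moreover have lim: "(\<lambda>n. prob (E n)) \<longlonglongrightarrow> prob (\<Union>n. E n)"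
    using En inc by (intro finite_Lim_measure_incseq) auto
  moreover have bound: "prob (E n) \<le> exp (- x)" for n
    unfolding E_def b_def using True by (intro sq_dev_concentration_aux[OF t S]) auto
  ultimately show ?thesis using LIMSEQ_le_const2[OF lim, of "exp (- x)"] by simp
qed

end

section \<open>Optimism of the boosted samples\<close>

lemma ln_add_one_le: "1 \<le> x \<Longrightarrow> ln (x + 1) \<le> ln x + (1 :: real)"
proof -
  assume x: "1 \<le> x"
  have "ln ((x + 1) / x) \<le> (x + 1) / x - 1" using x by (intro ln_le_minus_one) auto
  also have "\<dots> \<le> 1" using x by (simp add: field_simps)
  finally show ?thesis using x by (simp add: ln_div)
qed

lemma boost_f_eq:
  "boost_f 1 m t = 2 * (ln (real t) + (real m + 2) * ln (ln (real t)) + real m / 2 * ln (1 + exp 1))"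
  by (simp add: boost_f_def)

lemma ln_1e: "1 \<le> ln (1 + exp 1 :: real)" "ln (1 + exp 1 :: real) \<le> 2"
proof -
  have "ln (exp 1) \<le> ln (1 + exp 1 :: real)" by (subst ln_le_cancel_iff) (auto intro: add_pos_pos)
  then show "1 \<le> ln (1 + exp 1 :: real)" by simp
  have "(1 + exp 1 :: real) \<le> exp 1 * exp 1"
  proof -
    have "(2 :: real) \<le> exp 1" using exp_ge_add_one_self[of 1] by simp
    then have "2 * exp 1 \<le> exp 1 * (exp 1 :: real)" by (intro mult_right_mono) auto
    moreover have "(1 :: real) \<le> exp 1" by simp
    ultimately show ?thesis by linarith
  qed
  then have "ln (1 + exp 1 :: real) \<le> ln (exp 1 * exp 1)" by (subst ln_le_cancel_iff) (auto intro: add_pos_pos)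
  then show "ln (1 + exp 1 :: real) \<le> 2" by (simp add: ln_mult)
qed

text \<open>The value 21 / 8 is where \<open>20 / 9 * (y + 3) \<le> 4 * y + 2\<close> begins to
  hold, as \<open>boost_f_ge\<close> requires for \<open>y = ln (ln t)\<close>. Hence the condition
  \<open>16 \<le> ln t\<close> on all late rounds.\<close>

lemma ln16: "(21 / 8 :: real) \<le> ln x" if "16 \<le> x"
proof -
  have "ln (2 ^ 4 :: real) = 4 * ln 2" by (simp only: ln_realpow)
  then have "(8 / 3 :: real) \<le> ln 16" using ln2_ge_two_thirds by simp
  also have "\<dots> \<le> ln x" using that by simp
  finally show ?thesis by simp
qed

lemma boost_f_le:
  assumes L: "16 \<le> ln (real t)" and m: "2 \<le> m"
  shows "boost_f 1 m t \<le> 2 * ln (real t) + 4 * real m * ln (ln (real t)) + 2 * real m"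
proof -
  have "0 \<le> ln (ln (real t))" using ln16[OF L] by linarith
  then have "(real m + 2) * ln (ln (real t)) \<le> (2 * real m) * ln (ln (real t))" using m by (intro mult_right_mono) auto
  moreover have "real m / 2 * ln (1 + exp 1) \<le> real m / 2 * 2" using ln_1e by (intro mult_left_mono) auto
  ultimately show ?thesis unfolding boost_f_eq by simp
qed

text \<open>The coefficients of \<open>ln t\<close> agree exactly,
  \<open>20 / 9 * (9 / 5) = 4\<close>, so 9 / 5 is the largest failure exponent that the boost
  affords. The \<open>ln ln\<close> part of the boost pays for the grid.\<close>

lemma boost_f_ge:
  assumes L: "16 \<le> ln (real t)"
  shows "20 / 9 * (9 / 5 * ln (real t) + real m * (ln (ln (real t) + 1) + 2)) \<le> 2 * boost_f 1 m t"
proof -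
  have lL: "21 / 8 \<le> ln (ln (real t))" by (rule ln16[OF L])
  have "ln (ln (real t) + 1) \<le> ln (ln (real t)) + 1" using L by (intro ln_add_one_le) auto
  then have "20 / 9 * (ln (ln (real t) + 1) + 2) \<le> 4 * ln (ln (real t)) + 2 * ln (1 + exp 1)"
    using lL ln_1e(1) by (simp add: field_simps)
  then have "real m * (20 / 9 * (ln (ln (real t) + 1) + 2)) \<le> real m * (4 * ln (ln (real t)) + 2 * ln (1 + exp 1))"
    by (intro mult_left_mono) auto
  then show ?thesis unfolding boost_f_eq using lL by (simp add: algebra_simps)
qed

lemma boost_g_le:
  assumes L: "16 \<le> ln (real t)" and m: "2 \<le> m"
  shows "boost_g 1 m t \<le> 7 * real m"
proof -
  have "ln (ln (real t)) \<le> ln (real t)" using L ln_le_minus_one[of "ln (real t)"] by simp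
  then have "4 * real m * ln (ln (real t)) \<le> 4 * real m * ln (real t)" by (intro mult_left_mono) auto
  moreover have "2 * real m * 1 \<le> 2 * real m * ln (real t)" using L by (intro mult_left_mono) auto
  moreover have "2 * ln (real t) \<le> real m * ln (real t)" using m L by (intro mult_right_mono) auto
  ultimately have "boost_f 1 m t \<le> 7 * real m * ln (real t)" using boost_f_le[OF L m] by linarith
  then show ?thesis using L by (simp add: boost_g_def pos_divide_le_eq)
qed

lemma boost_g_nonneg:
  assumes L: "16 \<le> ln (real t)" shows "0 \<le> boost_g 1 m t"
proof -
  have "0 \<le> ln (ln (real t))" using ln16[OF L] by linarith
  then show ?thesis unfolding boost_g_def boost_f_eq using L ln_1e by simp
qed

text \<open>A squared confidence radius in units of \<open>\<sigma>\<^sup>2\<close>. The leading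
  \<open>ln t\<close> carries neither \<open>d\<close> nor \<open>m\<close>; these multiply only
  lower-order terms, and this keeps the leading regret term at \<open>d ln m ln T\<close>.\<close>

definition width :: "nat \<Rightarrow> nat \<Rightarrow> nat \<Rightarrow> real" where
  "width d m t = 133 * (ln (real t) + real d * ln (ln (real t)) + real d * real m)"

text \<open>Against \<open>ln t\<close> the boost is expanded as \<open>boost_f\<close>, with
  leading part \<open>2 * ln t\<close>; the crude bound \<open>7 * m\<close> is applied only against
  \<open>d\<close>, since elsewhere it would put \<open>m\<close> in front of
  \<open>ln t\<close>.\<close>

lemma width_ge:
  assumes L: "16 \<le> ln (real t)" and m: "2 \<le> m" "m \<le> d"
  shows "2 * (20 / 9 * (2 * ln (real t) + real d * (ln (ln (real t) + 1) + 2)))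
    + 4 * boost_g 1 m t * (8 * ln (real t) + 2 * real d) \<le> width d m t"
proof -
  let ?L = "ln (real t)"
  have lL: "0 \<le> ln ?L" using ln16[OF L] by linarith
  have "ln (?L + 1) \<le> ln ?L + 1" using L by (intro ln_add_one_le) auto
  then have "real d * (ln (?L + 1) + 2) \<le> real d * (ln ?L + 3)" by (intro mult_left_mono) auto
  then have 1: "real d * (ln (?L + 1) + 2) \<le> real d * ln ?L + 3 * real d" by (simp add: algebra_simps)
  have 2: "boost_g 1 m t * ?L \<le> 2 * ?L + 4 * (real m * ln ?L) + 2 * real m"
    using boost_f_le[OF L m(1)] L by (simp add: boost_g_def mult.assoc)
  have "real d * boost_g 1 m t \<le> real d * (7 * real m)" using boost_g_le[OF L m(1)] by (intro mult_left_mono) auto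
  then have 3: "boost_g 1 m t * real d \<le> 7 * (real d * real m)" by (simp add: ac_simps)
  have 4: "real m * ln ?L \<le> real d * ln ?L" using m lL by (intro mult_right_mono) auto
  have 5: "2 * real d \<le> real d * real m" using mult_left_mono[of 2 "real m" "real d"] m by simp
  have 6: "real m \<le> real d" using m by simp
  have 7: "0 \<le> real d * ln ?L" using lL by simp
  have 8: "4 * boost_g 1 m t * (8 * ?L + 2 * real d) = 32 * (boost_g 1 m t * ?L) + 8 * (boost_g 1 m t * real d)"
    by (simp add: algebra_simps)
  \<comment> \<open>The constant 133 rounds up 40 / 9 + 128, the coefficient of \<open>b\<close>,
    which stands for \<open>d ln ln t\<close>; the other coefficients are smaller.\<close>
  have "2 * (20 / 9 * (2 * l + a)) + (32 * c + 8 * e) \<le> 133 * (l + b + q)"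
    if "a \<le> b + 3 * n" "c \<le> 2 * l + 4 * r + 2 * k" "e \<le> 7 * q" "r \<le> b" "2 * n \<le> q" "k \<le> n"
      "0 \<le> b" "16 \<le> l" "0 \<le> n" for a b c e k l n q r :: real
    using that by (simp add: field_simps)
  from this[OF 1 2 3 4 5 6 7 L] show ?thesis unfolding width_def 8 by simp
qed

lemma theta_cong:
  assumes "\<And>s. 1 \<le> s \<Longrightarrow> s < t \<Longrightarrow> a s = b s"
  shows "theta \<sigma> lam m x a z t = theta \<sigma> lam m x b z t"
proof
  fix i
  have "num_plays a t i = num_plays b t i"
    unfolding num_plays_def using assms by (intro arg_cong[where f = card]) auto
  moreover have "(\<Sum>s = 1..<t. if i \<in> a s then x s i else 0) = (\<Sum>s = 1..<t. if i \<in> b s then x s i else 0)"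
    using assms by (intro sum.cong) auto
  ultimately show "theta \<sigma> lam m x a z t i = theta \<sigma> lam m x b z t i" by (simp add: theta_def emp_mean_def)
qed

text \<open>The added assumptions exclude degenerate problems: for \<open>m = 1\<close> the factor
  \<open>ln m\<close> of the bound vanishes, and without a positive gap \<open>gap_min\<close> is
  the minimum of an empty set.\<close>

locale bg_cts_one = bg_cts_run M d \<A> \<mu> \<sigma> X 1 init Z U A
  for M :: "'w measure" and d \<A> \<mu> \<sigma> X init Z U A +
  assumes size_ge2: "2 \<le> max_size \<A>" and gap_ex: "\<exists>B\<in>\<A>. 0 < gap \<A> \<mu> B"
begin

abbreviation "m \<equiv> max_size \<A>"
abbreviation "opt \<equiv> opt_action \<A> \<mu>"
abbreviation "D \<equiv> gap_min \<A> \<mu>"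
abbreviation "Dmax \<equiv> gap_max \<A> \<mu>"

definition th :: "nat \<Rightarrow> 'w \<Rightarrow> nat \<Rightarrow> real" where
  "th t \<omega> = theta \<sigma> 1 m (\<lambda>s. X s \<omega>) (\<lambda>s. act s \<omega>) (Z t \<omega>) t"

section \<open>Gaps and almost sure properties of the run\<close>

lemma finite_A: "finite \<A>" using actions by (rule finite_subset) simp

lemma opt_is_arg_max: "is_arg_max (reward \<mu>) (\<lambda>B. B \<in> \<A>) opt"
proof -
  have "opt = (SOME B. is_arg_max (reward \<mu>) (\<lambda>B. B \<in> \<A>) B)"
    by (simp add: opt_action_def arg_max_on_def arg_max_def)
  then show ?thesis using unique_optimum by (metis someI_ex)
qed

lemma opt_in: "opt \<in> \<A>" using opt_is_arg_max by (simp add: is_arg_max_def)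

lemma gap_nonneg: "B \<in> \<A> \<Longrightarrow> 0 \<le> gap \<A> \<mu> B"
  using opt_is_arg_max by (auto simp: is_arg_max_linorder gap_def)

lemma gap_opt[simp]: "gap \<A> \<mu> opt = 0" by (simp add: gap_def)

lemma gap_pos:
  assumes "B \<in> \<A>" "B \<noteq> opt" shows "0 < gap \<A> \<mu> B"
proof (rule ccontr)
  assume "\<not> 0 < gap \<A> \<mu> B"
  then have "reward \<mu> opt \<le> reward \<mu> B" by (simp add: gap_def)
  then have "is_arg_max (reward \<mu>) (\<lambda>B. B \<in> \<A>) B"
    using opt_is_arg_max assms by (auto simp: is_arg_max_linorder intro: order_trans)
  then show False using unique_optimum opt_is_arg_max assms(2) by blast
qed

lemma finite_gaps: "finite {gap \<A> \<mu> B |B. B \<in> \<A> \<and> 0 < gap \<A> \<mu> B}"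
  by (rule finite_subset[of _ "gap \<A> \<mu> ` \<A>"]) (use finite_A in auto)

lemma D_le: "B \<in> \<A> \<Longrightarrow> B \<noteq> opt \<Longrightarrow> D \<le> gap \<A> \<mu> B"
  unfolding gap_min_def using gap_pos finite_gaps by (intro Min_le) auto

lemma D_pos: "0 < D"
proof -
  have "D \<in> {gap \<A> \<mu> B |B. B \<in> \<A> \<and> 0 < gap \<A> \<mu> B}"
    unfolding gap_min_def using gap_ex by (intro Min_in finite_gaps) auto
  then show ?thesis by auto
qed

lemma gap_le: "B \<in> \<A> \<Longrightarrow> gap \<A> \<mu> B \<le> Dmax"
  unfolding gap_max_def using finite_A by (intro Max_ge) auto

lemma Dmax_pos: "0 < Dmax"
  using gap_ex gap_le by fastforce

lemma card_le: "B \<in> \<A> \<Longrightarrow> card B \<le> m"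
  unfolding max_size_def using finite_A by (intro Max_ge) auto

lemma sub_d: "B \<in> \<A> \<Longrightarrow> B \<subseteq> {..<d}" using actions by auto

lemma m_le_d: "m \<le> d"
proof -
  have "m \<in> card ` \<A>" unfolding max_size_def using finite_A opt_in by (intro Max_in) auto
  then obtain B where "B \<in> \<A>" "m = card B" by auto
  then show ?thesis using card_mono[of "{..<d}" B] sub_d by auto
qed

lemma act_argmax: "AE \<omega> in M. \<forall>t>d. is_arg_max (reward (th t \<omega>)) (\<lambda>B. B \<in> \<A>) (act t \<omega>)"
proof -
  have "AE \<omega> in M. \<forall>t. 1 \<le> t \<longrightarrow> act t \<omega> = A t \<omega>"
    unfolding AE_all_countable using act_AE by auto
  moreover have "AE \<omega> in M. \<forall>t. d < t \<longrightarrow> is_arg_max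
            (reward (theta \<sigma> 1 m (\<lambda>s. X s \<omega>) (\<lambda>s. A s \<omega>) (Z t \<omega>) t)) (\<lambda>B. B \<in> \<A>) (A t \<omega>)"
    unfolding AE_all_countable using A_argmax by auto
  ultimately show ?thesis
  proof eventually_elim
    case (elim \<omega>)
    have "th t \<omega> = theta \<sigma> 1 m (\<lambda>s. X s \<omega>) (\<lambda>s. A s \<omega>) (Z t \<omega>) t" for t
      unfolding th_def using elim by (intro theta_cong) auto
    moreover have "act t \<omega> = A t \<omega>" if "d < t" for t using elim that by auto
    ultimately show ?case using elim by simp
  qed
qed

lemma act_in: "AE \<omega> in M. \<forall>t\<ge>1. act t \<omega> \<in> \<A>"
proof -
  have "AE \<omega> in M. \<forall>t. 1 \<le> t \<and> t \<le> d \<longrightarrow> act t \<omega> = init t"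
    unfolding AE_all_countable
  proof
    fix t
    show "AE \<omega> in M. 1 \<le> t \<and> t \<le> d \<longrightarrow> act t \<omega> = init t"
    proof (cases "1 \<le> t \<and> t \<le> d")
      case True
      then have "1 \<le> t" "t \<le> d" by auto
      from act_AE[OF this(1)] A_init[OF this] show ?thesis by eventually_elim simp
    qed auto
  qed
  with act_argmax show ?thesis
  proof eventually_elim
    case (elim \<omega>)
    show ?case
    proof (intro allI impI)
      fix t :: nat assume "1 \<le> t"
      then show "act t \<omega> \<in> \<A>" using elim init_actions
        by (cases "t \<le> d") (auto simp: is_arg_max_def)
    qed
  qed
qed

lemma emp_mean_act:
  assumes "1 \<le> plays t \<omega> i"
  shows "emp_mean (\<lambda>s. X s \<omega>) (\<lambda>s. act s \<omega>) t i = \<mu> i + dev t \<omega> i / real (plays t \<omega> i)"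
proof -
  have "dev t \<omega> i = (\<Sum>s = 1..<t. (if i \<in> act s \<omega> then X s \<omega> i else 0) - \<mu> i * of_bool (i \<in> act s \<omega>))"
    unfolding dev_def by (intro sum.cong) auto
  also have "\<dots> = (\<Sum>s = 1..<t. if i \<in> act s \<omega> then X s \<omega> i else 0) - \<mu> i * real (plays t \<omega> i)"
    unfolding plays_def num_plays_sum by (simp add: sum_subtractf sum_distrib_left)
  finally show ?thesis using assms unfolding emp_mean_def plays_def[symmetric] by (simp add: field_simps)
qed

text \<open>The root of the inverse count is pulled out of both the empirical error and the Gaussian
  noise, so that Cauchy-Schwarz can separate counts from fluctuations.\<close>

lemma th_eq:
  assumes "1 \<le> plays t \<omega> i"
  shows "th t \<omega> i = \<mu> i + sqrt (1 / real (plays t \<omega> i)) *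
    (dev t \<omega> i / sqrt (real (plays t \<omega> i)) + \<sigma> * sqrt (2 * boost_g 1 m t) * Z t \<omega> i)"
proof -
  have "sqrt (1 / real (plays t \<omega> i)) * (dev t \<omega> i / sqrt (real (plays t \<omega> i))) = dev t \<omega> i / real (plays t \<omega> i)"
    by (simp add: real_sqrt_divide)
  then show ?thesis
    unfolding th_def theta_def emp_mean_act[OF assms] plays_def[symmetric] by (simp add: distrib_left mult_ac)
qed

section \<open>Good events and their deterministic consequences\<close>

definition noise_sq :: "nat \<Rightarrow> 'w \<Rightarrow> real" where
  "noise_sq t \<omega> = (\<Sum>i<d. (Z t \<omega> i)\<^sup>2)"

text \<open>Accuracy for all items at once, as needed for an action that the sample itself selects.
  Constants may be lost here.\<close>

definition accurate :: "nat \<Rightarrow> 'w \<Rightarrow> bool" where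
  "accurate t \<omega> \<longleftrightarrow>
     sq_dev {..<d} t \<omega> \<le> \<sigma>\<^sup>2 * (20 / 9 * (2 * ln (real t) + real d * (ln (ln (real t) + 1) + 2))) \<and>
     noise_sq t \<omega> \<le> 8 * ln (real t) + 2 * real d"

text \<open>A separate event because optimism must match the boost, which grows with
  \<open>m\<close> and not with \<open>d\<close>: only the at most \<open>m\<close> items of the
  optimal action may enter.\<close>

definition opt_accurate :: "nat \<Rightarrow> 'w \<Rightarrow> bool" where
  "opt_accurate t \<omega> \<longleftrightarrow> sq_dev opt t \<omega> \<le> \<sigma>\<^sup>2 * (2 * boost_f 1 m t)"

text \<open>The squared root is kept so that the event has the form of
  \<open>std_normal_combination_tail\<close>, with coefficients \<open>sqrt (1 / N)\<close>.\<close>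

definition boosted :: "nat \<Rightarrow> 'w \<Rightarrow> bool" where
  "boosted t \<omega> \<longleftrightarrow> sqrt (ln (real t)) * sqrt (\<Sum>i\<in>opt. (sqrt (1 / real (plays t \<omega> i)))\<^sup>2)
     \<le> (\<Sum>i\<in>opt. sqrt (1 / real (plays t \<omega> i)) * Z t \<omega> i)"

lemma accurate_bound:
  assumes B: "B \<subseteq> {..<d}" and N: "\<And>i. i < d \<Longrightarrow> 1 \<le> plays t \<omega> i"
    and L: "16 \<le> ln (real t)" and acc: "accurate t \<omega>"
  shows "(reward (th t \<omega>) B - reward \<mu> B)\<^sup>2 \<le> \<sigma>\<^sup>2 * width d m t * (\<Sum>i\<in>B. 1 / real (plays t \<omega> i))"
proof -
  let ?n = "\<lambda>i. real (plays t \<omega> i)"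
  define b where "b i = dev t \<omega> i / sqrt (?n i) + \<sigma> * sqrt (2 * boost_g 1 m t) * Z t \<omega> i" for i
  have fB: "finite B" using B by (rule finite_subset) simp
  have g: "0 \<le> boost_g 1 m t" by (rule boost_g_nonneg[OF L])
  have "reward (th t \<omega>) B - reward \<mu> B = (\<Sum>i\<in>B. sqrt (1 / ?n i) * b i)"
    unfolding reward_def sum_subtractf[symmetric]
    using B N by (intro sum.cong) (auto simp: th_eq b_def)
  then have "(reward (th t \<omega>) B - reward \<mu> B)\<^sup>2 \<le> (\<Sum>i\<in>B. (sqrt (1 / ?n i))\<^sup>2) * (\<Sum>i\<in>B. (b i)\<^sup>2)"
    using Cauchy_Schwarz_ineq_sum[of "\<lambda>i. sqrt (1 / ?n i)" b B] by simp
  also have "(\<Sum>i\<in>B. (sqrt (1 / ?n i))\<^sup>2) = (\<Sum>i\<in>B. 1 / ?n i)" by simp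
  finally have cs: "(reward (th t \<omega>) B - reward \<mu> B)\<^sup>2 \<le> (\<Sum>i\<in>B. 1 / ?n i) * (\<Sum>i\<in>B. (b i)\<^sup>2)" .
  \<comment> \<open>Enlarging the sum to all items makes the bound independent of \<open>B\<close>,
    which may depend on the sample.\<close>
  have "(\<Sum>i\<in>B. (b i)\<^sup>2) \<le> (\<Sum>i<d. (b i)\<^sup>2)" using B by (intro sum_mono2) auto
  also have "\<dots> \<le> (\<Sum>i<d. 2 * ((dev t \<omega> i)\<^sup>2 / ?n i) + 4 * \<sigma>\<^sup>2 * boost_g 1 m t * (Z t \<omega> i)\<^sup>2)"
  proof (rule sum_mono)
    fix i assume "i \<in> {..<d}"
    then have n: "0 < ?n i" using N[of i] by simp
    have "(x + y)\<^sup>2 \<le> 2 * x\<^sup>2 + 2 * y\<^sup>2" for x y :: real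
      using sum_squares_bound[of x y] by (simp add: power2_sum)
    from this[of "dev t \<omega> i / sqrt (?n i)" "\<sigma> * sqrt (2 * boost_g 1 m t) * Z t \<omega> i"]
    show "(b i)\<^sup>2 \<le> 2 * ((dev t \<omega> i)\<^sup>2 / ?n i) + 4 * \<sigma>\<^sup>2 * boost_g 1 m t * (Z t \<omega> i)\<^sup>2"
      using n g by (simp add: b_def power_divide power_mult_distrib mult_ac)
  qed
  also have "\<dots> = 2 * sq_dev {..<d} t \<omega> + 4 * \<sigma>\<^sup>2 * boost_g 1 m t * noise_sq t \<omega>"
    by (simp add: sum.distrib sum_distrib_left sq_dev_def noise_sq_def)
  also have "\<dots> \<le> 2 * (\<sigma>\<^sup>2 * (20 / 9 * (2 * ln (real t) + real d * (ln (ln (real t) + 1) + 2))))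
      + 4 * \<sigma>\<^sup>2 * boost_g 1 m t * (8 * ln (real t) + 2 * real d)"
    using acc g unfolding accurate_def by (intro add_mono mult_left_mono) auto
  also have "\<dots> = \<sigma>\<^sup>2 * (2 * (20 / 9 * (2 * ln (real t) + real d * (ln (ln (real t) + 1) + 2)))
      + 4 * boost_g 1 m t * (8 * ln (real t) + 2 * real d))"
    by (simp only: distrib_left mult_ac)
  also have "\<dots> \<le> \<sigma>\<^sup>2 * width d m t"
    by (intro mult_left_mono width_ge L size_ge2 m_le_d) simp
  finally have "(\<Sum>i\<in>B. 1 / ?n i) * (\<Sum>i\<in>B. (b i)\<^sup>2) \<le> (\<Sum>i\<in>B. 1 / ?n i) * (\<sigma>\<^sup>2 * width d m t)"
    by (intro mult_left_mono sum_nonneg) auto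
  with cs have "(reward (th t \<omega>) B - reward \<mu> B)\<^sup>2 \<le> (\<Sum>i\<in>B. 1 / ?n i) * (\<sigma>\<^sup>2 * width d m t)"
    by (rule order_trans)
  then show ?thesis by (subst mult.commute)
qed

text \<open>By Cauchy-Schwarz the empirical error along the optimal action is at most
  \<open>\<sigma> * sqrt (2 * boost_f 1 m t * w)\<close>. A boosted noise term is at least
  \<open>\<sigma> * sqrt (2 * boost_g 1 m t * ln t * w)\<close>, the same number because
  \<open>boost_g\<close> times \<open>ln t\<close> is \<open>boost_f\<close>.\<close>

lemma boosted_optimistic:
  assumes N: "\<And>i. i < d \<Longrightarrow> 1 \<le> plays t \<omega> i" and L: "16 \<le> ln (real t)"
    and acc: "opt_accurate t \<omega>" and boost: "boosted t \<omega>"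
  shows "reward \<mu> opt \<le> reward (th t \<omega>) opt"
proof -
  let ?n = "\<lambda>i. real (plays t \<omega> i)"
  define w where "w = (\<Sum>i\<in>opt. (sqrt (1 / ?n i))\<^sup>2)"
  have w0: "0 \<le> w" unfolding w_def by (intro sum_nonneg) auto
  have g: "0 \<le> boost_g 1 m t" by (rule boost_g_nonneg[OF L])
  have gL: "boost_g 1 m t * ln (real t) = boost_f 1 m t" using L by (simp add: boost_g_def)
  have sub: "opt \<subseteq> {..<d}" by (rule sub_d[OF opt_in])
  have eq: "reward (th t \<omega>) opt - reward \<mu> opt
      = (\<Sum>i\<in>opt. sqrt (1 / ?n i) * (dev t \<omega> i / sqrt (?n i)))
        + \<sigma> * sqrt (2 * boost_g 1 m t) * (\<Sum>i\<in>opt. sqrt (1 / ?n i) * Z t \<omega> i)"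
    unfolding reward_def sum_subtractf[symmetric] sum_distrib_left sum.distrib[symmetric]
    using sub N by (intro sum.cong) (auto simp: th_eq distrib_left mult_ac)
  have "(\<Sum>i\<in>opt. sqrt (1 / ?n i) * (dev t \<omega> i / sqrt (?n i)))\<^sup>2 \<le> w * (\<Sum>i\<in>opt. (dev t \<omega> i / sqrt (?n i))\<^sup>2)"
    unfolding w_def by (rule Cauchy_Schwarz_ineq_sum)
  also have "(\<Sum>i\<in>opt. (dev t \<omega> i / sqrt (?n i))\<^sup>2) = sq_dev opt t \<omega>"
    by (simp add: sq_dev_def power_divide)
  also have "w * \<dots> \<le> w * (\<sigma>\<^sup>2 * (2 * boost_f 1 m t))"
    using acc w0 unfolding opt_accurate_def by (intro mult_left_mono)
  also have "\<dots> = (\<sigma> * sqrt (2 * boost_g 1 m t) * (sqrt (ln (real t)) * sqrt w))\<^sup>2"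
  proof -
    have "(\<sigma> * sqrt (2 * boost_g 1 m t) * (sqrt (ln (real t)) * sqrt w))\<^sup>2
        = \<sigma>\<^sup>2 * (2 * boost_g 1 m t) * (ln (real t) * w)"
      unfolding power_mult_distrib using g w0 L by simp
    also have "\<dots> = w * (\<sigma>\<^sup>2 * (2 * (boost_g 1 m t * ln (real t))))" by (simp only: mult_ac)
    finally show ?thesis by (simp only: gL)
  qed
  finally have sq: "(\<Sum>i\<in>opt. sqrt (1 / ?n i) * (dev t \<omega> i / sqrt (?n i)))\<^sup>2
      \<le> (\<sigma> * sqrt (2 * boost_g 1 m t) * (sqrt (ln (real t)) * sqrt w))\<^sup>2" .
  have "\<bar>\<Sum>i\<in>opt. sqrt (1 / ?n i) * (dev t \<omega> i / sqrt (?n i))\<bar>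
      \<le> \<sigma> * sqrt (2 * boost_g 1 m t) * (sqrt (ln (real t)) * sqrt w)"
  proof (rule power2_le_imp_le)
    show "\<bar>\<Sum>i\<in>opt. sqrt (1 / ?n i) * (dev t \<omega> i / sqrt (?n i))\<bar>\<^sup>2
      \<le> (\<sigma> * sqrt (2 * boost_g 1 m t) * (sqrt (ln (real t)) * sqrt w))\<^sup>2"
      using sq by (simp only: power2_abs)
    show "0 \<le> \<sigma> * sqrt (2 * boost_g 1 m t) * (sqrt (ln (real t)) * sqrt w)"
      using sigma_nonneg g w0 L by (intro mult_nonneg_nonneg) auto
  qed
  moreover have "\<sigma> * sqrt (2 * boost_g 1 m t) * (sqrt (ln (real t)) * sqrt w)
      \<le> \<sigma> * sqrt (2 * boost_g 1 m t) * (\<Sum>i\<in>opt. sqrt (1 / ?n i) * Z t \<omega> i)"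
    using boost sigma_nonneg g unfolding boosted_def w_def by (intro mult_left_mono) auto
  ultimately show ?thesis using eq by linarith
qed

end

section \<open>Probabilities of the accuracy events\<close>

context bg_cts_one
begin

lemma Z_indep_at: "1 \<le> t \<Longrightarrow> S \<subseteq> {..<d} \<Longrightarrow> indep_vars (\<lambda>_. borel) (\<lambda>i \<omega>. Z t \<omega> i) S"
proof -
  assume t: "1 \<le> t" and S: "S \<subseteq> {..<d}"
  have inj: "inj_on (\<lambda>i. (t, i)) S" by (auto simp: inj_on_def)
  have "indep_vars (\<lambda>_. borel) (\<lambda>(t, i) \<omega>. Z t \<omega> i) ((\<lambda>i. (t, i)) ` S)"
    by (rule indep_vars_subset[OF Z_indep]) (use t S in auto)
  from indep_vars_reindex[OF inj this] show ?thesis by simp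
qed

lemma noise_sq_measurable[measurable]: "1 \<le> t \<Longrightarrow> noise_sq t \<in> borel_measurable M"
  unfolding noise_sq_def[abs_def] by (intro borel_measurable_sum borel_measurable_power Z_meas) auto

lemma accurate_event: "1 \<le> t \<Longrightarrow> {\<omega> \<in> space M. accurate t \<omega>} \<in> events"
  unfolding accurate_def using sq_dev_measurable[of "{..<d}" t] noise_sq_measurable[of t] by simp

lemma opt_accurate_event: "{\<omega> \<in> space M. opt_accurate t \<omega>} \<in> events"
  unfolding opt_accurate_def using sq_dev_measurable[OF sub_d[OF opt_in], of t] by simp

text \<open>Chernoff with parameter 1 / 4 for a chi-squared variable with \<open>d\<close> degrees
  of freedom. A quarter of the threshold is \<open>2 * ln t + d / 2\<close>, and the part
  \<open>d / 2\<close> pays for the factor \<open>sqrt 2 ^ d\<close>.\<close>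

lemma noise_concentration:
  assumes t: "1 \<le> t"
  shows "prob {\<omega> \<in> space M. 8 * ln (real t) + 2 * real d < noise_sq t \<omega>} \<le> exp (- 2 * ln (real t))"
proof -
  let ?F = "\<lambda>\<omega>. \<Prod>i<d. ennreal (exp ((Z t \<omega> i)\<^sup>2 / 4))"
  have "prob {\<omega> \<in> space M. 8 * ln (real t) + 2 * real d < noise_sq t \<omega>}
      \<le> sqrt 2 ^ d * exp (- (2 * ln (real t) + real d / 2))"
  proof (rule prob_exp_Markov[where F = ?F])
    show "?F \<in> borel_measurable M"
      using t by (intro borel_measurable_prod_ennreal measurable_compose[OF _ measurable_ennreal]
        measurable_compose[OF _ borel_measurable_exp] borel_measurable_divide borel_measurable_power Z_meas) auto
    have "(\<integral>\<^sup>+\<omega>. ?F \<omega> \<partial>M) = (\<Prod>i<d. \<integral>\<^sup>+\<omega>. ennreal (exp ((Z t \<omega> i)\<^sup>2 / 4)) \<partial>M)"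
      by (intro indep_vars_nn_integral indep_vars_compose2[OF Z_indep_at[OF t order_refl]]) auto
    also have "\<dots> = (\<Prod>i<d. ennreal (sqrt 2))"
      using t by (intro prod.cong refl std_normal_exp_square Z_normal) auto
    finally show "(\<integral>\<^sup>+\<omega>. ?F \<omega> \<partial>M) \<le> ennreal (sqrt 2 ^ d)" by (simp add: ennreal_power)
    show "{\<omega> \<in> space M. 8 * ln (real t) + 2 * real d < noise_sq t \<omega>} \<in> events"
      using noise_sq_measurable[OF t] by simp
    show "AE \<omega> in M. \<omega> \<in> {\<omega> \<in> space M. 8 * ln (real t) + 2 * real d < noise_sq t \<omega>} \<longrightarrow>
        ennreal (exp (2 * ln (real t) + real d / 2)) \<le> ?F \<omega>"
    proof (intro AE_I2 impI)
      fix \<omega> assume "\<omega> \<in> {\<omega> \<in> space M. 8 * ln (real t) + 2 * real d < noise_sq t \<omega>}"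
      then have "2 * ln (real t) + real d / 2 \<le> (\<Sum>i<d. (Z t \<omega> i)\<^sup>2 / 4)"
        by (simp add: noise_sq_def sum_divide_distrib[symmetric])
      then show "ennreal (exp (2 * ln (real t) + real d / 2)) \<le> ?F \<omega>"
        by (simp add: prod_ennreal exp_sum[symmetric] ennreal_leI)
    qed
  qed simp
  also have "\<dots> \<le> exp (- 2 * ln (real t))"
  proof -
    have "sqrt 2 \<le> (exp (1 / 2) :: real)"
    proof (rule real_le_lsqrt)
      show "2 \<le> (exp (1 / 2) :: real)\<^sup>2" using exp_ge_add_one_self[of 1] by (simp add: power2_eq_square mult_exp_exp)
    qed auto
    then have "sqrt 2 ^ d \<le> exp (1 / 2) ^ d" by (intro power_mono) auto
    also have "\<dots> = exp (real d / 2)" by (simp add: exp_of_nat_mult[symmetric])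
    finally have "sqrt 2 ^ d * exp (- (2 * ln (real t) + real d / 2)) \<le> exp (real d / 2) * exp (- (2 * ln (real t) + real d / 2))"
      by (intro mult_right_mono) auto
    then show ?thesis by (simp add: mult_exp_exp)
  qed
  finally show ?thesis .
qed

lemma accurate_prob:
  assumes t: "d < t" and L: "16 \<le> ln (real t)"
  shows "prob {\<omega> \<in> space M. \<not> accurate t \<omega>} \<le> 2 * exp (- 2 * ln (real t))"
proof -
  let ?E1 = "{\<omega> \<in> space M. \<sigma>\<^sup>2 * (20 / 9 * (2 * ln (real t) + real (card {..<d}) * (ln (ln (real t) + 1) + 2))) < sq_dev {..<d} t \<omega>}"
  let ?E2 = "{\<omega> \<in> space M. 8 * ln (real t) + 2 * real d < noise_sq t \<omega>}"
  have "prob {\<omega> \<in> space M. \<not> accurate t \<omega>} \<le> prob (?E1 \<union> ?E2)"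
    using t sq_dev_measurable[of "{..<d}" t] noise_sq_measurable[of t]
    by (intro finite_measure_mono) (auto simp: accurate_def)
  also have "\<dots> \<le> prob ?E1 + prob ?E2"
    using t sq_dev_measurable[of "{..<d}" t] noise_sq_measurable[of t]
    by (intro measure_Un_le) auto
  also have "\<dots> \<le> exp (- (2 * ln (real t))) + exp (- 2 * ln (real t))"
    using t L dim_pos by (intro add_mono sq_dev_concentration noise_concentration) auto
  finally show ?thesis by simp
qed

lemma opt_accurate_prob:
  assumes t: "d < t" and L: "16 \<le> ln (real t)"
  shows "prob {\<omega> \<in> space M. \<not> opt_accurate t \<omega>} \<le> exp (- (9 / 5 * ln (real t)))"
proof -
  let ?b = "20 / 9 * (9 / 5 * ln (real t) + real (card opt) * (ln (ln (real t) + 1) + 2))"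
  have "0 \<le> ln (ln (real t) + 1)" using L by simp
  then have "real (card opt) * (ln (ln (real t) + 1) + 2) \<le> real m * (ln (ln (real t) + 1) + 2)"
    using card_le[OF opt_in] by (intro mult_right_mono) auto
  then have "?b \<le> 2 * boost_f 1 m t" using boost_f_ge[OF L, of m] by (simp add: algebra_simps)
  then have "\<sigma>\<^sup>2 * ?b \<le> \<sigma>\<^sup>2 * (2 * boost_f 1 m t)" by (intro mult_left_mono) auto
  then have "prob {\<omega> \<in> space M. \<not> opt_accurate t \<omega>} \<le> prob {\<omega> \<in> space M. \<sigma>\<^sup>2 * ?b < sq_dev opt t \<omega>}"
    using sq_dev_measurable[OF sub_d[OF opt_in], of t]
    by (intro finite_measure_mono) (auto simp: opt_accurate_def)
  also have "\<dots> \<le> exp (- (9 / 5 * ln (real t)))"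
    using t L dim_pos by (intro sq_dev_concentration t sub_d opt_in) auto
  finally show ?thesis .
qed

section \<open>Counting boosted rounds\<close>

lemma boosted_measurable_gen:
  assumes "\<And>s. 1 \<le> s \<Longrightarrow> s < t \<Longrightarrow> act s \<in> N \<rightarrow>\<^sub>M count_space (Pow {..<d})"
    and "\<And>i. i < d \<Longrightarrow> (\<lambda>\<omega>. Z t \<omega> i) \<in> borel_measurable N"
  shows "Measurable.pred N (\<lambda>\<omega>. boosted t \<omega>)"
proof -
  have [measurable]: "(\<lambda>\<omega>. real (plays t \<omega> i)) \<in> borel_measurable N" for i
    by (intro plays_measurable_gen assms(1))
  have [measurable]: "(\<lambda>\<omega>. Z t \<omega> i) \<in> borel_measurable N" if "i \<in> opt" for i
    using that sub_d[OF opt_in] by (intro assms(2)) auto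
  show ?thesis unfolding boosted_def by measurable
qed

lemma boosted_pred[measurable]: "1 \<le> t \<Longrightarrow> Measurable.pred M (\<lambda>\<omega>. boosted t \<omega>)"
  by (intro boosted_measurable_gen act_measurable Z_meas)

definition num_boosted :: "nat \<Rightarrow> nat \<Rightarrow> 'w \<Rightarrow> nat" where
  "num_boosted a b \<omega> = card {s \<in> {a..<b}. boosted s \<omega>}"

lemma num_boosted_sum: "real (num_boosted a b \<omega>) = (\<Sum>s = a..<b. of_bool (boosted s \<omega>))"
proof -
  have "{s \<in> {a..<b}. boosted s \<omega>} = {a..<b} \<inter> {s. boosted s \<omega>}" by auto
  then show ?thesis by (simp add: num_boosted_def)
qed

text \<open>Not the probability of a boosted round but a lower bound for it that is valid for every
  value of the counts, hence deterministic.\<close>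

definition boost_prob :: "nat \<Rightarrow> real" where
  "boost_prob t = exp (- (sqrt (ln (real t)) + 1)\<^sup>2 / 2) / sqrt (2 * pi)"

text \<open>For frozen counts \<open>n\<close> the expectation is
  \<open>1 - (1 - exp (- 1)) * p\<close> with \<open>p\<close> at least \<open>boost_prob t\<close>;
  3 / 5 is a lower bound for \<open>1 - exp (- 1)\<close>.\<close>

lemma boosted_factor:
  assumes t: "1 \<le> t"
  shows "(\<integral>\<^sup>+\<omega>. ennreal (exp (- of_bool (sqrt (ln (real t)) * sqrt (\<Sum>i\<in>opt. (sqrt (1 / real (n i)))\<^sup>2)
      \<le> (\<Sum>i\<in>opt. sqrt (1 / real (n i)) * Z t \<omega> i)))) \<partial>M) \<le> ennreal (exp (- (3 / 5 * boost_prob t)))"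
proof -
  have fin: "finite opt" by (rule finite_subset[OF sub_d[OF opt_in]]) simp
  define E where "E = {\<omega> \<in> space M. sqrt (ln (real t)) * sqrt (\<Sum>i\<in>opt. (sqrt (1 / real (n i)))\<^sup>2)
      \<le> (\<Sum>i\<in>opt. sqrt (1 / real (n i)) * Z t \<omega> i)}"
  have [measurable]: "(\<lambda>\<omega>. Z t \<omega> i) \<in> borel_measurable M" if "i \<in> opt" for i
    using that sub_d[OF opt_in] t by (intro Z_meas) auto
  have E[measurable]: "E \<in> events" unfolding E_def by measurable
  have p: "boost_prob t \<le> prob E"
    unfolding boost_prob_def E_def using t sub_d[OF opt_in]
    by (intro std_normal_combination_tail fin Z_indep_at Z_normal) auto
  have e: "exp (- 1) \<le> (2 / 5 :: real)"
  proof -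
    have "5 / 2 \<le> (exp 1 :: real)" using exp_lower_Taylor_quadratic[of 1] by simp
    then show ?thesis by (simp add: exp_minus field_simps)
  qed
  have "(\<integral>\<^sup>+\<omega>. ennreal (exp (- of_bool (sqrt (ln (real t)) * sqrt (\<Sum>i\<in>opt. (sqrt (1 / real (n i)))\<^sup>2)
      \<le> (\<Sum>i\<in>opt. sqrt (1 / real (n i)) * Z t \<omega> i)))) \<partial>M)
      = (\<integral>\<^sup>+\<omega>. ennreal (exp (- 1)) * indicator E \<omega> + indicator (space M - E) \<omega> \<partial>M)"
    by (intro nn_integral_cong) (auto simp: E_def indicator_def)
  also have "\<dots> = ennreal (exp (- 1)) * ennreal (prob E) + ennreal (prob (space M - E))"
    by (subst nn_integral_add) (auto simp: nn_integral_cmult emeasure_eq_measure)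
  also have "\<dots> = ennreal (exp (- 1) * prob E + (1 - prob E))"
    using prob_compl[OF E] by (simp add: ennreal_mult[symmetric] ennreal_plus[symmetric] del: ennreal_plus)
  also have "\<dots> \<le> ennreal (exp (- (3 / 5 * boost_prob t)))"
  proof (rule ennreal_leI)
    have "exp (- 1) * prob E \<le> 2 / 5 * prob E" using e by (intro mult_right_mono) auto
    then have "exp (- 1) * prob E + (1 - prob E) \<le> 1 + - (3 / 5 * boost_prob t)" using p by simp
    also have "\<dots> \<le> exp (- (3 / 5 * boost_prob t))" by (rule exp_ge_add_one_self)
    finally show "exp (- 1) * prob E + (1 - prob E) \<le> exp (- (3 / 5 * boost_prob t))" .
  qed
  finally show ?thesis .
qed

text \<open>The boosted events involve adaptive counts, but each new factor obeys the same
  deterministic bound given the past. The Laplace transform is therefore bounded as for independent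
  events.\<close>

lemma num_boosted_exp:
  assumes a: "1 \<le> a" "a \<le> b"
  shows "(\<integral>\<^sup>+\<omega>. ennreal (exp (- real (num_boosted a b \<omega>))) \<partial>M)
    \<le> ennreal (exp (- (3 / 5 * (\<Sum>s = a..<b. boost_prob s))))"
  using a(2)
proof (induction b rule: dec_induct)
  case base
  show ?case by (simp add: num_boosted_sum emeasure_space_1)
next
  case (step b)
  then have b: "1 \<le> b" using a by simp
  define H where "H \<omega> = ennreal (exp (- real (num_boosted a b \<omega>)))" for \<omega>
  define f where "f n y = ennreal (exp (- of_bool (sqrt (ln (real b)) * sqrt (\<Sum>i\<in>opt. (sqrt (1 / real (n i)))\<^sup>2)
      \<le> (\<Sum>i\<in>opt. sqrt (1 / real (n i)) * y (b, i)))))" for n :: "nat \<Rightarrow> nat" and y :: "nat \<times> nat \<Rightarrow> real"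
  let ?Y = "\<lambda>\<omega>. \<lambda>(s, i)\<in>{b} \<times> {..<d}. Z s \<omega> i"
  \<comment> \<open>Restricted to the optimal items, the counts lie in a finite set of extensional
    functions, and boosting depends on nothing else from the past.\<close>
  let ?\<kappa> = "\<lambda>\<omega>. restrict (plays b \<omega>) opt"
  have fin: "finite opt" by (rule finite_subset[OF sub_d[OF opt_in]]) simp
  have H_meas: "H \<in> borel_measurable (noises_before b)"
  proof -
    have [measurable]: "Measurable.pred (noises_before b) (\<lambda>\<omega>. boosted s \<omega>)" if "s \<in> {a..<b}" for s
      using that a by (intro boosted_measurable_gen act_noises_before noises_before_measurable) auto
    show ?thesis unfolding H_def num_boosted_sum by measurable
  qed
  have k_meas: "(\<lambda>\<omega>. indicator {\<omega> \<in> space M. ?\<kappa> \<omega> = k} \<omega> * H \<omega>) \<in> borel_measurable (noises_before b)"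
    if k: "k \<in> PiE opt (\<lambda>_. {..<b})" for k
  proof -
    have [measurable]: "(\<lambda>\<omega>. real (plays b \<omega> i)) \<in> borel_measurable (noises_before b)" for i
      by (intro plays_measurable_gen act_noises_before) auto
    have "?\<kappa> \<omega> = k \<longleftrightarrow> (\<forall>i\<in>opt. real (plays b \<omega> i) = real (k i))" for \<omega>
      using k by (auto simp: fun_eq_iff PiE_def extensional_def restrict_def)
    moreover have "Measurable.pred (noises_before b) (\<lambda>\<omega>. \<forall>i\<in>opt. real (plays b \<omega> i) = real (k i))"
    proof (intro pred_intros_finite(3) fin)
      show "Measurable.pred (noises_before b) (\<lambda>\<omega>. real (plays b \<omega> i) = real (k i))" for i by measurable
    qed
    ultimately have "{\<omega> \<in> space M. ?\<kappa> \<omega> = k} \<in> sets (noises_before b)"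
      by (simp add: pred_def known_before_def)
    then show ?thesis using H_meas by (intro borel_measurable_times_ennreal borel_measurable_indicator)
  qed
  have f_eq: "f n (?Y \<omega>) = ennreal (exp (- of_bool (sqrt (ln (real b)) * sqrt (\<Sum>i\<in>opt. (sqrt (1 / real (n i)))\<^sup>2)
      \<le> (\<Sum>i\<in>opt. sqrt (1 / real (n i)) * Z b \<omega> i))))" for n \<omega>
  proof -
    have "(\<Sum>i\<in>opt. sqrt (1 / real (n i)) * ?Y \<omega> (b, i)) = (\<Sum>i\<in>opt. sqrt (1 / real (n i)) * Z b \<omega> i)"
      using sub_d[OF opt_in] by (intro sum.cong) auto
    then show ?thesis by (simp only: f_def)
  qed
  have "(\<integral>\<^sup>+\<omega>. ennreal (exp (- real (num_boosted a (Suc b) \<omega>))) \<partial>M) = (\<integral>\<^sup>+\<omega>. f (?\<kappa> \<omega>) (?Y \<omega>) * H \<omega> \<partial>M)"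
  proof (intro nn_integral_cong)
    fix \<omega>
    have "f (?\<kappa> \<omega>) (?Y \<omega>) = ennreal (exp (- of_bool (boosted b \<omega>)))"
      unfolding f_eq boosted_def by simp
    moreover have "real (num_boosted a (Suc b) \<omega>) = real (num_boosted a b \<omega>) + of_bool (boosted b \<omega>)"
      unfolding num_boosted_sum using step by simp
    ultimately show "ennreal (exp (- real (num_boosted a (Suc b) \<omega>))) = f (?\<kappa> \<omega>) (?Y \<omega>) * H \<omega>"
      unfolding H_def by (simp add: ennreal_mult[symmetric] mult_exp_exp)
  qed
  also have "\<dots> \<le> ennreal (exp (- (3 / 5 * boost_prob b))) * (\<integral>\<^sup>+\<omega>. H \<omega> \<partial>M)"
  proof (rule nn_integral_conditioning[where I = "PiE opt (\<lambda>_. {..<b})" and \<kappa> = ?\<kappa> and f = f and Y = ?Y and H = H])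
    show "finite (PiE opt (\<lambda>_. {..<b}))" using fin by (intro finite_PiE) auto
    show "?\<kappa> \<omega> \<in> PiE opt (\<lambda>_. {..<b})" for \<omega> using plays_less[OF b] by auto
    show "indep_rv (PiM ({b} \<times> {..<d}) (\<lambda>_. borel)) ?Y borel (\<lambda>\<omega>. indicator {\<omega> \<in> space M. ?\<kappa> \<omega> = k} \<omega> * H \<omega>)"
      if "k \<in> PiE opt (\<lambda>_. {..<b})" for k
      by (rule indep_noise[OF b k_meas[OF that]])
    show "f n \<in> borel_measurable (PiM ({b} \<times> {..<d}) (\<lambda>_. borel))" for n
    proof -
      have [measurable]: "(\<lambda>y. y (b, i)) \<in> borel_measurable (PiM ({b} \<times> {..<d}) (\<lambda>_. borel))" if "i \<in> opt" for i
        using that sub_d[OF opt_in] by (intro measurable_component_singleton) auto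
      show ?thesis unfolding f_def by measurable
    qed
    show "(\<integral>\<^sup>+\<omega>. f n (?Y \<omega>) \<partial>M) \<le> ennreal (exp (- (3 / 5 * boost_prob b)))" for n
      unfolding f_eq by (rule boosted_factor[OF b])
  qed
  also have "\<dots> \<le> ennreal (exp (- (3 / 5 * boost_prob b))) * ennreal (exp (- (3 / 5 * (\<Sum>s = a..<b. boost_prob s))))"
    unfolding H_def by (intro mult_left_mono step.IH) simp
  also have "\<dots> = ennreal (exp (- (3 / 5 * (\<Sum>s = a..<Suc b. boost_prob s))))"
    using step by (simp add: ennreal_mult[symmetric] mult_exp_exp algebra_simps)
  finally show ?case .
qed

lemma num_boosted_measurable[measurable]: "1 \<le> a \<Longrightarrow> (\<lambda>\<omega>. real (num_boosted a b \<omega>)) \<in> borel_measurable M"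
  unfolding num_boosted_sum by (intro borel_measurable_sum measurable_compose[OF boosted_pred]) auto

lemma num_boosted_prob:
  assumes a: "1 \<le> a" "a \<le> b"
  shows "prob {\<omega> \<in> space M. real (num_boosted a b \<omega>) < r} \<le> exp (r - 3 / 5 * (\<Sum>s = a..<b. boost_prob s))"
proof -
  have "prob {\<omega> \<in> space M. real (num_boosted a b \<omega>) < r}
      \<le> exp (- (3 / 5 * (\<Sum>s = a..<b. boost_prob s))) * exp (- (- r))"
    by (rule prob_exp_Markov[OF _ num_boosted_exp[OF a]])
      (use num_boosted_measurable[OF a(1), of b] in \<open>auto intro!: ennreal_leI\<close>)
  then show ?thesis by (simp add: mult_exp_exp)
qed

end

section \<open>Exploration of the optimal action\<close>

lemma width_mono:
  assumes "16 \<le> ln (real s)" "s \<le> t"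
  shows "width d m s \<le> width d m t"
proof -
  have s: "0 < s" using assms(1) by (cases "s = 0") auto
  have 1: "ln (real s) \<le> ln (real t)" using s assms by simp
  then have "ln (ln (real s)) \<le> ln (ln (real t))" using assms(1) by simp
  then show ?thesis unfolding width_def using 1 by (intro mult_left_mono add_mono) auto
qed

lemma width_nonneg: "16 \<le> ln (real t) \<Longrightarrow> 0 \<le> width d m t"
  using ln16[of "ln (real t)"] unfolding width_def by (intro mult_nonneg_nonneg add_nonneg_nonneg) auto

context bg_cts_one
begin

text \<open>Gathers the almost sure facts, so that the counting arguments can run at a single sample
  point.\<close>

definition regular :: "'w \<Rightarrow> bool" where
  "regular \<omega> \<longleftrightarrow> (\<forall>t\<ge>1. act t \<omega> \<in> \<A>) \<and> (\<forall>t i. d < t \<longrightarrow> i < d \<longrightarrow> 1 \<le> plays t \<omega> i) \<and>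
     (\<forall>t>d. is_arg_max (reward (th t \<omega>)) (\<lambda>B. B \<in> \<A>) (act t \<omega>))"

lemma AE_regular: "AE \<omega> in M. regular \<omega>"
  using act_in plays_pos act_argmax by eventually_elim (auto simp: regular_def)

lemma regularD:
  assumes "regular \<omega>" and "d < t"
  shows "act t \<omega> \<in> \<A>" "\<And>i. i < d \<Longrightarrow> 1 \<le> plays t \<omega> i"
    "\<And>B. B \<in> \<A> \<Longrightarrow> reward (th t \<omega>) B \<le> reward (th t \<omega>) (act t \<omega>)"
  using assms unfolding regular_def is_arg_max_linorder by auto

lemma sum_gap_charged:
  assumes reg: "regular \<omega>" and S: "finite S" "\<And>s. s \<in> S \<Longrightarrow> d < s"
    and K: "0 \<le> K" and ne: "\<And>s. s \<in> S \<Longrightarrow> act s \<omega> \<noteq> opt"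
    and le: "\<And>s. s \<in> S \<Longrightarrow> (gap \<A> \<mu> (act s \<omega>))\<^sup>2 \<le> K * (\<Sum>i\<in>act s \<omega>. 1 / real (plays s \<omega> i))"
  shows "(\<Sum>s\<in>S. gap \<A> \<mu> (act s \<omega>)) \<le> 10 * (real d * K * ln (real m) / D)"
proof (rule sum_gap_le[where a = "\<lambda>s. act s \<omega>"])
  have act: "act s \<omega> \<in> \<A>" "1 \<le> s" if "s \<in> S" for s
    using regularD(1)[OF reg S(2)[OF that]] S(2)[OF that] by auto
  show "1 \<le> s" if "s \<in> S" for s by (rule act(2)[OF that])
  show "act s \<omega> \<subseteq> {..<d}" if "s \<in> S" for s by (rule sub_d[OF act(1)[OF that]])
  show "card (act s \<omega>) \<le> m" if "s \<in> S" for s by (rule card_le[OF act(1)[OF that]])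
  show "D \<le> gap \<A> \<mu> (act s \<omega>)" if "s \<in> S" for s by (rule D_le[OF act(1)[OF that] ne[OF that]])
  show "1 \<le> num_plays (\<lambda>s. act s \<omega>) s i" if "s \<in> S" "i \<in> act s \<omega>" for s i
  proof -
    have "i < d" using sub_d[OF act(1)[OF that(1)]] that(2) by auto
    then show ?thesis using regularD(2)[OF reg S(2)[OF that(1)]] unfolding plays_def[symmetric] by blast
  qed
  show "(gap \<A> \<mu> (act s \<omega>))\<^sup>2 \<le> K * (\<Sum>i\<in>act s \<omega>. 1 / real (num_plays (\<lambda>s. act s \<omega>) s i))" if "s \<in> S" for s
    using le[OF that] unfolding plays_def .
qed (use S K size_ge2 D_pos in auto)

text \<open>A boosted round either plays the optimal action, and hence item \<open>i\<close>, or is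
  inaccurate, or is optimistic and suboptimal. Rounds of the last kind each have gap at least
  \<open>D\<close>, while the sum of their gaps is charged to counts; the quotient bounds their
  number.\<close>

lemma num_boosted_le:
  assumes reg: "regular \<omega>" and a: "d < a" "16 \<le> ln (real a)" and ab: "a \<le> b" and i: "i \<in> opt"
  shows "real (num_boosted a b \<omega>) \<le> real (plays b \<omega> i)
    + real (card {s \<in> {a..<b}. \<not> accurate s \<omega> \<or> \<not> opt_accurate s \<omega>})
    + 10 * (real d * (\<sigma>\<^sup>2 * width d m b) * ln (real m) / D) / D"
proof -
  define S where "S = {s \<in> {a..<b}. boosted s \<omega> \<and> accurate s \<omega> \<and> opt_accurate s \<omega> \<and> act s \<omega> \<noteq> opt}"
  let ?O = "{s \<in> {1..<b}. i \<in> act s \<omega>}" and ?B = "{s \<in> {a..<b}. \<not> accurate s \<omega> \<or> \<not> opt_accurate s \<omega>}"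
  have a0: "0 < a" using a by simp
  have Ls: "16 \<le> ln (real s)" if "a \<le> s" for s
  proof -
    have "ln (real a) \<le> ln (real s)" using that a0 by simp
    then show ?thesis using a by linarith
  qed
  have "num_boosted a b \<omega> \<le> card (?O \<union> ?B \<union> S)"
    unfolding num_boosted_def using i a0 by (intro card_mono) (auto simp: S_def)
  also have "\<dots> \<le> card ?O + card ?B + card S"
    using card_Un_le[of "?O \<union> ?B" S] card_Un_le[of ?O ?B] by linarith
  finally have 1: "real (num_boosted a b \<omega>) \<le> real (plays b \<omega> i) + real (card ?B) + real (card S)"
    unfolding plays_def num_plays_def by linarith
  have "(\<Sum>s\<in>S. gap \<A> \<mu> (act s \<omega>)) \<le> 10 * (real d * (\<sigma>\<^sup>2 * width d m b) * ln (real m) / D)"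
  proof (rule sum_gap_charged[OF reg])
    show "d < s" if "s \<in> S" for s using that a by (auto simp: S_def)
    show "0 \<le> \<sigma>\<^sup>2 * width d m b" using Ls[OF ab] by (simp add: width_nonneg)
    fix s assume s: "s \<in> S"
    then have sd: "d < s" "a \<le> s" "s \<le> b" using a by (auto simp: S_def)
    have N: "1 \<le> plays s \<omega> j" if "j < d" for j by (rule regularD(2)[OF reg sd(1) that])
    have act: "act s \<omega> \<in> \<A>" by (rule regularD(1)[OF reg sd(1)])
    have "reward \<mu> opt \<le> reward (th s \<omega>) opt"
      by (rule boosted_optimistic[OF N Ls[OF sd(2)]]) (use s in \<open>auto simp: S_def\<close>)
    also have "\<dots> \<le> reward (th s \<omega>) (act s \<omega>)"
      by (rule regularD(3)[OF reg sd(1) opt_in])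
    finally have "gap \<A> \<mu> (act s \<omega>) \<le> reward (th s \<omega>) (act s \<omega>) - reward \<mu> (act s \<omega>)"
      by (simp add: gap_def)
    then have "(gap \<A> \<mu> (act s \<omega>))\<^sup>2 \<le> (reward (th s \<omega>) (act s \<omega>) - reward \<mu> (act s \<omega>))\<^sup>2"
      using gap_nonneg[OF act] by (intro power_mono)
    also have "\<dots> \<le> \<sigma>\<^sup>2 * width d m s * (\<Sum>i\<in>act s \<omega>. 1 / real (plays s \<omega> i))"
      by (rule accurate_bound[OF sub_d[OF act] N Ls[OF sd(2)]]) (use s in \<open>auto simp: S_def\<close>)
    also have "\<dots> \<le> \<sigma>\<^sup>2 * width d m b * (\<Sum>i\<in>act s \<omega>. 1 / real (plays s \<omega> i))"
      by (intro mult_right_mono mult_left_mono width_mono Ls[OF sd(2)] sd sum_nonneg) auto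
    finally show "(gap \<A> \<mu> (act s \<omega>))\<^sup>2 \<le> \<sigma>\<^sup>2 * width d m b * (\<Sum>i\<in>act s \<omega>. 1 / real (plays s \<omega> i))" .
  qed (auto simp: S_def)
  moreover have "real (card S) * D \<le> (\<Sum>s\<in>S. gap \<A> \<mu> (act s \<omega>))"
  proof -
    have "(\<Sum>s\<in>S. D) \<le> (\<Sum>s\<in>S. gap \<A> \<mu> (act s \<omega>))"
      using a by (intro sum_mono D_le regularD(1)[OF reg]) (auto simp: S_def)
    then show ?thesis by simp
  qed
  ultimately have "real (card S) * D \<le> 10 * (real d * (\<sigma>\<^sup>2 * width d m b) * ln (real m) / D)" by linarith
  then have "real (card S) \<le> 10 * (real d * (\<sigma>\<^sup>2 * width d m b) * ln (real m) / D) / D"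
    using D_pos by (simp add: pos_le_divide_eq)
  then show ?thesis using 1 by linarith
qed

definition explored :: "(nat \<Rightarrow> real) \<Rightarrow> nat \<Rightarrow> 'w \<Rightarrow> bool" where
  "explored quota t \<omega> \<longleftrightarrow> (\<forall>i\<in>opt. quota t \<le> real (plays t \<omega> i))"

text \<open>The quota makes the optimal action's sample accurate within \<open>D / 2\<close>, at
  most half the gap. The action played must then be overestimated by at least half its gap; squaring
  this half gives the factor 4.\<close>

lemma explored_gap:
  assumes reg: "regular \<omega>" and t: "d < t" and L: "16 \<le> ln (real t)"
    and acc: "accurate t \<omega>" and exp: "explored quota t \<omega>" and quota: "0 < quota t"
    and small: "4 * \<sigma>\<^sup>2 * width d m t * real m \<le> D\<^sup>2 * quota t" and ne: "act t \<omega> \<noteq> opt"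
  shows "(gap \<A> \<mu> (act t \<omega>))\<^sup>2 \<le> 4 * \<sigma>\<^sup>2 * width d m t * (\<Sum>i\<in>act t \<omega>. 1 / real (plays t \<omega> i))"
proof -
  have N: "1 \<le> plays t \<omega> j" if "j < d" for j by (rule regularD(2)[OF reg t that])
  have act: "act t \<omega> \<in> \<A>" by (rule regularD(1)[OF reg t])
  have w0: "0 \<le> \<sigma>\<^sup>2 * width d m t" using L by (simp add: width_nonneg)
  have "(\<Sum>i\<in>opt. 1 / real (plays t \<omega> i)) \<le> (\<Sum>i\<in>opt. 1 / quota t)"
    using exp quota by (intro sum_mono) (auto simp: explored_def frac_le)
  also have "\<dots> \<le> real m / quota t" using card_le[OF opt_in] quota by (simp add: divide_right_mono)
  finally have inv: "(\<Sum>i\<in>opt. 1 / real (plays t \<omega> i)) \<le> real m / quota t" .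
  have "(reward (th t \<omega>) opt - reward \<mu> opt)\<^sup>2 \<le> \<sigma>\<^sup>2 * width d m t * (\<Sum>i\<in>opt. 1 / real (plays t \<omega> i))"
    by (rule accurate_bound[OF sub_d[OF opt_in] N L acc])
  also have "\<dots> \<le> \<sigma>\<^sup>2 * width d m t * (real m / quota t)" by (rule mult_left_mono[OF inv w0])
  also have "\<dots> = 4 * \<sigma>\<^sup>2 * width d m t * real m / quota t / 4" by simp
  also have "\<dots> \<le> D\<^sup>2 / 4"
    using small quota by (intro divide_right_mono) (auto simp: pos_divide_le_eq)
  also have "\<dots> = (D / 2)\<^sup>2" by (simp add: power_divide)
  finally have "\<bar>reward (th t \<omega>) opt - reward \<mu> opt\<bar>\<^sup>2 \<le> (D / 2)\<^sup>2" by (simp only: power2_abs)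
  then have "\<bar>reward (th t \<omega>) opt - reward \<mu> opt\<bar> \<le> D / 2"
    by (rule power2_le_imp_le) (use D_pos in simp)
  then have "reward \<mu> opt - D / 2 \<le> reward (th t \<omega>) opt" by (simp only: abs_le_iff) simp
  moreover have "reward (th t \<omega>) opt \<le> reward (th t \<omega>) (act t \<omega>)"
    by (rule regularD(3)[OF reg t opt_in])
  moreover have gap: "D \<le> gap \<A> \<mu> (act t \<omega>)" by (rule D_le[OF act ne])
  ultimately have "gap \<A> \<mu> (act t \<omega>) / 2 \<le> reward (th t \<omega>) (act t \<omega>) - reward \<mu> (act t \<omega>)"
    by (simp add: gap_def field_simps)
  then have "(gap \<A> \<mu> (act t \<omega>) / 2)\<^sup>2 \<le> (reward (th t \<omega>) (act t \<omega>) - reward \<mu> (act t \<omega>))\<^sup>2"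
    using gap D_pos by (intro power_mono) auto
  also have "\<dots> \<le> \<sigma>\<^sup>2 * width d m t * (\<Sum>i\<in>act t \<omega>. 1 / real (plays t \<omega> i))"
    by (rule accurate_bound[OF sub_d[OF act] N L acc])
  finally show ?thesis by (simp add: power_divide)
qed

lemma late_regret:
  assumes reg: "regular \<omega>" and t0: "d < t0" "16 \<le> ln (real t0)" "t0 \<le> T"
    and quota: "\<And>t. t0 \<le> t \<Longrightarrow> 0 < quota t \<and> 4 * \<sigma>\<^sup>2 * width d m t * real m \<le> D\<^sup>2 * quota t"
  shows "(\<Sum>t = t0..T. gap \<A> \<mu> (act t \<omega>))
    \<le> Dmax * (\<Sum>t = t0..T. of_bool (\<not> accurate t \<omega> \<or> \<not> explored quota t \<omega>))
      + 10 * (real d * (4 * \<sigma>\<^sup>2 * width d m T) * ln (real m) / D)"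
proof -
  define S where "S = {t \<in> {t0..T}. accurate t \<omega> \<and> explored quota t \<omega> \<and> act t \<omega> \<noteq> opt}"
  have Ls: "16 \<le> ln (real s)" if "t0 \<le> s" for s
  proof -
    have "ln (real t0) \<le> ln (real s)" using that t0 by simp
    then show ?thesis using t0 by linarith
  qed
  have "(\<Sum>t = t0..T. gap \<A> \<mu> (act t \<omega>)) \<le> (\<Sum>t = t0..T. Dmax * of_bool (\<not> accurate t \<omega> \<or> \<not> explored quota t \<omega>)
      + (if t \<in> S then gap \<A> \<mu> (act t \<omega>) else 0))"
  proof (rule sum_mono)
    fix t assume t: "t \<in> {t0..T}"
    then have "act t \<omega> \<in> \<A>" using t0 by (intro regularD(1)[OF reg]) auto
    then show "gap \<A> \<mu> (act t \<omega>) \<le> Dmax * of_bool (\<not> accurate t \<omega> \<or> \<not> explored quota t \<omega>)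
      + (if t \<in> S then gap \<A> \<mu> (act t \<omega>) else 0)"
      using gap_le[of "act t \<omega>"] gap_nonneg[of "act t \<omega>"] t by (auto simp: S_def)
  qed
  also have "\<dots> = Dmax * (\<Sum>t = t0..T. of_bool (\<not> accurate t \<omega> \<or> \<not> explored quota t \<omega>)) + (\<Sum>t\<in>S. gap \<A> \<mu> (act t \<omega>))"
  proof -
    have "(\<Sum>t = t0..T. if t \<in> S then gap \<A> \<mu> (act t \<omega>) else 0) = (\<Sum>t\<in>S. gap \<A> \<mu> (act t \<omega>))"
      by (intro sum.mono_neutral_cong_right) (auto simp: S_def)
    then show ?thesis by (simp add: sum.distrib sum_distrib_left)
  qed
  also have "(\<Sum>t\<in>S. gap \<A> \<mu> (act t \<omega>)) \<le> 10 * (real d * (4 * \<sigma>\<^sup>2 * width d m T) * ln (real m) / D)"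
  proof (rule sum_gap_charged[OF reg])
    show "d < s" if "s \<in> S" for s using that t0 by (auto simp: S_def)
    show "0 \<le> 4 * \<sigma>\<^sup>2 * width d m T" using Ls[OF t0(3)] by (simp add: width_nonneg)
    fix s assume s: "s \<in> S"
    then have sd: "d < s" "t0 \<le> s" "s \<le> T" using t0 by (auto simp: S_def)
    have "(gap \<A> \<mu> (act s \<omega>))\<^sup>2 \<le> 4 * \<sigma>\<^sup>2 * width d m s * (\<Sum>i\<in>act s \<omega>. 1 / real (plays s \<omega> i))"
      using s quota[OF sd(2)] by (intro explored_gap[OF reg sd(1) Ls[OF sd(2)], where quota = quota]) (auto simp: S_def)
    also have "\<dots> \<le> 4 * \<sigma>\<^sup>2 * width d m T * (\<Sum>i\<in>act s \<omega>. 1 / real (plays s \<omega> i))"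
      by (intro mult_right_mono mult_left_mono width_mono Ls[OF sd(2)] sd sum_nonneg) auto
    finally show "(gap \<A> \<mu> (act s \<omega>))\<^sup>2 \<le> 4 * \<sigma>\<^sup>2 * width d m T * (\<Sum>i\<in>act s \<omega>. 1 / real (plays s \<omega> i))" .
  qed (auto simp: S_def)
  finally show ?thesis by simp
qed

section \<open>Probability of exploring the optimal action\<close>

lemma explored_event: "{\<omega> \<in> space M. explored quota t \<omega>} \<in> events"
proof -
  have "finite opt" by (rule finite_subset[OF sub_d[OF opt_in]]) simp
  then have "Measurable.pred M (\<lambda>\<omega>. \<forall>i\<in>opt. quota t \<le> real (plays t \<omega> i))"
    by (intro pred_intros_finite(3)) measurable
  then show ?thesis by (simp add: explored_def pred_def)
qed

text \<open>If an optimal item misses its quota and fewer than a quota of rounds are inaccurate,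
  then \<open>num_boosted_le\<close> bounds the boosted rounds by three quotas, as
  \<open>small\<close> covers the third class. Markov handles the inaccurate rounds and Chernoff the
  boosted ones.\<close>

lemma explored_prob:
  assumes a: "d < a" "16 \<le> ln (real a)" "a \<le> t" and quota: "0 < quota t"
    and small: "10 * (real d * (\<sigma>\<^sup>2 * width d m t) * ln (real m) / D) / D \<le> quota t"
  shows "prob {\<omega> \<in> space M. \<not> explored quota t \<omega>}
    \<le> (\<Sum>s = a..<t. 3 * exp (- (9 / 5 * ln (real s)))) / quota t
      + exp (3 * quota t - 3 / 5 * (\<Sum>s = a..<t. boost_prob s))"
proof -
  let ?B = "\<lambda>s \<omega>. \<not> accurate s \<omega> \<or> \<not> opt_accurate s \<omega>"
  let ?E1 = "{\<omega> \<in> space M. quota t \<le> real (card {s \<in> {a..<t}. ?B s \<omega>})}"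
  let ?E2 = "{\<omega> \<in> space M. real (num_boosted a t \<omega>) < 3 * quota t}"
  have a1: "1 \<le> a" using a by simp
  have not_ev: "{\<omega> \<in> space M. \<not> accurate s \<omega>} \<in> events" "{\<omega> \<in> space M. \<not> opt_accurate s \<omega>} \<in> events"
    if "1 \<le> s" for s
    using accurate_event[OF that] opt_accurate_event[of s] by auto
  have B_eq: "{\<omega> \<in> space M. ?B s \<omega>} = {\<omega> \<in> space M. \<not> accurate s \<omega>} \<union> {\<omega> \<in> space M. \<not> opt_accurate s \<omega>}" for s
    by auto
  have B_ev: "{\<omega> \<in> space M. ?B s \<omega>} \<in> events" if "1 \<le> s" for s
    unfolding B_eq using not_ev[OF that] by auto
  have E1: "?E1 \<in> events"
  proof -
    have eq: "real (card {s \<in> {a..<t}. ?B s \<omega>}) = (\<Sum>s = a..<t. indicator {\<omega> \<in> space M. ?B s \<omega>} \<omega>)"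
      if "\<omega> \<in> space M" for \<omega>
    proof -
      have "(\<Sum>s = a..<t. indicator {\<omega> \<in> space M. ?B s \<omega>} \<omega>) = (\<Sum>s = a..<t. of_bool (?B s \<omega>) :: real)"
        using that by (intro sum.cong) (auto simp: indicator_def)
      also have "\<dots> = real (card ({a..<t} \<inter> {s. ?B s \<omega>}))" by simp
      also have "{a..<t} \<inter> {s. ?B s \<omega>} = {s \<in> {a..<t}. ?B s \<omega>}" by auto
      finally show ?thesis ..
    qed
    have "(\<lambda>\<omega>. \<Sum>s = a..<t. indicator {\<omega> \<in> space M. ?B s \<omega>} \<omega> :: real) \<in> borel_measurable M"
      using B_ev a1 by (intro borel_measurable_sum borel_measurable_indicator) auto
    then have "{\<omega> \<in> space M. quota t \<le> (\<Sum>s = a..<t. indicator {\<omega> \<in> space M. ?B s \<omega>} \<omega> :: real)} \<in> events" by simp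
    also have "{\<omega> \<in> space M. quota t \<le> (\<Sum>s = a..<t. indicator {\<omega> \<in> space M. ?B s \<omega>} \<omega> :: real)} = ?E1"
      using eq by auto
    finally show ?thesis .
  qed
  have E2: "?E2 \<in> events" using num_boosted_measurable[OF a1, of t] by simp
  have "prob {\<omega> \<in> space M. \<not> explored quota t \<omega>} \<le> prob (?E1 \<union> ?E2)"
  proof (rule finite_measure_mono_AE)
    show "AE \<omega> in M. \<omega> \<in> {\<omega> \<in> space M. \<not> explored quota t \<omega>} \<longrightarrow> \<omega> \<in> ?E1 \<union> ?E2"
      using AE_regular
    proof eventually_elim
      case (elim \<omega>)
      show ?case
      proof
        assume "\<omega> \<in> {\<omega> \<in> space M. \<not> explored quota t \<omega>}"
        then obtain i where w: "\<omega> \<in> space M" and i: "i \<in> opt" "real (plays t \<omega> i) < quota t"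
          by (auto simp: explored_def not_le)
        show "\<omega> \<in> ?E1 \<union> ?E2"
        proof (cases "quota t \<le> real (card {s \<in> {a..<t}. ?B s \<omega>})")
          case False
          then have "real (num_boosted a t \<omega>) < 3 * quota t"
            using num_boosted_le[OF elim a i(1)] small i(2) by linarith
          then show ?thesis using w by blast
        qed (use w in blast)
      qed
    qed
    show "?E1 \<union> ?E2 \<in> events" using E1 E2 by (rule sets.Un)
  qed
  also have "\<dots> \<le> prob ?E1 + prob ?E2" by (rule measure_Un_le[OF E1 E2])
  also have "prob ?E1 \<le> (\<Sum>s = a..<t. prob {\<omega> \<in> space M. ?B s \<omega>}) / quota t"
    using a1 by (intro prob_count_ge quota B_ev) auto
  also have "\<dots> \<le> (\<Sum>s = a..<t. 3 * exp (- (9 / 5 * ln (real s)))) / quota t"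
  proof (intro divide_right_mono sum_mono)
    fix s assume s: "s \<in> {a..<t}"
    have L: "16 \<le> ln (real s)"
    proof -
      have "ln (real a) \<le> ln (real s)" using s a1 by simp
      then show ?thesis using a by linarith
    qed
    have "prob {\<omega> \<in> space M. ?B s \<omega>} \<le> prob {\<omega> \<in> space M. \<not> accurate s \<omega>} + prob {\<omega> \<in> space M. \<not> opt_accurate s \<omega>}"
      unfolding B_eq using not_ev[of s] s a1 by (intro measure_Un_le) auto
    also have "\<dots> \<le> 2 * exp (- 2 * ln (real s)) + exp (- (9 / 5 * ln (real s)))"
      using s a by (intro add_mono accurate_prob opt_accurate_prob L) auto
    also have "\<dots> \<le> 3 * exp (- (9 / 5 * ln (real s)))" using L by simp
    finally show "prob {\<omega> \<in> space M. ?B s \<omega>} \<le> 3 * exp (- (9 / 5 * ln (real s)))" .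
  qed (use quota in simp)
  also have "prob ?E2 \<le> exp (3 * quota t - 3 / 5 * (\<Sum>s = a..<t. boost_prob s))"
    by (rule num_boosted_prob[OF a1 a(3)])
  finally show ?thesis by simp
qed

end

section \<open>Constants and the final bound\<close>

definition tail_const :: real where "tail_const = exp (- 3) / sqrt (2 * pi)"

lemma tail_const_pos: "0 < tail_const"
  by (simp add: tail_const_def)

text \<open>
  The rounds \<open>t / 2 \<le> s < t\<close> contain on average at least \<open>tail_const / 3 * t powr (2 / 5)\<close> boosted ones;
  the quota is a small enough fraction of this for a Chernoff bound to leave a factor \<open>exp (- quota t)\<close>.
\<close>

definition quota :: "nat \<Rightarrow> real" where "quota t = tail_const / 20 * real t powr (2 / 5)"

lemma quota_pos: "0 < t \<Longrightarrow> 0 < quota t"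
  using tail_const_pos by (simp add: quota_def)

section \<open>Power sums over the second half of the rounds\<close>

lemma half_range:
  assumes "2 \<le> (t :: nat)"
  shows "real t / 3 \<le> real (t - (t + 1) div 2)" "real t / 2 \<le> real ((t + 1) div 2)" "1 \<le> (t + 1) div 2" "(t + 1) div 2 \<le> t"
proof -
  obtain k where "t = 2 * k \<or> t = 2 * k + 1" by (metis evenE oddE)
  then have h: "(t + 1) div 2 = k \<and> t = 2 * k \<or> (t + 1) div 2 = k + 1 \<and> t = 2 * k + 1" by auto
  have k: "1 \<le> k" using \<open>t = 2 * k \<or> t = 2 * k + 1\<close> assms by auto
  show "real t / 3 \<le> real (t - (t + 1) div 2)" "real t / 2 \<le> real ((t + 1) div 2)"
    "1 \<le> (t + 1) div 2" "(t + 1) div 2 \<le> t"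
    using h k by auto
qed

lemma sum_powr_half_ge:
  assumes t: "2 \<le> t"
  shows "1 / 3 * real t powr (2 / 5) \<le> (\<Sum>s = (t + 1) div 2..<t. real s powr (- 3 / 5))"
proof -
  have "real t powr (2 / 5) = real t * real t powr (- 3 / 5)"
    using t powr_add[of "real t" 1 "- 3 / 5"] by simp
  then have "1 / 3 * real t powr (2 / 5) = real t / 3 * real t powr (- 3 / 5)" by simp
  also have "\<dots> \<le> real (t - (t + 1) div 2) * real t powr (- 3 / 5)"
    using half_range(1)[OF t] by (intro mult_right_mono) auto
  also have "\<dots> = (\<Sum>s = (t + 1) div 2..<t. real t powr (- 3 / 5))" by simp
  also have "\<dots> \<le> (\<Sum>s = (t + 1) div 2..<t. real s powr (- 3 / 5))"
    using half_range(3)[OF t] by (intro sum_mono powr_mono2') auto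
  finally show ?thesis .
qed

lemma sum_powr_half_le:
  assumes t: "2 \<le> t"
  shows "(\<Sum>s = (t + 1) div 2..<t. 3 * exp (- (9 / 5 * ln (real s)))) \<le> 12 * real t powr (- 4 / 5)"
proof -
  have two: "(2 :: real) powr (9 / 5) \<le> 4" using powr_mono[of "9 / 5" 2 "2 :: real"] by simp
  have "(\<Sum>s = (t + 1) div 2..<t. 3 * exp (- (9 / 5 * ln (real s)))) \<le> (\<Sum>s = (t + 1) div 2..<t. 12 * real t powr (- 9 / 5))"
  proof (rule sum_mono)
    fix s assume s: "s \<in> {(t + 1) div 2..<t}"
    then have s0: "0 < real s" and st: "real t / 2 \<le> real s"
      using half_range(2,3)[OF t] by (auto intro: order_trans)
    have "exp (- (9 / 5 * ln (real s))) = real s powr (- 9 / 5)" using s0 by (simp add: powr_def)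
    also have "\<dots> \<le> (real t / 2) powr (- 9 / 5)" using st t by (intro powr_mono2') auto
    also have "\<dots> = 2 powr (9 / 5) * real t powr (- 9 / 5)"
      using t by (simp add: powr_divide powr_minus field_simps)
    also have "\<dots> \<le> 4 * real t powr (- 9 / 5)" using two by (intro mult_right_mono) auto
    finally show "3 * exp (- (9 / 5 * ln (real s))) \<le> 12 * real t powr (- 9 / 5)" by simp
  qed
  also have "\<dots> = real (t - (t + 1) div 2) * (12 * real t powr (- 9 / 5))" by simp
  also have "\<dots> \<le> real t * (12 * real t powr (- 9 / 5))" by (intro mult_right_mono) auto
  also have "\<dots> = 12 * real t powr (- 4 / 5)" using t powr_add[of "real t" 1 "- 9 / 5"] by simp
  finally show ?thesis .
qed

text \<open>The third power is chosen because the cube of \<open>t powr (2 / 5)\<close> is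
  \<open>t powr (6 / 5)\<close>, which brings the Chernoff term to the rate of the Markov
  term.\<close>

lemma exp_minus_le_cube: "0 < x \<Longrightarrow> exp (- x) \<le> 27 / x ^ 3" for x :: real
proof -
  assume x: "0 < x"
  have "x / 3 \<le> exp (x / 3)" by (rule order_trans[OF _ exp_ge_add_one_self]) simp
  then have "(x / 3) ^ 3 \<le> exp (x / 3) ^ 3" using x by (intro power_mono) auto
  also have "\<dots> = exp x" by (simp add: exp_of_nat_mult[symmetric])
  finally have "x ^ 3 / 27 \<le> exp x" by (simp add: power_divide)
  then have "inverse (exp x) \<le> inverse (x ^ 3 / 27)" using x by (intro le_imp_inverse_le) auto
  then show ?thesis by (simp add: exp_minus)
qed

text \<open>The summands come from an inaccurate round, from Markov for the inaccurate rounds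
  (\<open>12 * 20 = 240\<close>), and from Chernoff for the boosted rounds.\<close>

definition fail_const :: real where
  "fail_const = 2 + 240 / tail_const + 27 * (20 / tail_const) ^ 3"

definition round_const :: real where
  "round_const = fail_const * (\<Sum>n. real n powr (- 6 / 5))"

lemma fail_const_pos: "0 < fail_const"
  unfolding fail_const_def using tail_const_pos by (intro add_pos_pos) auto

lemma sum_powr_le_suminf: "(\<Sum>t = a..b. real t powr (- 6 / 5)) \<le> (\<Sum>n. real n powr (- 6 / 5))"
proof (rule sum_le_suminf)
  show "summable (\<lambda>n. real n powr (- 6 / 5))" by (simp add: summable_real_powr_iff)
qed auto

lemma round_const_nonneg: "0 \<le> round_const"
  using sum_powr_le_suminf[of 1 0] fail_const_pos unfolding round_const_def by simp

lemma le_mult_ge_one: "1 \<le> q \<Longrightarrow> 0 \<le> p \<Longrightarrow> p \<le> p * q" for p q :: real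
  using mult_left_mono[of 1 q p] by simp

lemma ln_le_powr_tenth: "0 < x \<Longrightarrow> ln x \<le> 10 * x powr (1 / 10)" for x :: real
  using ln_bound[of "x powr (1 / 10)"] by (simp add: ln_powr)

section \<open>A polynomial threshold and summable failure probabilities\<close>

context bg_cts_one
begin

text \<open>The loss \<open>exp (- sqrt (ln t))\<close> is traded for
  \<open>t powr (- 1 / 10)\<close>. With \<open>x = sqrt (ln t)\<close>, the inequality
  \<open>(x + 1)\<^sup>2 / 2 \<le> 3 / 5 * x\<^sup>2 + 3\<close> is
  \<open>0 \<le> (x - 5)\<^sup>2\<close>, and this fixes the \<open>exp (- 3)\<close> in
  \<open>tail_const\<close>.\<close>

lemma boost_prob_ge:
  assumes t: "1 \<le> t" shows "tail_const * real t powr (- 3 / 5) \<le> boost_prob t"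
proof -
  define x where "x = sqrt (ln (real t))"
  have x2: "x\<^sup>2 = ln (real t)" using t by (simp add: x_def)
  have "0 \<le> (x - 5)\<^sup>2" by simp
  then have "- 3 + - 3 / 5 * x\<^sup>2 \<le> - (x + 1)\<^sup>2 / 2" by (simp add: power2_eq_square algebra_simps)
  then have "exp (- 3 + - 3 / 5 * ln (real t)) \<le> exp (- (x + 1)\<^sup>2 / 2)"
    unfolding x2 by simp
  moreover have "exp (- 3 + - 3 / 5 * ln (real t)) = exp (- 3) * real t powr (- 3 / 5)"
    using t by (simp only: exp_add powr_def) simp
  ultimately have "exp (- 3) * real t powr (- 3 / 5) \<le> exp (- (sqrt (ln (real t)) + 1)\<^sup>2 / 2)"
    by (simp only: x_def)
  then show ?thesis unfolding tail_const_def boost_prob_def by (simp add: divide_right_mono)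
qed

text \<open>One quantity above 1, all five parameters and \<open>d * m\<close>: polynomial
  dependence is tracked as a power of it, and its powers are polynomials in the five
  arguments.\<close>

definition scale :: real where
  "scale = (1 + real m) * (1 + real d) * (1 + 1 / D) * (1 + Dmax) * (1 + \<sigma>)"

lemma scale_bounds:
  "1 \<le> scale" "1 + real d + real d * real m \<le> scale" "real d * real m \<le> scale" "real m \<le> scale"
  "real d \<le> scale" "1 / D \<le> scale" "Dmax \<le> scale" "\<sigma> \<le> scale"
proof -
  define p q r u v where "p = 1 + real m" "q = 1 + real d" "r = 1 + 1 / D" "u = 1 + Dmax" "v = 1 + \<sigma>"
  have 1: "1 \<le> p" "1 \<le> q" "1 \<le> r" "1 \<le> u" "1 \<le> v"
    unfolding p_q_r_u_v_def using D_pos Dmax_pos sigma_nonneg by auto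
  have s: "scale = p * q * r * u * v" by (simp add: scale_def p_q_r_u_v_def)
  have prod: "1 \<le> x * y" if "1 \<le> x" "1 \<le> y" for x y :: real
    using mult_mono[of 1 x 1 y] that by simp
  have pq: "p * q \<le> scale"
    using le_mult_ge_one[of "r * u * v" "p * q"] 1 by (simp add: s prod mult.assoc)
  show "1 \<le> scale" unfolding s by (intro prod 1)
  have "1 + real d + real d * real m \<le> p * q" by (simp add: p_q_r_u_v_def algebra_simps)
  then show dm: "1 + real d + real d * real m \<le> scale" using pq by linarith
  then show "real d * real m \<le> scale" "real d \<le> scale"
    using of_nat_0_le_iff[of d, where 'a = real] mult_nonneg_nonneg[of "real d" "real m"] by linarith+
  have "p \<le> scale" using le_mult_ge_one[of "q * r * u * v" p] 1 by (simp add: s prod mult.assoc)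
  then show "real m \<le> scale" by (simp add: p_q_r_u_v_def)
  have "r \<le> r * (p * q * u * v)" by (intro le_mult_ge_one prod 1) (use 1 in simp)
  then show "1 / D \<le> scale" by (simp add: s p_q_r_u_v_def mult_ac)
  have "u \<le> u * (p * q * r * v)" by (intro le_mult_ge_one prod 1) (use 1 in simp)
  then show "Dmax \<le> scale" by (simp add: s p_q_r_u_v_def mult_ac)
  have "v \<le> v * (p * q * r * u)" by (intro le_mult_ge_one prod 1) (use 1 in simp)
  then show "\<sigma> \<le> scale" by (simp add: s p_q_r_u_v_def mult_ac)
qed

text \<open>The first summand makes the quota dominate (\<open>266000 = 200 * 1330\<close>,
  \<open>1330 = 10 * 133\<close>). Since \<open>3 ^ 16\<close> exceeds \<open>exp 16\<close>, the
  second forces \<open>16 \<le> ln s\<close>, and \<open>2 * d\<close> clears the initialisation;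
  both are doubled because they must hold from round \<open>t / 2\<close> on.\<close>

definition start :: nat where
  "start = nat \<lceil>(266000 / tail_const * scale ^ 6) ^ 4\<rceil> + 2 * 3 ^ 16 + 2 * d + 2"

lemma start_log:
  assumes "start \<le> t" "(t + 1) div 2 \<le> s" shows "16 \<le> ln (real s)"
proof -
  have "3 ^ 16 \<le> (t + 1) div 2" using assms(1) by (simp add: start_def)
  then have "(3 :: nat) ^ 16 \<le> s" using assms(2) by linarith
  then have "(3 :: real) ^ 16 \<le> real s" by (metis of_nat_le_iff of_nat_numeral of_nat_power)
  moreover have "exp 1 ^ 16 \<le> (3 :: real) ^ 16" using exp_le by (intro power_mono) auto
  moreover have "exp 16 = (exp 1 :: real) ^ 16" by (simp add: exp_of_nat_mult[symmetric])
  ultimately have le: "exp 16 \<le> real s" by linarith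
  then have "0 < real s" by (smt (verit) exp_gt_zero)
  then show ?thesis using le by (simp add: ln_ge_iff)
qed

text \<open>The power \<open>t powr (2 / 5)\<close> is split into \<open>t powr (3 / 10)\<close>,
  which beats the problem-dependent factor, and \<open>t powr (1 / 10)\<close>, which beats
  \<open>ln t\<close> up to the factor 10.\<close>

lemma start_quota:
  assumes t: "start \<le> t"
  shows "1330 * scale ^ 6 * ln (real t) \<le> quota t"
proof -
  define B where "B = 266000 / tail_const * scale ^ 6"
  have B: "0 < B" using tail_const_pos scale_bounds(1) by (simp add: B_def)
  have t1: "1 \<le> real t" using t by (simp add: start_def)
  have "nat \<lceil>B ^ 4\<rceil> \<le> start" unfolding start_def B_def add.assoc by (rule le_add1)
  then have "nat \<lceil>B ^ 4\<rceil> \<le> t" using t by (rule le_trans)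
  then have "real (nat \<lceil>B ^ 4\<rceil>) \<le> real t" by (rule of_nat_mono)
  with real_nat_ceiling_ge have "B ^ 4 \<le> real t" by (rule order_trans)
  then have "(B ^ 4) powr (1 / 4) \<le> real t powr (1 / 4)" using B by (intro powr_mono2) auto
  moreover have "(B ^ 4) powr (1 / 4) = B"
    using powr_powr[of B 4 "1 / 4"] powr_realpow[OF B, of 4] B by simp
  \<comment> \<open>The exponent 3 / 10 alone would ask for \<open>B powr (10 / 3) \<le> t\<close>;
    the integer power \<open>B ^ 4\<close> keeps \<open>start\<close> below a polynomial.\<close>
  moreover have "real t powr (1 / 4) \<le> real t powr (3 / 10)" using t1 by (intro powr_mono) auto
  ultimately have Bt: "B \<le> real t powr (3 / 10)" by linarith
  have "1330 * scale ^ 6 = tail_const / 200 * B" using tail_const_pos by (simp add: B_def)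
  then have "1330 * scale ^ 6 * ln (real t) = tail_const / 200 * (B * ln (real t))" by simp
  also have "\<dots> \<le> tail_const / 200 * (real t powr (3 / 10) * (10 * real t powr (1 / 10)))"
    using tail_const_pos B Bt t1 by (intro mult_left_mono mult_mono ln_le_powr_tenth) auto
  also have "\<dots> = tail_const / 20 * (real t powr (3 / 10) * real t powr (1 / 10))" by simp
  also have "\<dots> = quota t" unfolding quota_def powr_add[symmetric] by simp
  finally show ?thesis .
qed

text \<open>Both reduce to \<open>scale ^ 6\<close>: two powers each for
  \<open>\<sigma>\<^sup>2\<close> and \<open>1 / D\<^sup>2\<close>, one for \<open>width\<close>,
  and one for \<open>d * ln m\<close> or \<open>m\<close>.\<close>

lemma start_conditions:
  assumes t: "start \<le> t"
  shows "10 * (real d * (\<sigma>\<^sup>2 * width d m t) * ln (real m) / D) / D \<le> quota t"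
    and "4 * \<sigma>\<^sup>2 * width d m t * real m \<le> D\<^sup>2 * quota t"
proof -
  let ?L = "ln (real t)"
  note sb = scale_bounds
  have L: "16 \<le> ?L" by (rule start_log[OF t]) (use t in \<open>simp add: start_def\<close>)
  have Y0: "0 \<le> scale" using sb(1) by linarith
  have "ln ?L \<le> ?L" using L ln_le_minus_one[of ?L] by simp
  then have "?L + real d * ln ?L + real d * real m \<le> ?L + real d * ?L + real d * real m * ?L"
    using L mult_left_mono[of 1 ?L "real d * real m"] by (intro add_mono mult_left_mono) auto
  also have "\<dots> = ?L * (1 + real d + real d * real m)" by (simp add: algebra_simps)
  also have "\<dots> \<le> ?L * scale" using L sb(2) by (intro mult_left_mono) auto
  finally have w: "width d m t \<le> 133 * (?L * scale)" by (simp add: width_def)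
  have w0: "0 \<le> width d m t" by (rule width_nonneg[OF L])
  have s2: "\<sigma>\<^sup>2 \<le> scale\<^sup>2" using sb sigma_nonneg by (intro power_mono) auto
  have D2: "1 / D * (1 / D) \<le> scale * scale" using sb D_pos Y0 by (intro mult_mono) auto
  have lnm: "0 \<le> ln (real m)" "ln (real m) \<le> real m"
    using size_ge2 ln_le_minus_one[of "real m"] by auto
  have "real d * ln (real m) \<le> real d * real m" using lnm by (intro mult_left_mono) auto
  then have dl: "real d * ln (real m) \<le> scale" using sb(3) by linarith
  let ?W = "scale\<^sup>2 * (133 * (?L * scale))"
  have W0: "0 \<le> ?W" using Y0 L by (intro mult_nonneg_nonneg) auto
  have sw: "\<sigma>\<^sup>2 * width d m t \<le> ?W" by (rule mult_mono[OF s2 w]) (use w0 in simp_all)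
  have sw0: "0 \<le> \<sigma>\<^sup>2 * width d m t" using w0 by simp
  have DD0: "0 \<le> 1 / D * (1 / D)" using D_pos by simp
  have "real d * ln (real m) * (\<sigma>\<^sup>2 * width d m t) \<le> scale * ?W"
    by (rule mult_mono[OF dl sw Y0 sw0])
  then have e: "real d * ln (real m) * (\<sigma>\<^sup>2 * width d m t) * (1 / D * (1 / D)) \<le> scale * ?W * (scale * scale)"
    by (rule mult_mono[OF _ D2 mult_nonneg_nonneg[OF Y0 W0] DD0])
  have "10 * (real d * (\<sigma>\<^sup>2 * width d m t) * ln (real m) / D) / D
      = 10 * (real d * ln (real m) * (\<sigma>\<^sup>2 * width d m t) * (1 / D * (1 / D)))" by simp
  also have "\<dots> \<le> 10 * (scale * ?W * (scale * scale))" by (rule mult_left_mono[OF e]) simp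
  also have "\<dots> = 1330 * scale ^ 6 * ?L" by (simp add: power2_eq_square power_numeral_reduce)
  also have "\<dots> \<le> quota t" by (rule start_quota[OF t])
  finally show "10 * (real d * (\<sigma>\<^sup>2 * width d m t) * ln (real m) / D) / D \<le> quota t" .
  have "\<sigma>\<^sup>2 * width d m t * real m \<le> ?W * scale"
    by (rule mult_mono[OF sw sb(4) W0]) simp
  then have e: "\<sigma>\<^sup>2 * width d m t * real m * (1 / D * (1 / D)) \<le> ?W * scale * (scale * scale)"
    by (rule mult_mono[OF _ D2 mult_nonneg_nonneg[OF W0 Y0] DD0])
  have "4 * \<sigma>\<^sup>2 * width d m t * real m * (1 / D * (1 / D)) = 4 * (\<sigma>\<^sup>2 * width d m t * real m * (1 / D * (1 / D)))" by simp
  also have "\<dots> \<le> 4 * (?W * scale * (scale * scale))" by (rule mult_left_mono[OF e]) simp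
  also have "\<dots> = 532 * (scale ^ 6 * ?L)" by (simp add: power2_eq_square power_numeral_reduce)
  also have "\<dots> \<le> 1330 * (scale ^ 6 * ?L)" using Y0 L by (intro mult_right_mono) auto
  also have "\<dots> \<le> quota t" using start_quota[OF t] by (simp add: mult.assoc)
  finally have "4 * \<sigma>\<^sup>2 * width d m t * real m * (1 / D * (1 / D)) \<le> quota t" .
  then have "D\<^sup>2 * (4 * \<sigma>\<^sup>2 * width d m t * real m * (1 / D * (1 / D))) \<le> D\<^sup>2 * quota t"
    by (intro mult_left_mono) auto
  then show "4 * \<sigma>\<^sup>2 * width d m t * real m \<le> D\<^sup>2 * quota t"
    using D_pos by (simp add: power2_eq_square)
qed

text \<open>Only the rounds from \<open>t / 2\<close> on are searched for boosts and inaccuracies: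
  there the failure probabilities are already of order \<open>t powr (- 9 / 5)\<close>, while about
  as many rounds remain.\<close>

lemma round_failure:
  assumes t: "start \<le> t"
  shows "prob {\<omega> \<in> space M. \<not> accurate t \<omega>} + prob {\<omega> \<in> space M. \<not> explored quota t \<omega>}
    \<le> fail_const * real t powr (- 6 / 5)"
proof -
  let ?a = "(t + 1) div 2"
  have t2: "2 \<le> t" "d < t" "d < ?a" using t by (auto simp: start_def)
  have L: "16 \<le> ln (real t)" by (rule start_log[OF t]) (use t2 in simp)
  have La: "16 \<le> ln (real ?a)" by (rule start_log[OF t order_refl])
  have q: "0 < quota t" using t2 by (intro quota_pos) simp
  have "prob {\<omega> \<in> space M. \<not> accurate t \<omega>} \<le> 2 * exp (- 2 * ln (real t))" by (rule accurate_prob[OF t2(2) L])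
  also have "\<dots> \<le> 2 * real t powr (- 6 / 5)" using t2 L by (simp add: powr_def)
  finally have 1: "prob {\<omega> \<in> space M. \<not> accurate t \<omega>} \<le> 2 * real t powr (- 6 / 5)" .
  have "prob {\<omega> \<in> space M. \<not> explored quota t \<omega>}
      \<le> (\<Sum>s = ?a..<t. 3 * exp (- (9 / 5 * ln (real s)))) / quota t
        + exp (3 * quota t - 3 / 5 * (\<Sum>s = ?a..<t. boost_prob s))"
    by (rule explored_prob[where quota = quota, OF t2(3) La half_range(4)[OF t2(1)] q start_conditions(1)[OF t]])
  also have "\<dots> \<le> 12 * real t powr (- 4 / 5) / quota t + exp (- quota t)"
  proof (intro add_mono divide_right_mono sum_powr_half_le t2(1))
    have "tail_const * (1 / 3 * real t powr (2 / 5)) \<le> tail_const * (\<Sum>s = ?a..<t. real s powr (- 3 / 5))"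
      using tail_const_pos by (intro mult_left_mono sum_powr_half_ge t2(1)) auto
    also have "\<dots> \<le> (\<Sum>s = ?a..<t. boost_prob s)"
      unfolding sum_distrib_left using half_range(3)[OF t2(1)] by (intro sum_mono boost_prob_ge) auto
    \<comment> \<open>The lower bound \<open>tail_const / 5 * t powr (2 / 5)\<close> subtracted in
      the exponent is exactly four quotas, one more than the three allowed.\<close>
    finally show "exp (3 * quota t - 3 / 5 * (\<Sum>s = ?a..<t. boost_prob s)) \<le> exp (- quota t)"
      by (simp add: quota_def field_simps)
  qed (use q in simp)
  also have "\<dots> \<le> 240 / tail_const * real t powr (- 6 / 5) + 27 * (20 / tail_const) ^ 3 * real t powr (- 6 / 5)"
  proof (rule add_mono)
    have "real t powr (- 4 / 5) = real t powr (- 6 / 5) * real t powr (2 / 5)"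
      by (simp add: powr_add[symmetric])
    then show "12 * real t powr (- 4 / 5) / quota t \<le> 240 / tail_const * real t powr (- 6 / 5)"
      using t2 tail_const_pos by (simp add: quota_def)
    have "real t powr (- 6 / 5) * (real t powr (2 / 5)) ^ 3 = 1"
      using t2 by (simp add: powr_powr powr_add[symmetric] flip: powr_realpow)
    then have "27 * (20 / tail_const) ^ 3 * real t powr (- 6 / 5) = 27 / quota t ^ 3"
      using t2 tail_const_pos by (simp add: quota_def power_mult_distrib power_divide field_simps)
    then show "exp (- quota t) \<le> 27 * (20 / tail_const) ^ 3 * real t powr (- 6 / 5)"
      using exp_minus_le_cube[OF q] by simp
  qed
  finally show ?thesis using 1 by (simp add: fail_const_def distrib_right)
qed

end

text \<open>The binomial theorem in each variable; the coefficients are \<open>K\<close> times five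
  binomial coefficients and do not depend on the problem.\<close>

lemma is_polynomial5_scale_power:
  "is_polynomial5 (\<lambda>x1 x2 x3 x4 x5. K * ((1 + x1) * (1 + x2) * (1 + x3) * (1 + x4) * (1 + x5)) ^ n)"
  unfolding is_polynomial5_def
proof (intro exI allI)
  fix x1 x2 x3 x4 x5 :: real
  have binom: "(1 + x) ^ n = (\<Sum>i\<le>n. real (n choose i) * x ^ i)" for x :: real
    using binomial_ring[of x 1 n] by (simp add: add.commute)
  let ?b = "\<lambda>i. real (n choose i)"
  have "(\<Sum>i1\<le>n. \<Sum>i2\<le>n. \<Sum>i3\<le>n. \<Sum>i4\<le>n. \<Sum>i5\<le>n.
      K * ?b i1 * ?b i2 * ?b i3 * ?b i4 * ?b i5 * x1 ^ i1 * x2 ^ i2 * x3 ^ i3 * x4 ^ i4 * x5 ^ i5)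
    = (\<Sum>i1\<le>n. \<Sum>i2\<le>n. \<Sum>i3\<le>n. \<Sum>i4\<le>n. \<Sum>i5\<le>n.
      K * ((?b i1 * x1 ^ i1) * ((?b i2 * x2 ^ i2) * ((?b i3 * x3 ^ i3) * ((?b i4 * x4 ^ i4) * (?b i5 * x5 ^ i5))))))"
    by (intro sum.cong refl) (simp only: mult_ac)
  also have "\<dots> = K * ((\<Sum>i\<le>n. ?b i * x1 ^ i) * ((\<Sum>i\<le>n. ?b i * x2 ^ i) * ((\<Sum>i\<le>n. ?b i * x3 ^ i)
      * ((\<Sum>i\<le>n. ?b i * x4 ^ i) * (\<Sum>i\<le>n. ?b i * x5 ^ i)))))"
    by (simp only: sum_distrib_left[symmetric] sum_distrib_right[symmetric])
  also have "\<dots> = K * ((1 + x1) * (1 + x2) * (1 + x3) * (1 + x4) * (1 + x5)) ^ n"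
    by (simp only: binom[symmetric] power_mult_distrib mult.assoc)
  finally show "K * ((1 + x1) * (1 + x2) * (1 + x3) * (1 + x4) * (1 + x5)) ^ n
    = (\<Sum>i1\<le>n. \<Sum>i2\<le>n. \<Sum>i3\<le>n. \<Sum>i4\<le>n. \<Sum>i5\<le>n.
      K * ?b i1 * ?b i2 * ?b i3 * ?b i4 * ?b i5 * x1 ^ i1 * x2 ^ i2 * x3 ^ i3 * x4 ^ i4 * x5 ^ i5)" ..
qed

definition start_const :: real where
  "start_const = (266000 / tail_const) ^ 4 + 1 + 2 * 3 ^ 16 + 4"

text \<open>The summands pay for the rounds before \<open>start\<close>, for the failing rounds, and
  for the \<open>d * m\<close> part of \<open>width\<close> (\<open>5320 = 40 * 133\<close>). For
  short horizons the last one offsets a negative \<open>ln (ln T)\<close>.\<close>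

definition poly_const :: real where
  "poly_const = start_const + round_const + 5320"

section \<open>Expected regret\<close>

context bg_cts_one
begin

lemma gap_act_measurable: "1 \<le> t \<Longrightarrow> (\<lambda>\<omega>. gap \<A> \<mu> (act t \<omega>)) \<in> borel_measurable M"
  by (rule measurable_compose[OF act_measurable]) simp_all

lemma regret_act: "regret M \<A> \<mu> A T = (\<integral>\<omega>. (\<Sum>t = 1..T. gap \<A> \<mu> (act t \<omega>)) \<partial>M)"
  unfolding regret_def
proof (rule Bochner_Integration.integral_cong_AE)
  have "(\<lambda>\<omega>. gap \<A> \<mu> (A t \<omega>)) \<in> borel_measurable M" if "1 \<le> t" for t
    by (rule measurable_compose[OF A_measurable[OF that]]) simp
  then show "(\<lambda>\<omega>. \<Sum>t = 1..T. gap \<A> \<mu> (A t \<omega>)) \<in> borel_measurable M"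
    by (intro borel_measurable_sum) auto
  show "(\<lambda>\<omega>. \<Sum>t = 1..T. gap \<A> \<mu> (act t \<omega>)) \<in> borel_measurable M"
    by (intro borel_measurable_sum gap_act_measurable) auto
  have "AE \<omega> in M. \<forall>t. 1 \<le> t \<longrightarrow> act t \<omega> = A t \<omega>"
    unfolding AE_all_countable using act_AE by auto
  then show "AE \<omega> in M. (\<Sum>t = 1..T. gap \<A> \<mu> (A t \<omega>)) = (\<Sum>t = 1..T. gap \<A> \<mu> (act t \<omega>))"
    by eventually_elim (auto intro!: sum.cong)
qed

lemma regret_le_integral:
  assumes B: "integrable M B" and le: "AE \<omega> in M. (\<Sum>t = 1..T. gap \<A> \<mu> (act t \<omega>)) \<le> B \<omega>"
  shows "regret M \<A> \<mu> A T \<le> (\<integral>\<omega>. B \<omega> \<partial>M)"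
  unfolding regret_act
proof (rule integral_mono_AE[OF _ B le])
  have bnd: "AE \<omega> in M. norm (\<Sum>t = 1..T. gap \<A> \<mu> (act t \<omega>)) \<le> real T * Dmax"
    using AE_regular
  proof eventually_elim
    case (elim \<omega>)
    have act: "act t \<omega> \<in> \<A>" if "1 \<le> t" for t using elim that by (simp add: regular_def)
    have "(\<Sum>t = 1..T. gap \<A> \<mu> (act t \<omega>)) \<le> (\<Sum>t = 1..T. Dmax)"
      by (intro sum_mono gap_le act) auto
    moreover have "0 \<le> (\<Sum>t = 1..T. gap \<A> \<mu> (act t \<omega>))"
      by (intro sum_nonneg gap_nonneg act) auto
    ultimately show ?case by simp
  qed
  show "integrable M (\<lambda>\<omega>. \<Sum>t = 1..T. gap \<A> \<mu> (act t \<omega>))"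
    by (rule integrable_const_bound[OF bnd]) (intro borel_measurable_sum gap_act_measurable, auto)
qed

lemma regret_trivial: "regret M \<A> \<mu> A T \<le> real T * Dmax"
proof -
  have "regret M \<A> \<mu> A T \<le> (\<integral>\<omega>. real T * Dmax \<partial>M)"
  proof (rule regret_le_integral)
    show "AE \<omega> in M. (\<Sum>t = 1..T. gap \<A> \<mu> (act t \<omega>)) \<le> real T * Dmax"
      using AE_regular
    proof eventually_elim
      case (elim \<omega>)
      have "(\<Sum>t = 1..T. gap \<A> \<mu> (act t \<omega>)) \<le> (\<Sum>t = 1..T. Dmax)"
        by (intro sum_mono gap_le) (use elim in \<open>auto simp: regular_def\<close>)
      then show ?case by simp
    qed
  qed simp
  then show ?thesis by (simp add: prob_space)
qed

text \<open>Rounds before \<open>start\<close> and failing rounds cost at most \<open>Dmax\<close>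
  each, and the expected number of failing rounds is bounded independently of \<open>T\<close>; all
  other rounds are charged to play counts.\<close>

lemma regret_late:
  assumes T: "start \<le> T"
  shows "regret M \<A> \<mu> A T \<le> real start * Dmax + Dmax * round_const
    + 40 * (real d * \<sigma>\<^sup>2 * width d m T * ln (real m) / D)"
proof -
  define bad where "bad t = {\<omega> \<in> space M. \<not> accurate t \<omega>} \<union> {\<omega> \<in> space M. \<not> explored quota t \<omega>}" for t
  define W where "W = 40 * (real d * \<sigma>\<^sup>2 * width d m T * ln (real m) / D)"
  have s1: "1 \<le> start" "d < start" by (simp_all add: start_def)
  have ev: "{\<omega> \<in> space M. \<not> accurate t \<omega>} \<in> events" "{\<omega> \<in> space M. \<not> explored quota t \<omega>} \<in> events" if "1 \<le> t" for t
    using accurate_event[OF that] explored_event[of quota t] by auto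
  have bad_ev: "bad t \<in> events" if "t \<in> {start..T}" for t unfolding bad_def using ev[of t] s1 that by auto
  let ?B = "\<lambda>\<omega>. real start * Dmax + W + Dmax * (\<Sum>t = start..T. indicator (bad t) \<omega>)"
  have int: "integrable M (\<lambda>\<omega>. indicator (bad t) \<omega> :: real)" if "t \<in> {start..T}" for t
    using bad_ev[OF that] by (simp add: emeasure_eq_measure)
  have intS: "integrable M (\<lambda>\<omega>. \<Sum>t = start..T. indicator (bad t) \<omega> :: real)"
    by (rule Bochner_Integration.integrable_sum) (rule int)
  have "regret M \<A> \<mu> A T \<le> (\<integral>\<omega>. ?B \<omega> \<partial>M)"
  proof (rule regret_le_integral)
    show "integrable M ?B" using intS by simp
    show "AE \<omega> in M. (\<Sum>t = 1..T. gap \<A> \<mu> (act t \<omega>)) \<le> ?B \<omega>"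
      using AE_regular AE_space
    proof eventually_elim
      case (elim \<omega>)
      have "(\<Sum>t = 1..T. gap \<A> \<mu> (act t \<omega>)) = (\<Sum>t = 1..<start. gap \<A> \<mu> (act t \<omega>)) + (\<Sum>t = start..T. gap \<A> \<mu> (act t \<omega>))"
      proof -
        have "{1..T} = {1..<start} \<union> {start..T}" "{1..<start} \<inter> {start..T} = {}" using T s1 by auto
        then show ?thesis by (simp only: sum.union_disjoint finite_atLeastAtMost finite_atLeastLessThan)
      qed
      also have "(\<Sum>t = 1..<start. gap \<A> \<mu> (act t \<omega>)) \<le> (\<Sum>t = 1..<start. Dmax)"
        by (intro sum_mono gap_le) (use elim in \<open>auto simp: regular_def\<close>)
      also have "\<dots> \<le> real start * Dmax" using Dmax_pos by simp
      also have "(\<Sum>t = start..T. gap \<A> \<mu> (act t \<omega>))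
          \<le> Dmax * (\<Sum>t = start..T. of_bool (\<not> accurate t \<omega> \<or> \<not> explored quota t \<omega>))
            + 10 * (real d * (4 * \<sigma>\<^sup>2 * width d m T) * ln (real m) / D)"
      proof (rule late_regret[OF elim(1) s1(2) _ T])
        show "16 \<le> ln (real start)" by (rule start_log[OF order_refl]) (simp add: start_def)
        show "0 < quota t \<and> 4 * \<sigma>\<^sup>2 * width d m t * real m \<le> D\<^sup>2 * quota t" if "start \<le> t" for t
          using start_conditions(2)[OF that] quota_pos[of t] s1 that by simp
      qed
      also have "(\<Sum>t = start..T. of_bool (\<not> accurate t \<omega> \<or> \<not> explored quota t \<omega>) :: real) = (\<Sum>t = start..T. indicator (bad t) \<omega>)"
        using elim(2) by (intro sum.cong) (auto simp: bad_def indicator_def)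
      finally show ?case by (simp add: W_def mult_ac)
    qed
  qed
  also have "\<dots> = real start * Dmax + W + Dmax * (\<Sum>t = start..T. prob (bad t))"
  proof -
    have "(\<integral>\<omega>. (\<Sum>t = start..T. indicator (bad t) \<omega>) \<partial>M) = (\<Sum>t = start..T. prob (bad t))"
      using bad_ev by (subst Bochner_Integration.integral_sum[OF int]) (auto intro!: sum.cong)
    then show ?thesis using intS by (simp add: prob_space)
  qed
  also have "(\<Sum>t = start..T. prob (bad t)) \<le> round_const"
  proof -
    have "(\<Sum>t = start..T. prob (bad t)) \<le> (\<Sum>t = start..T. fail_const * real t powr (- 6 / 5))"
    proof (rule sum_mono)
      fix t assume t: "t \<in> {start..T}"
      have "prob (bad t) \<le> prob {\<omega> \<in> space M. \<not> accurate t \<omega>} + prob {\<omega> \<in> space M. \<not> explored quota t \<omega>}"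
        unfolding bad_def using ev[of t] s1 t by (intro measure_Un_le) auto
      also have "\<dots> \<le> fail_const * real t powr (- 6 / 5)" using t by (intro round_failure) simp
      finally show "prob (bad t) \<le> fail_const * real t powr (- 6 / 5)" .
    qed
    also have "\<dots> \<le> round_const"
      unfolding sum_distrib_left[symmetric] round_const_def using fail_const_pos
      by (intro mult_left_mono sum_powr_le_suminf) auto
    finally show ?thesis .
  qed
  finally show ?thesis using Dmax_pos by (simp add: W_def mult_left_mono)
qed

lemma start_le: "real start \<le> start_const * scale ^ 24"
proof -
  have Y: "1 \<le> scale ^ 24" "scale \<le> scale ^ 24"
    using scale_bounds(1) by (simp_all add: self_le_power)
  define B where "B = (266000 / tail_const * scale ^ 6) ^ 4"
  have B: "0 \<le> B" "B = (266000 / tail_const) ^ 4 * scale ^ 24"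
    unfolding B_def by (simp_all only: power_mult_distrib power_mult[symmetric]) simp_all
  have "real (nat \<lceil>B\<rceil>) \<le> B + 1" using B(1) of_int_ceiling_le_add_one[of B] by simp
  then have "real start \<le> B + 1 + 2 * 3 ^ 16 + 2 * real d + 2"
    unfolding start_def B_def[symmetric] by simp
  then have "real start \<le> (266000 / tail_const) ^ 4 * scale ^ 24 + 1 + 2 * 3 ^ 16 + 2 * real d + 2"
    by (simp only: B(2))
  also have "\<dots> \<le> (266000 / tail_const) ^ 4 * scale ^ 24 + (1 + 2 * 3 ^ 16 + 2 + 2) * scale ^ 24"
  proof -
    have "real d \<le> scale ^ 24" using scale_bounds(5) Y by linarith
    then show ?thesis using Y by simp
  qed
  finally show ?thesis by (simp add: start_const_def distrib_right)
qed

lemma lnm_nonneg: "0 \<le> ln (real m)" and lnm_le: "ln (real m) \<le> real m"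
  using size_ge2 ln_le_minus_one[of "real m"] by auto

lemma cross_term_le: "\<sigma>\<^sup>2 * (real d)\<^sup>2 * real m * ln (real m) / D \<le> scale ^ 5"
proof -
  note sb = scale_bounds
  have Y0: "0 \<le> scale" using sb(1) by linarith
  have "\<sigma>\<^sup>2 * (real d)\<^sup>2 * real m * ln (real m) / D = \<sigma>\<^sup>2 * (real d * real m) * (real d * ln (real m)) * (1 / D)"
    by (simp add: power2_eq_square)
  also have "\<dots> \<le> scale\<^sup>2 * scale * scale * scale"
  proof (intro mult_mono sb)
    show "\<sigma>\<^sup>2 \<le> scale\<^sup>2" using sb sigma_nonneg by (intro power_mono) auto
    have "real d * ln (real m) \<le> real d * real m" using lnm_le by (intro mult_left_mono) auto
    then show "real d * ln (real m) \<le> scale" using sb(3) by linarith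
  qed (use Y0 lnm_nonneg D_pos in auto)
  finally show ?thesis by (simp add: power2_eq_square power_numeral_reduce)
qed

text \<open>From \<open>start\<close> on this is \<open>regret_late\<close> with
  \<open>width\<close> expanded; before it, the trivial bound is already polynomial.\<close>

lemma regret_bound:
  assumes T: "2 \<le> T"
  shows "regret M \<A> \<mu> A T
    \<le> 5320 * (\<sigma>\<^sup>2 * real d * ln (real m) / D) * ln (real T)
      + 5320 * (\<sigma>\<^sup>2 * (real d)\<^sup>2 * real m * ln (real m) / D) * ln (ln (real T))
      + poly_const * scale ^ 25"
proof -
  note sb = scale_bounds
  have Y0: "0 \<le> scale" using sb(1) by linarith
  let ?P = "\<sigma>\<^sup>2 * real d * ln (real m) / D" and ?Q = "\<sigma>\<^sup>2 * (real d)\<^sup>2 * real m * ln (real m) / D"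
  have P0: "0 \<le> ?P" and Q0: "0 \<le> ?Q" using lnm_nonneg D_pos by auto
  have Q: "?Q \<le> scale ^ 25" using cross_term_le power_increasing[of 5 25 scale] sb(1) by simp
  have sD: "real start * Dmax \<le> start_const * scale ^ 25"
  proof -
    have "real start * Dmax \<le> (start_const * scale ^ 24) * scale"
      using Dmax_pos start_le sb by (intro mult_mono) (auto intro: order_trans[OF _ start_le])
    then show ?thesis by (simp add: power_numeral_reduce mult_ac)
  qed
  have rD: "Dmax * round_const \<le> round_const * scale ^ 25"
  proof -
    have "Dmax \<le> scale ^ 25" using sb(1,7) self_le_power[of scale 25] by simp
    from mult_right_mono[OF this round_const_nonneg] show ?thesis by (simp only: mult.commute)
  qed
  show ?thesis
  proof (cases "start \<le> T")
    case True
    have L: "16 \<le> ln (real T)" by (rule start_log[OF True]) (use T in simp)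
    have lL: "0 \<le> ln (ln (real T))" using L by simp
    have eq: "?P * real d * real m = ?Q" by (simp add: power2_eq_square)
    have "40 * (real d * \<sigma>\<^sup>2 * width d m T * ln (real m) / D)
        = 5320 * (?P * ln (real T)) + 5320 * (?P * real d * ln (ln (real T))) + 5320 * (?P * real d * real m)"
      using D_pos by (simp add: width_def field_simps)
    then have "40 * (real d * \<sigma>\<^sup>2 * width d m T * ln (real m) / D)
        = 5320 * (?P * ln (real T)) + 5320 * (?P * real d * ln (ln (real T))) + 5320 * ?Q"
      by (simp only: eq)
    moreover have "?P * real d * ln (ln (real T)) \<le> ?Q * ln (ln (real T))"
    proof (rule mult_right_mono[OF _ lL])
      have "?P * real d * 1 \<le> ?P * real d * real m"
        by (rule mult_left_mono) (use size_ge2 mult_nonneg_nonneg[OF P0, of "real d"] in simp_all)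
      then show "?P * real d \<le> ?Q" by (simp only: eq mult_1_right)
    qed
    moreover have "w \<le> 5320 * a + 5320 * c + 5320 * y"
      if "w = 5320 * a + 5320 * b + 5320 * q" "b \<le> c" "q \<le> y" for a b c q w y :: real
      using that by simp
    ultimately have "40 * (real d * \<sigma>\<^sup>2 * width d m T * ln (real m) / D)
        \<le> 5320 * (?P * ln (real T)) + 5320 * (?Q * ln (ln (real T))) + 5320 * scale ^ 25"
      using Q by blast
    then show ?thesis using regret_late[OF True] sD rD unfolding poly_const_def by (simp add: distrib_right)
  next
    case False
    \<comment> \<open>For small \<open>T\<close> the \<open>ln (ln T)\<close> term is negative, but
      \<open>T \<ge> 2\<close> keeps \<open>ln (ln T)\<close> above -1, so the polynomial can absorb
      it.\<close>
    have "exp (- 1) \<le> ln (2 :: real)"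
    proof -
      have "(2 :: real) \<le> exp 1" using exp_ge_add_one_self[of 1] by simp
      then have "exp (- 1) \<le> (1 / 2 :: real)" by (simp add: exp_minus field_simps)
      then show ?thesis using ln2_ge_two_thirds by simp
    qed
    also have "ln 2 \<le> ln (real T)" using T by simp
    finally have "- 1 \<le> ln (ln (real T))"
      using T by (subst ln_ge_iff) auto
    then have "?Q * (- 1) \<le> ?Q * ln (ln (real T))" by (rule mult_left_mono[OF _ Q0])
    then have neg: "- (scale ^ 25) \<le> ?Q * ln (ln (real T))" using Q by simp
    have "real T * Dmax \<le> real start * Dmax" using False Dmax_pos by (intro mult_right_mono) auto
    moreover have "0 \<le> 5320 * ?P * ln (real T)"
      by (intro mult_nonneg_nonneg P0) (use T in simp_all)
    moreover have "0 \<le> round_const * scale ^ 25" using round_const_nonneg Y0 by simp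
    ultimately show ?thesis using regret_trivial[of T] sD neg unfolding poly_const_def
      by (simp add: distrib_right)
  qed
qed

end

theorem theorem1:
  shows "\<exists>(C :: real) (C' :: real) (P :: real \<Rightarrow> real \<Rightarrow> real \<Rightarrow> real \<Rightarrow> real \<Rightarrow> real).
    0 < C \<and> 0 < C' \<and> is_polynomial5 P \<and>
    (\<forall>(M :: (nat \<times> nat \<times> nat \<Rightarrow> real) measure) (d :: nat) \<A> \<mu> \<sigma> X init Z U A (T :: nat).
       bg_cts_run M d \<A> \<mu> \<sigma> X 1 init Z U A \<longrightarrow>
       2 \<le> max_size \<A> \<longrightarrow>
       (\<exists>B\<in>\<A>. 0 < gap \<A> \<mu> B) \<longrightarrow>
       2 \<le> T \<longrightarrow>
       regret M \<A> \<mu> A T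
         \<le> C * (\<sigma>\<^sup>2 * real d * ln (real (max_size \<A>)) / gap_min \<A> \<mu>) * ln (real T)
           + C' * (\<sigma>\<^sup>2 * (real d)\<^sup>2 * real (max_size \<A>) * ln (real (max_size \<A>)) / gap_min \<A> \<mu>)
               * ln (ln (real T))
           + P (real (max_size \<A>)) (real d) (1 / gap_min \<A> \<mu>) (gap_max \<A> \<mu>) \<sigma>)"
proof -
  \<comment> \<open>The degree 25 is 24 from the fourth power of \<open>scale ^ 6\<close> in
    \<open>start\<close>, plus 1 for the factor \<open>Dmax\<close>.\<close>
  let ?P = "\<lambda>x1 x2 x3 x4 x5. poly_const * ((1 + x1) * (1 + x2) * (1 + x3) * (1 + x4) * (1 + x5)) ^ 25"
  have bound: "regret M \<A> \<mu> A T
         \<le> 5320 * (\<sigma>\<^sup>2 * real d * ln (real (max_size \<A>)) / gap_min \<A> \<mu>) * ln (real T)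
           + 5320 * (\<sigma>\<^sup>2 * (real d)\<^sup>2 * real (max_size \<A>) * ln (real (max_size \<A>)) / gap_min \<A> \<mu>)
               * ln (ln (real T))
           + ?P (real (max_size \<A>)) (real d) (1 / gap_min \<A> \<mu>) (gap_max \<A> \<mu>) \<sigma>"
    if "bg_cts_run M d \<A> \<mu> \<sigma> X 1 init Z U A" "2 \<le> max_size \<A>" "\<exists>B\<in>\<A>. 0 < gap \<A> \<mu> B" "2 \<le> T"
    for M :: "(nat \<times> nat \<times> nat \<Rightarrow> real) measure" and d \<A> \<mu> \<sigma> X init Z U A T
  proof -
    interpret bg_cts_one M d \<A> \<mu> \<sigma> X init Z U A
      using that(1-3) by (simp add: bg_cts_one_def bg_cts_one_axioms_def)
    show ?thesis using regret_bound[OF that(4)] by (simp add: scale_def)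
  qed
  show ?thesis
    by (rule exI[of _ 5320], rule exI[of _ 5320], rule exI[of _ ?P])
      (use is_polynomial5_scale_power[of poly_const 25] bound in simp)
qed

end
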